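(* Let $\sigma\ge1$, $\delta\in(0,\frac\sigma2)$ and $m\in[1,2)$. For every space dimension $n\ge1$, every $a\ge0$ and $j\in\{0,1\}$, the Sobolev solutions $w$ to $$w_{tt}+(-\Delta)^\sigma w+(-\Delta)^\delta w_t=0,\quad w(0,x)=w_0(x),\quad w_t(0,x)=w_1(x)\qquad (t\ge0,\ x\in\mathbb{R}^n)$$ satisfy the $(L^m\cap L^2)-L^2$ estimates $$\big\|\partial_t^j|D|^aw(t,\cdot)\big\|_{L^2}\lesssim(1+t)^{-\frac{n}{2(\sigma-\delta)}(\frac1m-\frac12)-\frac{a+2j\delta}{2(\sigma-\delta)}}\|w_0\|_{L^m\cap H^{a+j\sigma}}+(1+t)^{1-\frac{n}{2(\sigma-\delta)}(\frac1m-\frac12)-\frac{a+2j\delta}{2(\sigma-\delta)}}\|w_1\|_{L^m\cap H^{[a+(j-1)\sigma]^+}},$$ and the $L^2-L^2$ estimates $$\big\|\partial_t^j|D|^aw(t,\cdot)\big\|_{L^2}\lesssim(1+t)^{-\frac{a+2j\delta}{2(\sigma-\delta)}}\|w_0\|_{H^{a+j\sigma}}+(1+t)^{1-\frac{a+2j\delta}{2(\sigma-\delta)}}\|w_1\|_{H^{[a+(j-1)\sigma]^+}}.$$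
   Context: $[s]^+:=\max\{s,0\}$; $H^a$ is the $L^2$-based Bessel potential space on $\mathbb{R}^n$; $|D|^a$ and $(-\Delta)^a$ are the Fourier multipliers with symbols $|\xi|^a$ and $|\xi|^{2a}$; $\|\cdot\|_{L^m\cap H^s}=\|\cdot\|_{L^m}+\|\cdot\|_{H^s}$; $f\lesssim g$ means $f\le Cg$ with $C>0$ independent of $t\ge0$ and of the data. The solution is the one given on the Fourier side by $\hat w=\frac{\lambda_1e^{\lambda_2t}-\lambda_2e^{\lambda_1t}}{\lambda_1-\lambda_2}\hat w_0+\frac{e^{\lambda_1t}-e^{\lambda_2t}}{\lambda_1-\lambda_2}\hat w_1$, $\lambda_{1,2}=\frac12\big(-|\xi|^{2\delta}\pm\sqrt{|\xi|^{4\delta}-4|\xi|^{2\sigma}}\big)$ (limiting values where $\lambda_1=\lambda_2$); the data are any functions for which the norms on the right-hand side are finite. *)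

theory Defs
  imports "HOL-Analysis.Analysis"
begin

text \<open>
  Elements of \<open>L\<^sup>p\<close> are represented by Borel functions; every class modulo null sets has
  such a representative. All notions below are invariant under changes on null sets.
\<close>

definition Lp :: "real \<Rightarrow> ('a::euclidean_space \<Rightarrow> complex) set" where
  "Lp p = {f \<in> borel_measurable lborel. integrable lborel (\<lambda>x. norm (f x) powr p)}"

definition Lp_norm :: "real \<Rightarrow> ('a::euclidean_space \<Rightarrow> complex) \<Rightarrow> real" where
  "Lp_norm p f = (LINT x|lborel. norm (f x) powr p) powr (1 / p)"

text \<open>The membership condition is needed because \<^term>\<open>Lp_norm p f\<close> is \<open>0\<close>, not infinite,
  when the integral diverges.\<close>

definition tendsto_Lp ::
  "real \<Rightarrow> ('i \<Rightarrow> 'a::euclidean_space \<Rightarrow> complex) \<Rightarrow> ('a \<Rightarrow> complex) \<Rightarrow> 'i filter \<Rightarrow> bool" where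
  "tendsto_Lp p F f \<Phi> \<longleftrightarrow>
     (\<forall>\<^sub>F k in \<Phi>. (\<lambda>x. F k x - f x) \<in> Lp p) \<and>
     ((\<lambda>k. Lp_norm p (\<lambda>x. F k x - f x)) \<longlongrightarrow> 0) \<Phi>"

definition fourier_L1 :: "('a::euclidean_space \<Rightarrow> complex) \<Rightarrow> 'a \<Rightarrow> complex" where
  "fourier_L1 f \<xi> =
     ((2 * pi) powr (- (real DIM('a) / 2))) *\<^sub>R (LINT x|lborel. cis (- (x \<bullet> \<xi>)) * f x)"

text \<open>Plancherel extension to \<open>L\<^sup>2\<close>: the limit in \<open>L\<^sup>2\<close> of the transforms of approximants
  from \<open>L\<^sup>1 \<inter> L\<^sup>2\<close>. The transform \<^term>\<open>g\<close> is determined up to a null set.\<close>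

definition is_fourier_L2 ::
  "('a::euclidean_space \<Rightarrow> complex) \<Rightarrow> ('a \<Rightarrow> complex) \<Rightarrow> bool" where
  "is_fourier_L2 f g \<longleftrightarrow> f \<in> Lp 2 \<and> g \<in> Lp 2 \<and>
     (\<exists>h :: nat \<Rightarrow> 'a \<Rightarrow> complex. (\<forall>k. h k \<in> Lp 1 \<inter> Lp 2) \<and>
        tendsto_Lp 2 h f sequentially \<and>
        tendsto_Lp 2 (\<lambda>k. fourier_L1 (h k)) g sequentially)"

text \<open>By Plancherel's theorem the choices below have a witness for every argument in
  \<open>L\<^sup>2\<close>; outside \<open>L\<^sup>2\<close> the values are unspecified.\<close>

definition fourier :: "('a::euclidean_space \<Rightarrow> complex) \<Rightarrow> 'a \<Rightarrow> complex" where
  "fourier f = (SOME g. is_fourier_L2 f g)"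

definition inv_fourier :: "('a::euclidean_space \<Rightarrow> complex) \<Rightarrow> 'a \<Rightarrow> complex" where
  "inv_fourier g = (SOME f. is_fourier_L2 f g)"

definition fourier_multiplier ::
  "('a::euclidean_space \<Rightarrow> complex) \<Rightarrow> ('a \<Rightarrow> complex) \<Rightarrow> 'a \<Rightarrow> complex" where
  "fourier_multiplier p f = inv_fourier (\<lambda>\<xi>. p \<xi> * fourier f \<xi>)"

text \<open>For \<open>a = 0\<close> the symbol is \<open>0\<close> instead of \<open>1\<close> at the single point \<open>\<xi> = 0\<close>
  (a null set), since \<open>0 powr 0 = 0\<close>.\<close>

definition abs_D :: "real \<Rightarrow> ('a::euclidean_space \<Rightarrow> complex) \<Rightarrow> 'a \<Rightarrow> complex" where
  "abs_D a = fourier_multiplier (\<lambda>\<xi>. of_real (norm \<xi> powr a))"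

definition bessel_weight :: "real \<Rightarrow> ('a::euclidean_space \<Rightarrow> complex) \<Rightarrow> 'a \<Rightarrow> complex" where
  "bessel_weight s f \<xi> = of_real ((1 + (norm \<xi>)\<^sup>2) powr (s / 2)) * fourier f \<xi>"

text \<open>Only the case \<open>s \<ge> 0\<close> is intended, where \<open>H\<^sup>s\<close> is a subspace of \<open>L\<^sup>2\<close>.
  As \<^const>\<open>fourier\<close> is unitary, the norm is that of the Bessel potential
  \<open>(1 - \<Delta>)\<close> to the power \<open>s/2\<close> applied to \<open>f\<close>.\<close>

definition Hs :: "real \<Rightarrow> ('a::euclidean_space \<Rightarrow> complex) set" where
  "Hs s = {f \<in> Lp 2. bessel_weight s f \<in> Lp 2}"

definition Hs_norm :: "real \<Rightarrow> ('a::euclidean_space \<Rightarrow> complex) \<Rightarrow> real" where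
  "Hs_norm s f = Lp_norm 2 (bessel_weight s f)"

definition Lp_Hs_norm :: "real \<Rightarrow> real \<Rightarrow> ('a::euclidean_space \<Rightarrow> complex) \<Rightarrow> real" where
  "Lp_Hs_norm m s f = Lp_norm m f + Hs_norm s f"

text \<open>The characteristic roots as functions of \<open>r = |\<xi>|\<close>.\<close>

definition char_disc :: "real \<Rightarrow> real \<Rightarrow> real \<Rightarrow> complex" where
  "char_disc \<sigma> \<delta> r = csqrt (of_real (r powr (4 * \<delta>) - 4 * r powr (2 * \<sigma>)))"

definition lambda1 :: "real \<Rightarrow> real \<Rightarrow> real \<Rightarrow> complex" where
  "lambda1 \<sigma> \<delta> r = (- of_real (r powr (2 * \<delta>)) + char_disc \<sigma> \<delta> r) / 2"

definition lambda2 :: "real \<Rightarrow> real \<Rightarrow> real \<Rightarrow> complex" where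
  "lambda2 \<sigma> \<delta> r = (- of_real (r powr (2 * \<delta>)) - char_disc \<sigma> \<delta> r) / 2"

text \<open>The first branch of each kernel is the limit of the second one as the roots coalesce.\<close>

definition kernel0 :: "real \<Rightarrow> real \<Rightarrow> real \<Rightarrow> real \<Rightarrow> complex" where
  "kernel0 \<sigma> \<delta> t r =
     (let l1 = lambda1 \<sigma> \<delta> r; l2 = lambda2 \<sigma> \<delta> r in
      if l1 = l2 then (1 - l1 * of_real t) * exp (l1 * of_real t)
      else (l1 * exp (l2 * of_real t) - l2 * exp (l1 * of_real t)) / (l1 - l2))"

definition kernel1 :: "real \<Rightarrow> real \<Rightarrow> real \<Rightarrow> real \<Rightarrow> complex" where
  "kernel1 \<sigma> \<delta> t r =
     (let l1 = lambda1 \<sigma> \<delta> r; l2 = lambda2 \<sigma> \<delta> r in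
      if l1 = l2 then of_real t * exp (l1 * of_real t)
      else (exp (l1 * of_real t) - exp (l2 * of_real t)) / (l1 - l2))"

definition sobolev_solution ::
  "real \<Rightarrow> real \<Rightarrow> ('a::euclidean_space \<Rightarrow> complex) \<Rightarrow> ('a \<Rightarrow> complex) \<Rightarrow> real \<Rightarrow> 'a \<Rightarrow> complex" where
  "sobolev_solution \<sigma> \<delta> w\<^sub>0 w\<^sub>1 t =
     inv_fourier (\<lambda>\<xi>. kernel0 \<sigma> \<delta> t (norm \<xi>) * fourier w\<^sub>0 \<xi> + kernel1 \<sigma> \<delta> t (norm \<xi>) * fourier w\<^sub>1 \<xi>)"

text \<open>\<open>has_time_deriv j u v\<close>: on \<open>[0,\<infinity>)\<close> the curve \<open>u\<close> is \<open>j\<close> times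
  differentiable as an \<open>L\<^sup>2\<close>-valued function (one-sidedly at \<open>0\<close>), with \<open>j\<close>-th derivative
  \<open>v\<close>. For each \<open>t\<close>, \<open>v t\<close> is determined up to a null set.\<close>

primrec has_time_deriv ::
  "nat \<Rightarrow> (real \<Rightarrow> 'a::euclidean_space \<Rightarrow> complex) \<Rightarrow> (real \<Rightarrow> 'a \<Rightarrow> complex) \<Rightarrow> bool" where
  "has_time_deriv 0 u v \<longleftrightarrow>
     (\<forall>t\<ge>0. u t \<in> Lp 2 \<and> v t \<in> Lp 2 \<and> (AE x in lborel. v t x = u t x))"
| "has_time_deriv (Suc j) u v \<longleftrightarrow>
     (\<exists>u'. has_time_deriv j u u' \<and>
       (\<forall>t\<ge>0. v t \<in> Lp 2 \<and>
          tendsto_Lp 2 (\<lambda>s x. (u' s x - u' t x) / of_real (s - t)) (v t) (at t within {0..})))"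

end

theory Submission
  imports Defs "HOL-Probability.Characteristic_Functions"
begin

text \<open>
  On the Fourier side the equation is, for each frequency \<open>r = |\<xi>|\<close>, a damped oscillator with
  characteristic roots \<open>\<lambda>\<^sub>1, \<lambda>\<^sub>2\<close>. The whole proof rests on two representations of its
  fundamental solutions. First, \<open>K\<^sub>1\<close> is a divided difference of exponentials, so
  \<open>|K\<^sub>1| \<le> t exp (t Re \<lambda>\<^sub>1)\<close> with no singularity where the roots coalesce, and
  \<open>K\<^sub>0 = exp (\<lambda>\<^sub>1 t) - \<lambda>\<^sub>1 K\<^sub>1\<close>. Second, the time derivatives are
  \<open>K\<^sub>0' = - r\<^bsup>2\<sigma>\<^esup> K\<^sub>1\<close> and \<open>K\<^sub>1' = K\<^sub>0 - r\<^bsup>2\<delta>\<^esup> K\<^sub>1\<close>. Because \<open>\<delta> < \<sigma>/2\<close>, for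
  \<open>r \<le> 1\<close> the dominant root has real part at most \<open>- r\<^bsup>\<theta>\<^esup>/2\<close> and modulus at most \<open>2 r\<^bsup>\<theta>\<^esup>\<close> with
  \<open>\<theta> = 2(\<sigma> - \<delta>)\<close>, as in a heat flow of order \<open>\<theta>\<close>: each factor \<open>r\<^sup>b\<close> is worth
  \<open>(1 + t)\<^bsup>-b/\<theta>\<^esup>\<close>. For \<open>r \<ge> 1\<close> the roots are
  complex, have modulus \<open>r\<^sup>\<sigma>\<close> and real part at most \<open>-1/2\<close>, so everything decays exponentially at the
  price of the stated regularity of the data. Both regimes are summarised in \<open>time_kernel_bound\<close>.

  The estimates with \<open>L\<^sup>2\<close> data follow by multiplying this bound with the Fourier transforms of
  the data. For \<open>L\<^sup>m\<close> data the low frequencies need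
  \<open>\<integral> exp (- s |\<xi>|\<^sup>2) |w^|\<^sup>2 \<le> C s\<^bsup>-q/2\<^esup> \<parallel>w\<parallel>\<^sub>m\<^sup>2\<close> with \<open>q = n (2/m - 1)\<close>. A Gaussian has an explicit
  Fourier transform, so the left side is a double integral of \<open>w\<close> against a Gaussian kernel, and
  the case needed of Young's convolution inequality is a pointwise weighted inequality between
  arithmetic and geometric means (\<open>bilinear_young\<close>). The profile
  \<open>exp (- |\<xi>|\<^bsup>\<theta>\<^esup> t)\<close> is then dominated by a series of dilated Gaussians
  (\<open>exp_powr_dyadic\<close>). The same Gaussian inequality with \<open>m = 2\<close> bounds the Fourier transform on
  \<open>L\<^sup>2\<close>, and Gaussian averages give its inversion; together they provide the \<open>L\<^sup>2\<close> theory of the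
  transform on which all definitions depend (\<open>is_fourier_L2_exists\<close>, \<open>is_fourier_L2_inverse\<close>).
  Since the estimates are claimed up to constants, norms are only ever compared up to fixed factors.

  Finally the time derivative exists in \<open>L\<^sup>2\<close> by dominated convergence of the difference quotients
  on the Fourier side, the mean value theorem supplying the dominating function
  (\<open>solution_time_deriv\<close>).
\<close>

section \<open>The squared norm of L2 functions\<close>

text \<open>
  The square of the \<open>L\<^sup>2\<close> norm as an extended number: its rules then hold for all measurable functions,
  and the bound \<open>nsq_add_le\<close> stands in for the triangle inequality.
\<close>

definition nsq :: "('a::euclidean_space \<Rightarrow> complex) \<Rightarrow> ennreal" where
  "nsq f = (\<integral>\<^sup>+x. ennreal ((norm (f x))\<^sup>2) \<partial>lborel)"

lemma norm_powr_2: "norm (z::complex) powr 2 = (norm z)\<^sup>2"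
  by (cases "z = 0") (auto simp: powr_numeral)

lemma Lp2_iff: "f \<in> Lp 2 \<longleftrightarrow> f \<in> borel_measurable borel \<and> nsq f < \<infinity>"
  by (auto simp: Lp_def nsq_def integrable_iff_bounded norm_powr_2)

lemma Lp2_measurable [measurable_dest]: "f \<in> Lp 2 \<Longrightarrow> f \<in> borel_measurable borel"
  by (simp add: Lp2_iff)

lemma Lp_norm_2:
  assumes [measurable]: "f \<in> borel_measurable borel"
  shows "Lp_norm 2 f = sqrt (enn2real (nsq f))"
  unfolding Lp_norm_def nsq_def
  by (subst integral_eq_nn_integral) (auto simp: norm_powr_2 powr_half_sqrt)

lemma nsq_mono_AE:
  assumes "AE x in lborel. norm (f x) \<le> norm (g x)"
  shows "nsq f \<le> nsq g"
  unfolding nsq_def using assms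
  by (intro nn_integral_mono_AE) (auto elim!: eventually_mono intro!: ennreal_leI power_mono)

lemma nsq_cong_AE:
  assumes "AE x in lborel. f x = g x"
  shows "nsq f = nsq g"
  using assms by (intro antisym nsq_mono_AE) (auto elim!: eventually_mono)

lemma nsq_add_le:
  assumes [measurable]: "f \<in> borel_measurable borel" "g \<in> borel_measurable borel"
  shows "nsq (\<lambda>x. f x + g x) \<le> 2 * nsq f + 2 * nsq g"
proof -
  have "(norm (f x + g x))\<^sup>2 \<le> 2 * (norm (f x))\<^sup>2 + 2 * (norm (g x))\<^sup>2" for x
  proof -
    have "(norm (f x + g x))\<^sup>2 \<le> (norm (f x) + norm (g x))\<^sup>2"
      by (intro power_mono norm_triangle_ineq) auto
    also have "\<dots> \<le> 2 * (norm (f x))\<^sup>2 + 2 * (norm (g x))\<^sup>2"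
      using sum_squares_bound[of "norm (f x)" "norm (g x)"] by (simp add: power2_sum)
    finally show ?thesis .
  qed
  then have "nsq (\<lambda>x. f x + g x)
      \<le> (\<integral>\<^sup>+x. 2 * ennreal ((norm (f x))\<^sup>2) + 2 * ennreal ((norm (g x))\<^sup>2) \<partial>lborel)"
    unfolding nsq_def
    by (intro nn_integral_mono) (simp flip: ennreal_plus ennreal_numeral ennreal_mult add: ennreal_leI)
  also have "\<dots> = 2 * nsq f + 2 * nsq g"
    by (simp add: nn_integral_add nn_integral_cmult nsq_def)
  finally show ?thesis .
qed

lemma nsq_uminus: "nsq (\<lambda>x. - f x) = nsq f"
  by (simp add: nsq_def)

lemma nsq_minus_commute: "nsq (\<lambda>x. f x - g x) = nsq (\<lambda>x. g x - f x)"
  by (simp add: nsq_def norm_minus_commute)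

lemma nsq_diff_le:
  assumes "f \<in> borel_measurable borel" "g \<in> borel_measurable borel"
  shows "nsq (\<lambda>x. f x - g x) \<le> 2 * nsq f + 2 * nsq g"
  using nsq_add_le[of f "\<lambda>x. - g x"] assms by (simp add: nsq_uminus)

lemma nsq_triangle:
  assumes "f \<in> borel_measurable borel" "g \<in> borel_measurable borel" "h \<in> borel_measurable borel"
  shows "nsq (\<lambda>x. f x - h x) \<le> 2 * nsq (\<lambda>x. f x - g x) + 2 * nsq (\<lambda>x. g x - h x)"
  using nsq_add_le[of "\<lambda>x. f x - g x" "\<lambda>x. g x - h x"] assms by simp

lemma nsq_cmult:
  assumes [measurable]: "f \<in> borel_measurable borel"
  shows "nsq (\<lambda>x. c * f x) = ennreal ((norm c)\<^sup>2) * nsq f"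
  by (simp add: nsq_def norm_mult power_mult_distrib ennreal_mult nn_integral_cmult)

lemma nsq_eq_0_AE:
  assumes [measurable]: "f \<in> borel_measurable borel" and "nsq f = 0"
  shows "AE x in lborel. f x = 0"
  using assms(2) by (simp add: nsq_def nn_integral_0_iff_AE)

lemma nn_integral_lborel_uminus:
  fixes f :: "'a::euclidean_space \<Rightarrow> ennreal"
  assumes [measurable]: "f \<in> borel_measurable borel"
  shows "(\<integral>\<^sup>+x. f (- x) \<partial>lborel) = (\<integral>\<^sup>+x. f x \<partial>lborel)"
  by (subst (2) lborel_affine[of "-1" 0])
     (simp_all add: nn_integral_density nn_integral_distr)

lemma nsq_reflect:
  assumes [measurable]: "f \<in> borel_measurable borel"
  shows "nsq (\<lambda>x. f (- x)) = nsq f"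
  unfolding nsq_def by (rule nn_integral_lborel_uminus) measurable

lemma Lp2_add: "f \<in> Lp 2 \<Longrightarrow> g \<in> Lp 2 \<Longrightarrow> (\<lambda>x. f x + g x) \<in> Lp 2"
  using nsq_add_le[of f g] unfolding Lp2_iff
  by (auto simp: ennreal_mult_less_top less_top[symmetric] top_unique ennreal_mult_eq_top_iff)

lemma Lp2_cmult: "f \<in> Lp 2 \<Longrightarrow> (\<lambda>x. c * f x) \<in> Lp 2"
  unfolding Lp2_iff by (auto simp: nsq_cmult ennreal_mult_less_top)

lemma Lp2_diff: "f \<in> Lp 2 \<Longrightarrow> g \<in> Lp 2 \<Longrightarrow> (\<lambda>x. f x - g x) \<in> Lp 2"
  using Lp2_add[of f "\<lambda>x. (-1) * g x"] Lp2_cmult[of g "-1"] by simp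

lemma Lp2_reflect: "f \<in> Lp 2 \<Longrightarrow> (\<lambda>x. f (- x)) \<in> Lp 2"
  unfolding Lp2_iff by (auto simp: nsq_reflect)

lemma Lp2_bound:
  assumes "g \<in> Lp 2" "f \<in> borel_measurable borel" "AE x in lborel. norm (f x) \<le> norm (g x)"
  shows "f \<in> Lp 2"
  using assms nsq_mono_AE[of f g] by (auto simp: Lp2_iff intro: le_less_trans)

text \<open>
  Moving between the real norm, which is only meaningful on \<open>L\<^sup>2\<close>, and the extended one, which
  obeys limit theorems without side conditions.
\<close>

lemma tendsto_Lp2_iff:
  "tendsto_Lp 2 F f \<Phi> \<longleftrightarrow>
     (\<forall>\<^sub>F k in \<Phi>. (\<lambda>x. F k x - f x) \<in> Lp 2) \<and> ((\<lambda>k. nsq (\<lambda>x. F k x - f x)) \<longlongrightarrow> 0) \<Phi>"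
proof -
  have eq: "\<forall>\<^sub>F k in \<Phi>. Lp_norm 2 (\<lambda>x. F k x - f x) = sqrt (enn2real (nsq (\<lambda>x. F k x - f x)))"
    if "\<forall>\<^sub>F k in \<Phi>. (\<lambda>x. F k x - f x) \<in> Lp 2"
    using that by eventually_elim (simp add: Lp_norm_2 Lp2_measurable)
  have eq': "\<forall>\<^sub>F k in \<Phi>. ennreal ((sqrt (enn2real (nsq (\<lambda>x. F k x - f x))))\<^sup>2) = nsq (\<lambda>x. F k x - f x)"
    if "\<forall>\<^sub>F k in \<Phi>. (\<lambda>x. F k x - f x) \<in> Lp 2"
    using that by eventually_elim (auto simp: Lp2_iff)
  have "((\<lambda>k. Lp_norm 2 (\<lambda>x. F k x - f x)) \<longlongrightarrow> 0) \<Phi> \<longleftrightarrow> ((\<lambda>k. nsq (\<lambda>x. F k x - f x)) \<longlongrightarrow> 0) \<Phi>"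
    if ev: "\<forall>\<^sub>F k in \<Phi>. (\<lambda>x. F k x - f x) \<in> Lp 2"
  proof -
    have "((\<lambda>k. Lp_norm 2 (\<lambda>x. F k x - f x)) \<longlongrightarrow> 0) \<Phi> \<longleftrightarrow>
        ((\<lambda>k. sqrt (enn2real (nsq (\<lambda>x. F k x - f x)))) \<longlongrightarrow> 0) \<Phi>"
      by (rule tendsto_cong[OF eq[OF ev]])
    also have "\<dots> \<longleftrightarrow> ((\<lambda>k. nsq (\<lambda>x. F k x - f x)) \<longlongrightarrow> 0) \<Phi>"
    proof
      assume "((\<lambda>k. sqrt (enn2real (nsq (\<lambda>x. F k x - f x)))) \<longlongrightarrow> 0) \<Phi>"
      from tendsto_ennrealI[OF tendsto_power[OF this, of 2]]
      have "((\<lambda>k. ennreal ((sqrt (enn2real (nsq (\<lambda>x. F k x - f x))))\<^sup>2)) \<longlongrightarrow> 0) \<Phi>" by simp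
      then show "((\<lambda>k. nsq (\<lambda>x. F k x - f x)) \<longlongrightarrow> 0) \<Phi>"
        by (subst (asm) tendsto_cong[OF eq'[OF ev]])
    next
      assume "((\<lambda>k. nsq (\<lambda>x. F k x - f x)) \<longlongrightarrow> 0) \<Phi>"
      then have "((\<lambda>k. nsq (\<lambda>x. F k x - f x)) \<longlongrightarrow> ennreal 0) \<Phi>" by simp
      from tendsto_real_sqrt[OF tendsto_enn2real[OF this]]
      show "((\<lambda>k. sqrt (enn2real (nsq (\<lambda>x. F k x - f x)))) \<longlongrightarrow> 0) \<Phi>" by simp
    qed
    finally show ?thesis .
  qed
  then show ?thesis unfolding tendsto_Lp_def by blast
qed

lemma nsq_Fatou:
  assumes [measurable]: "\<And>k::nat. u k \<in> borel_measurable borel"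
    and lim: "AE x in lborel. (\<lambda>k. u k x) \<longlonglongrightarrow> v x"
  shows "nsq v \<le> liminf (\<lambda>k. nsq (u k))"
proof -
  have "nsq v = (\<integral>\<^sup>+x. liminf (\<lambda>k. ennreal ((norm (u k x))\<^sup>2)) \<partial>lborel)"
    unfolding nsq_def
  proof (intro nn_integral_cong_AE, use lim in eventually_elim)
    case (elim x)
    then have "(\<lambda>k. ennreal ((norm (u k x))\<^sup>2)) \<longlonglongrightarrow> ennreal ((norm (v x))\<^sup>2)"
      by (intro tendsto_intros)
    then show ?case by (intro lim_imp_Liminf[symmetric]) auto
  qed
  also have "\<dots> \<le> liminf (\<lambda>k. nsq (u k))"
    unfolding nsq_def by (rule nn_integral_liminf) simp
  finally show ?thesis .
qed

lemma nsq_dominated: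
  assumes [measurable]: "\<And>k::nat. u k \<in> borel_measurable borel"
    and w: "w \<in> Lp 2" and bnd: "\<And>k. AE x in lborel. norm (u k x) \<le> norm (w x)"
    and lim: "AE x in lborel. (\<lambda>k. u k x) \<longlonglongrightarrow> 0"
  shows "(\<lambda>k. nsq (u k)) \<longlonglongrightarrow> 0"
proof -
  have [measurable]: "w \<in> borel_measurable borel" and fin: "nsq w < \<infinity>" using w by (auto simp: Lp2_iff)
  have "(\<lambda>k. \<integral>\<^sup>+x. ennreal ((norm (u k x))\<^sup>2) \<partial>lborel) \<longlonglongrightarrow> (\<integral>\<^sup>+(x::'a). 0 \<partial>lborel)"
  proof (rule nn_integral_dominated_convergence[where w="\<lambda>x. ennreal ((norm (w x))\<^sup>2)"])
    show "AE x in lborel. ennreal ((norm (u k x))\<^sup>2) \<le> ennreal ((norm (w x))\<^sup>2)" for k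
      using bnd[of k] by eventually_elim (intro ennreal_leI power_mono, auto)
    show "AE x in lborel. (\<lambda>k. ennreal ((norm (u k x))\<^sup>2)) \<longlonglongrightarrow> 0"
      using lim
    proof eventually_elim
      case (elim x)
      from tendsto_ennrealI[OF tendsto_power[OF tendsto_norm[OF elim], of 2]] show ?case by simp
    qed
    show "(\<integral>\<^sup>+x. ennreal ((norm (w x))\<^sup>2) \<partial>lborel) < \<infinity>" using fin by (simp add: nsq_def)
  qed auto
  then show ?thesis by (simp add: nsq_def)
qed

lemma ennreal_term_le_suminf: "f k \<le> (\<Sum>k. f k)" for f :: "nat \<Rightarrow> ennreal"
  using sum_le_suminf[of f "{k}"] by simp

text \<open>
  The Riesz-Fischer theorem for sequences that converge at a geometric rate. The weighted series of
  squared increments is integrable, hence finite almost everywhere, so the increments decay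
  geometrically at almost every point and the pointwise limit exists; Fatou's lemma identifies it as
  the limit in \<open>L\<^sup>2\<close>.
\<close>

lemma L2_complete_fast:
  fixes u :: "nat \<Rightarrow> 'a::euclidean_space \<Rightarrow> complex"
  assumes u: "\<And>k. u k \<in> Lp 2"
    and cauchy: "\<And>k l. k \<le> l \<Longrightarrow> nsq (\<lambda>x. u l x - u k x) \<le> ennreal (C * (1/8) ^ k)"
  shows "\<exists>g\<in>Lp 2. (\<lambda>k. nsq (\<lambda>x. u k x - g x)) \<longlonglongrightarrow> 0"
proof -
  have [measurable]: "u k \<in> borel_measurable borel" for k using u[of k] by measurable
  \<comment> \<open>the weights \<open>2\<^sup>k\<close> still leave a convergent series, since \<open>2 / 8 < 1\<close>\<close>
  define S where "S x = (\<Sum>k. ennreal (2 ^ k * (norm (u (Suc k) x - u k x))\<^sup>2))" for x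
  have C: "(\<integral>\<^sup>+x. ennreal (2 ^ k * (norm (u (Suc k) x - u k x))\<^sup>2) \<partial>lborel) \<le> ennreal (\<bar>C\<bar> * (1/4) ^ k)" for k
  proof -
    have "(\<integral>\<^sup>+x. ennreal (2 ^ k * (norm (u (Suc k) x - u k x))\<^sup>2) \<partial>lborel)
        = ennreal (2 ^ k) * nsq (\<lambda>x. u (Suc k) x - u k x)"
      by (simp add: nsq_def ennreal_mult nn_integral_cmult)
    also have "\<dots> \<le> ennreal (2 ^ k) * ennreal (\<bar>C\<bar> * (1/8) ^ k)"
      by (intro mult_left_mono order_trans[OF cauchy[of k "Suc k"]] ennreal_leI mult_right_mono) auto
    also have "\<dots> = ennreal (\<bar>C\<bar> * (1/4) ^ k)"
    proof -
      have "(2::real) ^ k * (1/8) ^ k = (1/4) ^ k" by (simp flip: power_mult_distrib)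
      then have "(2::real) ^ k * (\<bar>C\<bar> * (1/8) ^ k) = \<bar>C\<bar> * (1/4) ^ k" by (metis mult.left_commute)
      then show ?thesis by (metis abs_ge_zero ennreal_mult zero_le_divide_1_iff zero_le_mult_iff zero_le_numeral zero_le_power)
    qed
    finally show ?thesis .
  qed
  have "(\<integral>\<^sup>+x. S x \<partial>lborel) = (\<Sum>k. \<integral>\<^sup>+x. ennreal (2 ^ k * (norm (u (Suc k) x - u k x))\<^sup>2) \<partial>lborel)"
    unfolding S_def by (rule nn_integral_suminf) measurable
  also have "\<dots> \<le> (\<Sum>k. ennreal (\<bar>C\<bar> * (1/4) ^ k))" by (intro suminf_le C) auto
  also have "\<dots> < \<infinity>"
    by (subst suminf_ennreal2) (auto intro!: summable_mult)
  finally have "AE x in lborel. S x \<noteq> \<infinity>"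
    by (intro nn_integral_PInf_AE) (auto simp: S_def)
  then have conv: "AE x in lborel. convergent (\<lambda>k. u k x)"
  proof eventually_elim
    case (elim x)
    have bd: "2 ^ k * (norm (u (Suc k) x - u k x))\<^sup>2 \<le> enn2real (S x)" for k
    proof -
      have "ennreal (2 ^ k * (norm (u (Suc k) x - u k x))\<^sup>2) \<le> S x"
        unfolding S_def by (rule ennreal_term_le_suminf)
      with elim show ?thesis by (cases "S x") auto
    qed
    have "norm (u (Suc k) x - u k x) \<le> sqrt (enn2real (S x)) * (sqrt (1/2)) ^ k" for k
    proof -
      have "norm (u (Suc k) x - u k x) = sqrt ((norm (u (Suc k) x - u k x))\<^sup>2)" by simp
      also have "\<dots> \<le> sqrt (enn2real (S x) * (1/2) ^ k)"
        using bd[of k] by (intro real_sqrt_le_mono) (simp add: field_simps power_divide)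
      finally show ?thesis by (simp add: real_sqrt_mult real_sqrt_power)
    qed
    moreover have "summable (\<lambda>k. sqrt (enn2real (S x)) * (sqrt (1/2)) ^ k)"
      by (intro summable_mult summable_geometric) simp
    ultimately have "summable (\<lambda>k. u (Suc k) x - u k x)"
      by (rule summable_comparison_test'[where N=0, rotated])
    then have "convergent (\<lambda>n. \<Sum>k<n. u (Suc k) x - u k x)" by (simp add: summable_iff_convergent)
    then have "convergent (\<lambda>n. u n x - u 0 x)" by (simp add: sum_lessThan_telescope[of "\<lambda>k. u k x"])
    then show ?case by (simp add: convergent_diff_const_right_iff)
  qed
  define g where "g x = lim (\<lambda>k. u k x)" for x
  have [measurable]: "g \<in> borel_measurable borel"
    unfolding g_def by (rule borel_measurable_lim_metric) measurable
  have lim: "AE x in lborel. (\<lambda>k. u k x) \<longlonglongrightarrow> g x"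
    using conv by eventually_elim (simp add: convergent_LIMSEQ_iff g_def)
  have bd: "nsq (\<lambda>x. u k x - g x) \<le> ennreal (C * (1/8) ^ k)" for k
  proof -
    have "nsq (\<lambda>x. g x - u k x) \<le> liminf (\<lambda>l. nsq (\<lambda>x. u l x - u k x))"
      using lim by (intro nsq_Fatou) (auto elim!: eventually_mono intro!: tendsto_intros)
    also have "\<dots> \<le> liminf (\<lambda>l. ennreal (C * (1/8) ^ k))"
      by (intro Liminf_mono eventually_sequentiallyI[of k] cauchy)
    finally show ?thesis by (simp add: nsq_minus_commute Liminf_const)
  qed
  have "(\<lambda>k. nsq (\<lambda>x. u k x - g x)) \<longlonglongrightarrow> 0"
  proof (rule tendsto_sandwich[OF _ _ tendsto_const])
    have "(\<lambda>k. C * (1/8) ^ k) \<longlonglongrightarrow> C * 0" by (intro tendsto_intros LIMSEQ_power_zero) auto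
    from tendsto_ennrealI[OF this] show "(\<lambda>k. ennreal (C * (1/8) ^ k)) \<longlonglongrightarrow> 0" by simp
  qed (use bd in auto)
  moreover have "g \<in> Lp 2"
  proof -
    have "(\<lambda>x. u 0 x - g x) \<in> Lp 2" using bd[of 0] by (auto simp: Lp2_iff intro: le_less_trans)
    from Lp2_diff[OF u[of 0] this] show ?thesis by simp
  qed
  ultimately show ?thesis by blast
qed

section \<open>The Fourier transform of integrable functions and Gaussian averages\<close>

lemma borel_measurable_cis [measurable]: "cis \<in> borel_measurable borel"
  by (intro borel_measurable_continuous_onI continuous_intros)

lemma borel_measurable_cnj [measurable]: "cnj \<in> borel_measurable borel"
  by (intro borel_measurable_continuous_onI continuous_intros)

lemma integrable_pair_mult:
  fixes g :: "'a::euclidean_space \<Rightarrow> complex" and h :: "'b::euclidean_space \<Rightarrow> complex"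
  assumes g: "integrable lborel g" and h: "integrable lborel h"
  shows "integrable (lborel \<Otimes>\<^sub>M lborel) (\<lambda>(x, y). g x * h y)"
proof -
  have [measurable]: "g \<in> borel_measurable borel" "h \<in> borel_measurable borel" 
    using g h by (auto dest: borel_measurable_integrable)
  show ?thesis
    using g h by (intro lborel_pair.Fubini_integrable) (auto simp: norm_mult)
qed

lemma fourier_L1_measurable [measurable]:
  fixes h :: "'a::euclidean_space \<Rightarrow> complex"
  assumes [measurable]: "h \<in> borel_measurable borel"
  shows "fourier_L1 h \<in> borel_measurable borel"
  unfolding fourier_L1_def[abs_def] by measurable

lemma fourier_L1_bound:
  fixes h :: "'a::euclidean_space \<Rightarrow> complex"
  assumes "integrable lborel h"
  shows "norm (fourier_L1 h \<xi>) \<le> (2 * pi) powr (- (real DIM('a) / 2)) * (LINT x|lborel. norm (h x))"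
proof -
  have "norm (LINT x|lborel. cis (- (x \<bullet> \<xi>)) * h x) \<le> (LINT x|lborel. norm (cis (- (x \<bullet> \<xi>)) * h x))"
    by (rule integral_norm_bound)
  then show ?thesis by (simp add: fourier_L1_def norm_mult mult_left_mono)
qed

lemma integrable_cis_mult:
  fixes h :: "'a::euclidean_space \<Rightarrow> complex"
  assumes h: "integrable lborel h" and [measurable]: "r \<in> borel_measurable borel"
  shows "integrable lborel (\<lambda>x. cis (r x) * h x)"
  using h by (rule Bochner_Integration.integrable_bound)
    (use h in \<open>auto simp: norm_mult dest: borel_measurable_integrable\<close>)

text \<open>
  Fubini's theorem; every Gaussian identity below is an instance of this formula.
\<close>

lemma fourier_L1_multiplication:
  fixes g h :: "'a::euclidean_space \<Rightarrow> complex"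
  assumes g: "integrable lborel g" and h: "integrable lborel h"
  shows "(LINT \<xi>|lborel. fourier_L1 g \<xi> * h \<xi>) = (LINT x|lborel. g x * fourier_L1 h x)"
proof -
  have [measurable]: "g \<in> borel_measurable borel" "h \<in> borel_measurable borel" 
    using g h by (auto dest: borel_measurable_integrable)
  let ?c = "(2 * pi) powr (- (real DIM('a) / 2))"
  have int: "integrable (lborel \<Otimes>\<^sub>M lborel) (\<lambda>(x, \<xi>). cis (- (x \<bullet> \<xi>)) * g x * h \<xi>)"
    by (rule Bochner_Integration.integrable_bound[OF integrable_pair_mult[OF g h]])
       (auto simp: norm_mult)
  have "(LINT \<xi>|lborel. fourier_L1 g \<xi> * h \<xi>)
      = (LINT \<xi>|lborel. ?c *\<^sub>R (LINT x|lborel. cis (- (x \<bullet> \<xi>)) * g x * h \<xi>))"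
    by (simp add: fourier_L1_def)
  also have "\<dots> = ?c *\<^sub>R (LINT \<xi>|lborel. (LINT x|lborel. cis (- (x \<bullet> \<xi>)) * g x * h \<xi>))"
    by simp
  also have "(LINT \<xi>|lborel. (LINT x|lborel. cis (- (x \<bullet> \<xi>)) * g x * h \<xi>))
      = (LINT x|lborel. (LINT \<xi>|lborel. cis (- (x \<bullet> \<xi>)) * g x * h \<xi>))"
    using lborel_pair.Fubini_integral[OF int] by simp
  also have "\<dots> = (LINT x|lborel. g x * (LINT \<xi>|lborel. cis (- (\<xi> \<bullet> x)) * h \<xi>))"
    by (intro Bochner_Integration.integral_cong refl)
       (simp add: inner_commute mult.commute mult.left_commute flip: integral_mult_right_zero)
  also have "?c *\<^sub>R \<dots> = (LINT x|lborel. g x * fourier_L1 h x)"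
    by (simp add: fourier_L1_def)
  finally show ?thesis .
qed

text \<open>
  The parameter is an inverse width, so small \<open>s\<close> gives a function close to \<open>1\<close>: it is used as
  a convergence factor on the frequency side, with \<open>gauss (1/s)\<close> as its transform.
\<close>

definition gauss :: "real \<Rightarrow> 'a::euclidean_space \<Rightarrow> real" where
  "gauss s x = exp (- (s * norm x)\<^sup>2 / 2)"

lemma gauss_measurable [measurable]: "gauss s \<in> borel_measurable borel"
  unfolding gauss_def[abs_def] by measurable

lemma gauss_nonneg [simp]: "0 \<le> gauss s x" and gauss_le_1 [simp]: "gauss s x \<le> 1" and gauss_pos: "0 < gauss s x"
  by (auto simp: gauss_def)

lemma gauss_1_prod: "gauss 1 x = (\<Prod>b\<in>Basis. exp (- (x \<bullet> b)\<^sup>2 / 2))"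
proof -
  have "(norm x)\<^sup>2 = (\<Sum>b\<in>Basis. (x \<bullet> b)\<^sup>2)"
    by (subst power2_norm_eq_inner, subst euclidean_inner) (simp add: power2_eq_square)
  then show ?thesis
    by (simp add: gauss_def sum_negf sum_divide_distrib[symmetric] flip: exp_sum)
qed

lemma integral_lborel_prod:
  fixes f :: "'a::euclidean_space \<Rightarrow> real \<Rightarrow> complex"
  assumes f: "\<And>b. b \<in> Basis \<Longrightarrow> integrable lborel (f b)"
  shows "integrable lborel (\<lambda>x::'a. \<Prod>b\<in>Basis. f b (x \<bullet> b))"
    and "(LINT x|lborel. (\<Prod>b\<in>Basis. f b (x \<bullet> b))) = (\<Prod>b\<in>Basis. LINT y|lborel. f b y)"
proof -
  interpret product_sigma_finite "\<lambda>_::'a. lborel :: real measure" ..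
  have [measurable]: "f b \<in> borel_measurable borel" if "b \<in> Basis" for b
    using f[OF that] by (auto dest: borel_measurable_integrable)
  show "integrable lborel (\<lambda>x::'a. \<Prod>b\<in>Basis. f b (x \<bullet> b))"
    using product_integrable_prod[of Basis f] f
    by (subst lborel_eq, subst integrable_distr_eq) (simp_all cong: prod.cong)
  show "(LINT x|lborel. (\<Prod>b\<in>Basis. f b (x \<bullet> b))) = (\<Prod>b\<in>Basis. LINT y|lborel. f b y)"
    using product_integral_prod[of Basis f] f
    by (subst lborel_eq, subst integral_distr) (simp_all cong: prod.cong)
qed

lemma gaussian_1d:
  "integrable lborel (\<lambda>x. cis (- (x * \<xi>)) * complex_of_real (exp (- x\<^sup>2 / 2)))"
  "(LINT x|lborel. cis (- (x * \<xi>)) * complex_of_real (exp (- x\<^sup>2 / 2)))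
     = complex_of_real (sqrt (2 * pi) * exp (- \<xi>\<^sup>2 / 2))"
proof -
  interpret real_distribution std_normal_distribution by (rule real_dist_normal_dist)
  have int: "integrable std_normal_distribution (\<lambda>x. iexp ((-\<xi>) * x))"
    by (rule integrable_iexp) simp_all
  have eq: "cis (- (x * \<xi>)) * complex_of_real (exp (- x\<^sup>2 / 2))
      = complex_of_real (sqrt (2 * pi)) * (std_normal_density x *\<^sub>R iexp ((-\<xi>) * x))" for x
    by (simp add: std_normal_density_def cis_conv_exp scaleR_conv_of_real mult.commute mult.left_commute flip: of_real_mult)
  from int show "integrable lborel (\<lambda>x. cis (- (x * \<xi>)) * complex_of_real (exp (- x\<^sup>2 / 2)))"
    unfolding eq by (intro integrable_mult_right) (subst (asm) integrable_density, auto)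
  have "char std_normal_distribution (-\<xi>) = (LINT x|lborel. std_normal_density x *\<^sub>R iexp ((-\<xi>) * x))"
    unfolding char_def by (subst integral_density) auto
  then show "(LINT x|lborel. cis (- (x * \<xi>)) * complex_of_real (exp (- x\<^sup>2 / 2)))
     = complex_of_real (sqrt (2 * pi) * exp (- \<xi>\<^sup>2 / 2))"
    unfolding eq by (subst integral_mult_right_zero) (simp add: char_std_normal_distribution)
qed

lemma cis_prod: "finite A \<Longrightarrow> cis (sum f A) = (\<Prod>b\<in>A. cis (f b))"
  by (induction A rule: finite_induct) (auto simp: cis_mult[symmetric])

text \<open>
  The Gaussian and the character both factor over coordinates, which reduces the claim to the
  characteristic function of the normal distribution.
\<close>

lemma gaussian_nd:
  fixes \<xi> :: "'a::euclidean_space"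
  shows "integrable lborel (\<lambda>x. cis (- (x \<bullet> \<xi>)) * complex_of_real (gauss 1 x))"
    and "(LINT x|lborel. cis (- (x \<bullet> \<xi>)) * complex_of_real (gauss 1 x))
      = complex_of_real ((2 * pi) powr (real DIM('a) / 2) * gauss 1 \<xi>)"
proof -
  have eq: "cis (- (x \<bullet> \<xi>)) * complex_of_real (gauss 1 x)
      = (\<Prod>b\<in>Basis. cis (- ((x \<bullet> b) * (\<xi> \<bullet> b))) * complex_of_real (exp (- (x \<bullet> b)\<^sup>2 / 2)))" for x
    by (subst euclidean_inner, simp add: sum_negf[symmetric] cis_prod gauss_1_prod prod.distrib)
  show "integrable lborel (\<lambda>x. cis (- (x \<bullet> \<xi>)) * complex_of_real (gauss 1 x))"
    unfolding eq using gaussian_1d by (intro integral_lborel_prod(1)) auto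
  have "(LINT x|lborel. cis (- (x \<bullet> \<xi>)) * complex_of_real (gauss 1 x))
      = (\<Prod>b\<in>Basis. complex_of_real (sqrt (2 * pi) * exp (- (\<xi> \<bullet> b)\<^sup>2 / 2)))"
    unfolding eq using gaussian_1d by (subst integral_lborel_prod(2)) auto
  also have "\<dots> = complex_of_real (sqrt (2 * pi) ^ DIM('a) * gauss 1 \<xi>)"
    by (simp add: gauss_1_prod prod.distrib)
  also have "sqrt (2 * pi) ^ DIM('a) = (2 * pi) powr (real DIM('a) / 2)"
    by (simp add: powr_half_sqrt[symmetric] powr_powr flip: powr_realpow)
  finally show "(LINT x|lborel. cis (- (x \<bullet> \<xi>)) * complex_of_real (gauss 1 x))
      = complex_of_real ((2 * pi) powr (real DIM('a) / 2) * gauss 1 \<xi>)" .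
qed

lemma integrable_mult_left_iff_complex:
  fixes f :: "'a \<Rightarrow> complex"
  assumes "c \<noteq> 0"
  shows "integrable M (\<lambda>x. c * f x) \<longleftrightarrow> integrable M f"
  using integrable_mult_right[of c M f] integrable_mult_right[of "1 / c" M "\<lambda>x. c * f x"] assms
  by auto

lemma lborel_scale:
  fixes f :: "'a::euclidean_space \<Rightarrow> complex"
  assumes c: "c \<noteq> 0" and [measurable]: "f \<in> borel_measurable borel"
  shows "(LINT x|lborel. f x) = \<bar>c\<bar> ^ DIM('a) *\<^sub>R (LINT x|lborel. f (c *\<^sub>R x))"
    and "integrable lborel f \<longleftrightarrow> integrable lborel (\<lambda>x. f (c *\<^sub>R x))"
proof -
  show "(LINT x|lborel. f x) = \<bar>c\<bar> ^ DIM('a) *\<^sub>R (LINT x|lborel. f (c *\<^sub>R x))"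
    by (subst lborel_affine[OF c, of 0])
       (simp add: integral_density integral_distr)
  show "integrable lborel f \<longleftrightarrow> integrable lborel (\<lambda>x. f (c *\<^sub>R x))"
    by (subst lborel_affine[OF c, of 0])
       (use c in \<open>simp add: integrable_density integrable_distr_eq scaleR_conv_of_real integrable_mult_left_iff_complex\<close>)
qed

lemma integral_lborel_uminus:
  fixes f :: "'a::euclidean_space \<Rightarrow> complex"
  assumes [measurable]: "f \<in> borel_measurable borel"
  shows "(LINT x|lborel. f (- x)) = (LINT x|lborel. f x)"
  using lborel_scale(1)[of "-1" f] by simp

lemma integrable_lborel_uminus:
  fixes f :: "'a::euclidean_space \<Rightarrow> complex"
  assumes "integrable lborel f"
  shows "integrable lborel (\<lambda>x. f (- x))"
  using lborel_scale(2)[of "-1" f] assms by (auto dest: borel_measurable_integrable)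

lemma gauss_integrable:
  assumes "s > 0"
  shows "integrable lborel (\<lambda>x::'a::euclidean_space. complex_of_real (gauss s x))"
    and "(LINT x|lborel. cis (- (x \<bullet> \<xi>)) * complex_of_real (gauss s (x::'a)))
      = complex_of_real ((2 * pi) powr (real DIM('a) / 2) * ((1/s) ^ DIM('a) * gauss (1/s) \<xi>))"
proof -
  have eq: "gauss s ((1/s) *\<^sub>R x) = gauss 1 x" for x :: 'a
    using assms by (simp add: gauss_def)
  have int: "integrable lborel (\<lambda>x::'a. complex_of_real (gauss 1 x))"
    using gaussian_nd(1)[of 0] by simp
  show "integrable lborel (\<lambda>x::'a. complex_of_real (gauss s x))"
    by (subst lborel_scale(2)[of "1/s"]) (use assms int in \<open>auto simp: eq simp del: of_real_eq_iff\<close>)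
  have "(LINT x|lborel. cis (- (x \<bullet> \<xi>)) * complex_of_real (gauss s (x::'a)))
      = (1/s) ^ DIM('a) *\<^sub>R (LINT x|lborel. cis (- (x \<bullet> ((1/s) *\<^sub>R \<xi>))) * complex_of_real (gauss 1 x))"
    by (subst lborel_scale(1)[of "1/s"]) (use assms in \<open>auto simp: eq simp del: of_real_eq_iff\<close>)
  also have "\<dots> = complex_of_real ((2 * pi) powr (real DIM('a) / 2) * ((1/s) ^ DIM('a) * gauss (1/s) \<xi>))"
    by (subst gaussian_nd(2)) (simp add: scaleR_conv_of_real gauss_def power_divide)
  finally show "(LINT x|lborel. cis (- (x \<bullet> \<xi>)) * complex_of_real (gauss s (x::'a)))
      = complex_of_real ((2 * pi) powr (real DIM('a) / 2) * ((1/s) ^ DIM('a) * gauss (1/s) \<xi>))" .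
qed

text \<open>
  Convolution with the normalised Gaussian of width \<open>s\<close>, that is, the heat flow at time \<open>s\<^sup>2/2\<close>.
\<close>

definition heat_avg :: "real \<Rightarrow> ('a::euclidean_space \<Rightarrow> complex) \<Rightarrow> 'a \<Rightarrow> complex" where
  "heat_avg s h x = ((2 * pi) powr (- (real DIM('a) / 2)) * (1/s) ^ DIM('a)) *\<^sub>R
     (LINT y|lborel. complex_of_real (gauss (1/s) (y - x)) * h y)"

lemma fourier_L1_gaussian:
  assumes "s > 0"
  shows "fourier_L1 (\<lambda>\<xi>. cis (x \<bullet> \<xi>) * complex_of_real (gauss s \<xi>)) (y::'a::euclidean_space)
    = complex_of_real ((1/s) ^ DIM('a) * gauss (1/s) (y - x))"
proof -
  have "(LINT \<xi>|lborel. cis (- (\<xi> \<bullet> y)) * (cis (x \<bullet> \<xi>) * complex_of_real (gauss s \<xi>)))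
     = (LINT \<xi>|lborel. cis (- (\<xi> \<bullet> (y - x))) * complex_of_real (gauss s \<xi>))"
    by (intro Bochner_Integration.integral_cong refl)
       (simp add: cis_mult mult.assoc[symmetric] inner_diff_right inner_commute)
  then show ?thesis
    using assms by (simp add: fourier_L1_def gauss_integrable(2) powr_minus scaleR_conv_of_real)
qed

lemma integrable_gauss_fourier:
  fixes h :: "'a::euclidean_space \<Rightarrow> complex"
  assumes s: "s > 0" and h: "integrable lborel h"
  shows "integrable lborel (\<lambda>\<xi>. complex_of_real (gauss s \<xi>) * fourier_L1 h \<xi>)"
proof (rule Bochner_Integration.integrable_bound)
  let ?K = "(2 * pi) powr (- (real DIM('a) / 2)) * (LINT x|lborel. norm (h x))"
  have [measurable]: "h \<in> borel_measurable borel" using h by (auto dest: borel_measurable_integrable)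
  show "integrable lborel (\<lambda>\<xi>::'a. complex_of_real (gauss s \<xi>) * complex_of_real ?K)"
    by (intro integrable_mult_left gauss_integrable s)
  show "(\<lambda>\<xi>. complex_of_real (gauss s \<xi>) * fourier_L1 h \<xi>) \<in> borel_measurable lborel" by measurable
  show "AE \<xi> in lborel. norm (complex_of_real (gauss s \<xi>) * fourier_L1 h \<xi>)
      \<le> norm (complex_of_real (gauss s \<xi>) * complex_of_real ?K)"
    using fourier_L1_bound[OF h] by (auto simp: norm_mult intro!: mult_left_mono)
qed

text \<open>
  Inserting a Gaussian convergence factor in the inversion integral of \<open>h\<close> produces a Gaussian
  average of \<open>h\<close>.
\<close>

lemma fourier_L1_gauss_fourier_L1:
  fixes h :: "'a::euclidean_space \<Rightarrow> complex"
  assumes s: "s > 0" and h: "integrable lborel h"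
  shows "fourier_L1 (\<lambda>\<xi>. complex_of_real (gauss s \<xi>) * fourier_L1 h \<xi>) (- x) = heat_avg s h x"
proof -
  let ?c = "(2 * pi) powr (- (real DIM('a) / 2))"
  let ?g = "\<lambda>\<xi>. cis (x \<bullet> \<xi>) * complex_of_real (gauss s \<xi>)"
  have "fourier_L1 (\<lambda>\<xi>. complex_of_real (gauss s \<xi>) * fourier_L1 h \<xi>) (- x)
      = ?c *\<^sub>R (LINT \<xi>|lborel. ?g \<xi> * fourier_L1 h \<xi>)"
    by (simp add: fourier_L1_def inner_commute mult.assoc)
  also have "(LINT \<xi>|lborel. ?g \<xi> * fourier_L1 h \<xi>) = (LINT y|lborel. fourier_L1 ?g y * h y)"
    by (intro fourier_L1_multiplication[symmetric] integrable_cis_mult gauss_integrable s h) measurable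
  also have "\<dots> = (LINT y|lborel. complex_of_real ((1/s) ^ DIM('a)) * (complex_of_real (gauss (1/s) (y - x)) * h y))"
    by (simp add: fourier_L1_gaussian[OF s] mult.assoc)
  also have "\<dots> = (1/s) ^ DIM('a) *\<^sub>R (LINT y|lborel. complex_of_real (gauss (1/s) (y - x)) * h y)"
    by (simp add: scaleR_conv_of_real)
  finally show ?thesis by (simp add: heat_avg_def)
qed

text \<open>
  Parseval's identity with a convergence factor. The conjugate of the transform of \<open>h\<close> is the
  transform of the conjugated reflection of \<open>h\<close>, so the multiplication formula applies once more.
\<close>

lemma gauss_plancherel:
  fixes h :: "'a::euclidean_space \<Rightarrow> complex"
  assumes s: "s > 0" and h: "integrable lborel h"
  shows "(LINT \<xi>|lborel. complex_of_real (gauss s \<xi> * (norm (fourier_L1 h \<xi>))\<^sup>2))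
    = (LINT x|lborel. heat_avg s h x * cnj (h x))"
proof -
  have [measurable]: "h \<in> borel_measurable borel" using h by (auto dest: borel_measurable_integrable)
  define h' where "h' x = cnj (h (- x))" for x
  have h': "integrable lborel h'"
    unfolding h'_def using integrable_lborel_uminus[OF h] by simp
  then have [measurable]: "h' \<in> borel_measurable borel" by (auto dest: borel_measurable_integrable)
  let ?g = "\<lambda>\<xi>. complex_of_real (gauss s \<xi>) * fourier_L1 h \<xi>"
  have cnj: "cnj (fourier_L1 h \<xi>) = fourier_L1 h' \<xi>" for \<xi>
  proof -
    have "cnj (LINT x|lborel. cis (- (x \<bullet> \<xi>)) * h x) = (LINT x|lborel. cis (x \<bullet> \<xi>) * cnj (h x))"
      by (subst Bochner_Integration.integral_cnj[symmetric]) (simp add: cis_cnj)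
    also have "\<dots> = (LINT x|lborel. cis (- (x \<bullet> \<xi>)) * h' x)"
      by (subst integral_lborel_uminus[symmetric]) (auto simp: h'_def)
    finally show ?thesis by (simp add: fourier_L1_def)
  qed
  have "(LINT \<xi>|lborel. complex_of_real (gauss s \<xi> * (norm (fourier_L1 h \<xi>))\<^sup>2))
      = (LINT \<xi>|lborel. ?g \<xi> * fourier_L1 h' \<xi>)"
    by (intro Bochner_Integration.integral_cong refl)
       (simp add: cnj[symmetric] mult.assoc complex_norm_square flip: of_real_power)
  also have "\<dots> = (LINT x|lborel. fourier_L1 ?g x * h' x)"
    by (rule fourier_L1_multiplication[symmetric, OF integrable_gauss_fourier[OF s h] h'])
  also have "\<dots> = (LINT x|lborel. fourier_L1 ?g (- x) * h' (- x))"
    by (rule integral_lborel_uminus[symmetric]) measurable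
  also have "\<dots> = (LINT x|lborel. heat_avg s h x * cnj (h x))"
    by (simp add: fourier_L1_gauss_fourier_L1[OF s h]) (simp add: h'_def)
  finally show ?thesis .
qed


lemma weighted_am_gm3:
  fixes a b c :: real
  assumes "0 \<le> \<alpha>" "0 \<le> \<beta>" "\<alpha> + 2 * \<beta> = 1" "a > 0" "b > 0" "c > 0"
  shows "a powr \<alpha> * (b powr \<beta> * c powr \<beta>) \<le> \<alpha> * a + \<beta> * b + \<beta> * c"
proof -
  have "b powr \<beta> * c powr \<beta> = (b * c) powr \<beta>"
    using assms by (simp add: powr_mult)
  also have "\<dots> = sqrt (b * c) powr (2 * \<beta>)"
    using assms by (simp add: powr_half_sqrt[symmetric] powr_powr)
  finally have "a powr \<alpha> * (b powr \<beta> * c powr \<beta>) = a powr \<alpha> * sqrt (b * c) powr (2 * \<beta>)" by simp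
  also have "\<dots> \<le> \<alpha> * a + 2 * \<beta> * sqrt (b * c)"
    using assms by (intro Youngs_inequality_0) auto
  also have "\<dots> \<le> \<alpha> * a + 2 * \<beta> * ((b + c) / 2)"
    using assms by (intro add_left_mono mult_left_mono arith_geo_mean_sqrt) auto
  also have "2 * \<beta> * ((b + c) / 2) = \<beta> * b + \<beta> * c" by (simp add: field_simps)
  finally show ?thesis by simp
qed

lemma nn_integral_lborel_translate:
  fixes f :: "'a::euclidean_space \<Rightarrow> ennreal"
  assumes [measurable]: "f \<in> borel_measurable borel"
  shows "(\<integral>\<^sup>+y. f (y - x) \<partial>lborel) = (\<integral>\<^sup>+y. f y \<partial>lborel)"
  by (subst (2) lborel_affine[of 1 "- x"])
     (simp_all add: nn_integral_density nn_integral_distr)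

text \<open>
  The instance of Young's convolution inequality paired with its own argument. After normalising
  \<open>H\<^sup>m\<close> and \<open>K\<close> to integral one as \<open>u\<close> and \<open>v\<close>, the integrand is a constant times
  \<open>(u(x) u(y))\<^bsup>\<alpha>\<^esup> (u(x) v(y-x))\<^bsup>\<beta>\<^esup> (u(y) v(y-x))\<^bsup>\<beta>\<^esup>\<close> with \<open>\<alpha> + 2\<beta> = 1\<close>, and each of the three
  products has double integral one, so the weighted inequality of means finishes. The bound \<open>K \<le> 1\<close>
  lets \<open>K\<close> be replaced by \<open>K\<^bsup>2\<beta>\<^esup>\<close>, which covers \<open>m = 1\<close>, where \<open>\<beta> = 0\<close>.
\<close>

lemma bilinear_young:
  fixes H K :: "'a::euclidean_space \<Rightarrow> real"
  assumes m: "1 \<le> m" "m \<le> 2"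
    and [measurable]: "H \<in> borel_measurable borel" "K \<in> borel_measurable borel"
    and H: "\<And>x. 0 \<le> H x" and K: "\<And>x. 0 \<le> K x" "\<And>x. K x \<le> 1"
    and K_int: "(\<integral>\<^sup>+z. ennreal (K z) \<partial>lborel) = ennreal \<kappa>" and \<kappa>: "\<kappa> > 0"
    and H_int: "(\<integral>\<^sup>+x. ennreal (H x powr m) \<partial>lborel) = ennreal A" and A: "A \<ge> 0"
  shows "(\<integral>\<^sup>+x. \<integral>\<^sup>+y. ennreal (K (y - x) * H x * H y) \<partial>lborel \<partial>lborel)
    \<le> ennreal (\<kappa> powr (2 - 2 / m) * A powr (2 / m))"
proof (cases "A = 0")
  case True
  then have "AE x in lborel. H x = 0"
    using H_int H by (simp add: nn_integral_0_iff_AE)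
  then have "(\<integral>\<^sup>+y. ennreal (K (y - x) * H x * H y) \<partial>lborel) = 0" for x
    by (subst nn_integral_0_iff_AE) (auto elim!: eventually_mono)
  then show ?thesis by simp
next
  case False
  with A have A: "A > 0" by simp
  \<comment> \<open>the exponents are determined by \<open>m (\<alpha> + \<beta>) = 1\<close> and \<open>\<alpha> + 2 \<beta> = 1\<close>\<close>
  define \<alpha> \<beta> where "\<alpha> = 2 / m - 1" and "\<beta> = 1 - 1 / m"
  have ab: "0 \<le> \<alpha>" "0 \<le> \<beta>" "\<alpha> + 2 * \<beta> = 1" "\<alpha> + \<beta> = 1 / m" "2 * \<beta> \<le> 1" "2 * \<beta> = 2 - 2 / m"
    using m by (auto simp: \<alpha>_def \<beta>_def field_simps)
  define P where "P = \<kappa> powr (2 * \<beta>) * A powr (2 / m)"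
  have P: "P \<ge> 0" by (simp add: P_def)
  define u where "u x = H x powr m / A" for x
  define v where "v z = K z / \<kappa>" for z
  have uv: "0 \<le> u x" "0 \<le> v x" for x using A \<kappa> H K by (auto simp: u_def v_def)
  have [measurable]: "u \<in> borel_measurable borel" "v \<in> borel_measurable borel"
    by (auto simp: u_def[abs_def] v_def[abs_def])
  have iu: "(\<integral>\<^sup>+x. ennreal (u x) \<partial>lborel) = 1"
    using A H_int by (simp add: u_def nn_integral_divide divide_ennreal flip: divide_ennreal)
  have iv: "(\<integral>\<^sup>+x. ennreal (v x) \<partial>lborel) = 1"
    using \<kappa> K_int K by (simp add: v_def nn_integral_divide divide_ennreal flip: divide_ennreal)
  have pw: "K (y - x) * H x * H y
      \<le> P * (\<alpha> * (u x * u y) + \<beta> * (u x * v (y - x)) + \<beta> * (u y * v (y - x)))" for x y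
  proof (cases "K (y - x) = 0 \<or> H x = 0 \<or> H y = 0")
    case True
    then show ?thesis using P ab uv by (auto intro!: mult_nonneg_nonneg add_nonneg_nonneg)
  next
    case False
    then have pos: "K (y - x) > 0" "H x > 0" "H y > 0"
      using K H by (auto simp: less_le)
    then have pos': "u x > 0" "u y > 0" "v (y - x) > 0"
      using A \<kappa> by (auto simp: u_def v_def)
    have root: "u z powr (1 / m) = H z / A powr (1 / m)" for z
      using m A H[of z] by (simp add: u_def powr_divide powr_powr)
    have "K (y - x) \<le> K (y - x) powr (2 * \<beta>)"
      using powr_mono'[of "2 * \<beta>" 1 "K (y - x)"] ab pos K(2)[of "y - x"] by simp
    then have "K (y - x) * H x * H y \<le> K (y - x) powr (2 * \<beta>) * H x * H y"
      using pos by (intro mult_right_mono) auto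
    also have "\<dots> = P * (u x powr (1 / m) * u y powr (1 / m) * v (y - x) powr (2 * \<beta>))"
    proof -
      have "A powr (2 / m) = A powr (1 / m) * A powr (1 / m)" by (simp flip: powr_add)
      then show ?thesis using A \<kappa> pos
        by (simp add: root P_def v_def powr_divide field_simps)
    qed
    also have "u x powr (1 / m) * u y powr (1 / m) * v (y - x) powr (2 * \<beta>)
       = (u x * u y) powr \<alpha> * ((u x * v (y - x)) powr \<beta> * (u y * v (y - x)) powr \<beta>)"
    proof -
      have "v (y - x) powr (2 * \<beta>) = v (y - x) powr \<beta> * v (y - x) powr \<beta>" by (simp flip: powr_add)
      then show ?thesis using pos' by (simp add: powr_mult powr_add flip: ab(4))
    qed
    also have "P * \<dots> \<le> P * (\<alpha> * (u x * u y) + \<beta> * (u x * v (y - x)) + \<beta> * (u y * v (y - x)))"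
      by (intro mult_left_mono[OF _ P] weighted_am_gm3 ab mult_pos_pos pos')
    finally show ?thesis .
  qed
  have iv': "(\<integral>\<^sup>+x. ennreal (v (y - x)) \<partial>lborel) = 1" for y
  proof -
    have "(\<integral>\<^sup>+x. ennreal (v (y - x)) \<partial>lborel) = (\<integral>\<^sup>+x. ennreal (v (- x)) \<partial>lborel)"
      using nn_integral_lborel_translate[of "\<lambda>z. ennreal (v (- z))" y] by simp
    also have "\<dots> = 1"
      using nn_integral_lborel_uminus[of "\<lambda>z. ennreal (v z)"] iv by simp
    finally show ?thesis .
  qed
  have "(\<integral>\<^sup>+x. \<integral>\<^sup>+y. ennreal (K (y - x) * H x * H y) \<partial>lborel \<partial>lborel)
     \<le> (\<integral>\<^sup>+x. \<integral>\<^sup>+y. ennreal P * (ennreal \<alpha> * (ennreal (u x) * ennreal (u y))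
          + ennreal \<beta> * (ennreal (u x) * ennreal (v (y - x)))
          + ennreal \<beta> * (ennreal (u y) * ennreal (v (y - x)))) \<partial>lborel \<partial>lborel)"
    using pw P ab uv
    by (intro nn_integral_mono) (simp flip: ennreal_mult ennreal_plus add: ennreal_leI)
  also have "\<dots> = ennreal P * (ennreal \<alpha> * (\<integral>\<^sup>+x. \<integral>\<^sup>+y. ennreal (u x) * ennreal (u y) \<partial>lborel \<partial>lborel)
          + ennreal \<beta> * (\<integral>\<^sup>+x. \<integral>\<^sup>+y. ennreal (u x) * ennreal (v (y - x)) \<partial>lborel \<partial>lborel)
          + ennreal \<beta> * (\<integral>\<^sup>+x. \<integral>\<^sup>+y. ennreal (u y) * ennreal (v (y - x)) \<partial>lborel \<partial>lborel))"
    by (simp add: nn_integral_cmult nn_integral_add)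
  also have "(\<integral>\<^sup>+x. \<integral>\<^sup>+y. ennreal (u x) * ennreal (u y) \<partial>lborel \<partial>lborel) = 1"
    by (simp add: nn_integral_cmult nn_integral_multc iu)
  also have "(\<integral>\<^sup>+x. \<integral>\<^sup>+y. ennreal (u x) * ennreal (v (y - x)) \<partial>lborel \<partial>lborel) = 1"
    using nn_integral_lborel_translate[of "\<lambda>z. ennreal (v z)"]
    by (simp add: nn_integral_cmult nn_integral_multc iu iv)
  also have "(\<integral>\<^sup>+x. \<integral>\<^sup>+y. ennreal (u y) * ennreal (v (y - x)) \<partial>lborel \<partial>lborel)
      = (\<integral>\<^sup>+y. \<integral>\<^sup>+x. ennreal (u y) * ennreal (v (y - x)) \<partial>lborel \<partial>lborel)"
    by (rule lborel_pair.Fubini') measurable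
  also have "\<dots> = 1"
    by (simp add: nn_integral_cmult iv' iu)
  also have "ennreal P * (ennreal \<alpha> * 1 + ennreal \<beta> * 1 + ennreal \<beta> * 1) = ennreal P"
  proof -
    have "ennreal \<alpha> + ennreal \<beta> + ennreal \<beta> = ennreal (\<alpha> + \<beta> + \<beta>)"
      using ab(1,2) by (simp only: ennreal_plus add_nonneg_nonneg)
    also have "\<alpha> + \<beta> + \<beta> = 1" using ab(3) by simp
    finally show ?thesis by (simp add: iu)
  qed
  finally show ?thesis by (simp add: P_def ab(6))
qed

lemma ennreal_norm_integral_le:
  fixes f :: "'a \<Rightarrow> complex"
  shows "ennreal (norm (integral\<^sup>L M f)) \<le> (\<integral>\<^sup>+x. ennreal (norm (f x)) \<partial>M)"
  by (cases "integrable M f") (auto simp: integral_norm_bound_ennreal not_integrable_integral_eq)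

lemma heat_avg_norm_le:
  fixes h :: "'a::euclidean_space \<Rightarrow> complex"
  assumes "s > 0"
  shows "ennreal (norm (heat_avg s h x)) \<le> ennreal ((2 * pi) powr (- (real DIM('a) / 2)) * (1/s) ^ DIM('a)) *
     (\<integral>\<^sup>+y. ennreal (gauss (1/s) (y - x) * norm (h y)) \<partial>lborel)"
  using assms ennreal_norm_integral_le[of lborel "\<lambda>y. complex_of_real (gauss (1/s) (y - x)) * h y"]
  by (simp add: heat_avg_def ennreal_mult norm_mult mult_left_mono)

lemma nn_integral_gauss:
  assumes "s > 0"
  shows "(\<integral>\<^sup>+x. ennreal (gauss s (x::'a::euclidean_space)) \<partial>lborel)
     = ennreal ((2 * pi) powr (real DIM('a) / 2) * (1/s) ^ DIM('a))"
proof -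
  have int: "integrable lborel (\<lambda>x::'a. gauss s x)"
    using integrable_Re[OF gauss_integrable(1)[OF assms]] by simp
  have "complex_of_real (LINT x|lborel. gauss s (x::'a)) = (LINT x|lborel. complex_of_real (gauss s (x::'a)))"
    by simp
  also have "\<dots> = complex_of_real ((2 * pi) powr (real DIM('a) / 2) * (1/s) ^ DIM('a))"
    using gauss_integrable(2)[OF assms, of "0::'a"] by (simp add: gauss_def)
  finally have "(LINT x|lborel. gauss s (x::'a)) = (2 * pi) powr (real DIM('a) / 2) * (1/s) ^ DIM('a)"
    by (simp only: of_real_eq_iff)
  then show ?thesis using int by (subst nn_integral_eq_integral) auto
qed

text \<open>
  The quantitative smoothing estimate: the Gaussian-weighted energy of the transform is a bilinear
  Gaussian form in \<open>h\<close>, to which Young's inequality applies. For \<open>m = 2\<close> the right-hand side does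
  not depend on \<open>s\<close>.
\<close>

lemma fourier_gauss_bound:
  fixes h :: "'a::euclidean_space \<Rightarrow> complex"
  assumes s: "s > 0" and m: "1 \<le> m" "m \<le> 2" and h: "integrable lborel h"
    and A: "(\<integral>\<^sup>+x. ennreal (norm (h x) powr m) \<partial>lborel) = ennreal A" "A \<ge> 0"
  shows "(\<integral>\<^sup>+\<xi>. ennreal (gauss s \<xi> * (norm (fourier_L1 h \<xi>))\<^sup>2) \<partial>lborel)
    \<le> ennreal (((2 * pi) powr (real DIM('a) / 2) * s ^ DIM('a)) powr (1 - 2 / m) * A powr (2 / m))"
proof -
  have [measurable]: "h \<in> borel_measurable borel" using h by (auto dest: borel_measurable_integrable)
  define \<kappa> where "\<kappa> = (2 * pi) powr (real DIM('a) / 2) * s ^ DIM('a)"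
  have \<kappa>: "\<kappa> > 0" using s by (simp add: \<kappa>_def)
  have c: "(2 * pi) powr (- (real DIM('a) / 2)) * (1/s) ^ DIM('a) = \<kappa> powr (-1)"
    using s \<kappa> by (simp add: \<kappa>_def powr_minus powr_divide power_divide field_simps)
  let ?K = "(2 * pi) powr (- (real DIM('a) / 2)) * (LINT x|lborel. norm (h x))"
  have int: "integrable lborel (\<lambda>\<xi>. gauss s \<xi> * (norm (fourier_L1 h \<xi>))\<^sup>2)"
  proof (rule Bochner_Integration.integrable_bound)
    show "integrable lborel (\<lambda>\<xi>::'a. complex_of_real (gauss s \<xi>) * complex_of_real (?K\<^sup>2))"
      by (intro integrable_mult_left gauss_integrable s)
    show "AE \<xi> in lborel. norm (gauss s \<xi> * (norm (fourier_L1 h \<xi>))\<^sup>2)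
        \<le> norm (complex_of_real (gauss s \<xi>) * complex_of_real (?K\<^sup>2))"
      using power_mono[OF fourier_L1_bound[OF h], where n=2]
      by (auto simp: norm_mult simp del: of_real_mult of_real_power intro!: mult_left_mono)
  qed measurable
  have "(\<integral>\<^sup>+\<xi>. ennreal (gauss s \<xi> * (norm (fourier_L1 h \<xi>))\<^sup>2) \<partial>lborel)
      = ennreal (LINT \<xi>|lborel. gauss s \<xi> * (norm (fourier_L1 h \<xi>))\<^sup>2)"
    by (intro nn_integral_eq_integral int) auto
  also have "\<dots> = ennreal (norm (LINT x|lborel. heat_avg s h x * cnj (h x)))"
    unfolding gauss_plancherel[OF s h, symmetric]
    by (subst integral_complex_of_real) (simp add: Bochner_Integration.integral_nonneg)
  also have "\<dots> \<le> (\<integral>\<^sup>+x. ennreal (norm (heat_avg s h x)) * ennreal (norm (h x)) \<partial>lborel)"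
    using ennreal_norm_integral_le[of lborel "\<lambda>x. heat_avg s h x * cnj (h x)"]
    by (simp add: norm_mult ennreal_mult)
  also have "\<dots> \<le> (\<integral>\<^sup>+x. ennreal (\<kappa> powr (-1)) *
     (\<integral>\<^sup>+y. ennreal (gauss (1/s) (y - x) * norm (h y)) \<partial>lborel) * ennreal (norm (h x)) \<partial>lborel)"
    unfolding c[symmetric] by (intro nn_integral_mono mult_right_mono heat_avg_norm_le s) auto
  also have "\<dots> = ennreal (\<kappa> powr (-1)) *
     (\<integral>\<^sup>+x. \<integral>\<^sup>+y. ennreal (gauss (1/s) (y - x) * norm (h x) * norm (h y)) \<partial>lborel \<partial>lborel)"
  proof -
    have "ennreal (\<kappa> powr (-1)) * (\<integral>\<^sup>+y. ennreal (gauss (1/s) (y - x) * norm (h y)) \<partial>lborel) * ennreal (norm (h x))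
        = ennreal (\<kappa> powr (-1)) * (\<integral>\<^sup>+y. ennreal (gauss (1/s) (y - x) * norm (h x) * norm (h y)) \<partial>lborel)" for x
    proof -
      have "(\<integral>\<^sup>+y. ennreal (gauss (1/s) (y - x) * norm (h y)) \<partial>lborel) * ennreal (norm (h x))
          = (\<integral>\<^sup>+y. ennreal (gauss (1/s) (y - x) * norm (h y)) * ennreal (norm (h x)) \<partial>lborel)"
        by (rule nn_integral_multc[symmetric]) measurable
      also have "\<dots> = (\<integral>\<^sup>+y. ennreal (gauss (1/s) (y - x) * norm (h x) * norm (h y)) \<partial>lborel)"
        by (intro nn_integral_cong) (simp add: mult_ac flip: ennreal_mult)
      finally show ?thesis by (simp add: mult.assoc)
    qed
    then show ?thesis by (simp add: nn_integral_cmult)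
  qed
  also have "\<dots> \<le> ennreal (\<kappa> powr (-1)) * ennreal (\<kappa> powr (2 - 2 / m) * A powr (2 / m))"
    using s A \<kappa> nn_integral_gauss[of "1/s", where 'a='a]
    by (intro mult_left_mono bilinear_young m) (auto simp: \<kappa>_def)
  also have "\<dots> = ennreal (\<kappa> powr (1 - 2 / m) * A powr (2 / m))"
  proof -
    have "\<kappa> powr (1 - 2 / m) = \<kappa> powr (-1) * \<kappa> powr (2 - 2 / m)"
      by (subst powr_add[symmetric]) simp
    then show ?thesis by (simp only: mult.assoc ennreal_mult powr_ge_zero mult_nonneg_nonneg)
  qed
  finally show ?thesis by (simp add: \<kappa>_def)
qed

lemma Lp1_iff: "f \<in> Lp 1 \<longleftrightarrow> integrable lborel f"
  by (auto simp: Lp_def integrable_norm_iff dest: borel_measurable_integrable)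

lemma gauss_tendsto_1: "(\<lambda>k. gauss (1 / real (Suc k)) x) \<longlonglongrightarrow> 1"
proof -
  have "(\<lambda>k. exp (- (1 / real (Suc k) * norm x)\<^sup>2 / 2)) \<longlonglongrightarrow> exp (- (0 * norm x)\<^sup>2 / 2)"
    by (intro tendsto_intros) (use LIMSEQ_inverse_real_of_nat in \<open>simp_all add: inverse_eq_divide\<close>)
  then show ?thesis by (simp add: gauss_def)
qed

text \<open>
  Half of Plancherel's theorem: let the width of the convergence factor tend to infinity in
  \<open>fourier_gauss_bound\<close> with \<open>m = 2\<close>.
\<close>

lemma nsq_fourier_L1_le:
  fixes h :: "'a::euclidean_space \<Rightarrow> complex"
  assumes h: "integrable lborel h"
  shows "nsq (fourier_L1 h) \<le> nsq h"
proof (cases "nsq h = \<infinity>")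
  case False
  have [measurable]: "h \<in> borel_measurable borel" using h by (auto dest: borel_measurable_integrable)
  obtain A where A: "nsq h = ennreal A" "A \<ge> 0" using False by (cases "nsq h") auto
  have le: "(\<integral>\<^sup>+\<xi>. ennreal (gauss (1 / real (Suc k)) \<xi> * (norm (fourier_L1 h \<xi>))\<^sup>2) \<partial>lborel) \<le> nsq h" for k
    using fourier_gauss_bound[of "1 / real (Suc k)" 2 h A] A h by (simp add: norm_powr_2 nsq_def)
  have "nsq (fourier_L1 h) = (\<integral>\<^sup>+\<xi>. liminf (\<lambda>k. ennreal (gauss (1 / real (Suc k)) \<xi> * (norm (fourier_L1 h \<xi>))\<^sup>2)) \<partial>lborel)"
    unfolding nsq_def
  proof (intro nn_integral_cong)
    fix \<xi> :: 'a
    have "(\<lambda>k. ennreal (gauss (1 / real (Suc k)) \<xi> * (norm (fourier_L1 h \<xi>))\<^sup>2)) \<longlonglongrightarrow> ennreal (1 * (norm (fourier_L1 h \<xi>))\<^sup>2)"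
      by (intro tendsto_intros gauss_tendsto_1)
    then show "ennreal ((norm (fourier_L1 h \<xi>))\<^sup>2)
        = liminf (\<lambda>k. ennreal (gauss (1 / real (Suc k)) \<xi> * (norm (fourier_L1 h \<xi>))\<^sup>2))"
      by (intro lim_imp_Liminf[symmetric]) auto
  qed
  also have "\<dots> \<le> liminf (\<lambda>k. \<integral>\<^sup>+\<xi>. ennreal (gauss (1 / real (Suc k)) \<xi> * (norm (fourier_L1 h \<xi>))\<^sup>2) \<partial>lborel)"
    by (rule nn_integral_liminf) measurable
  also have "\<dots> \<le> liminf (\<lambda>k::nat. nsq h)"
    by (intro Liminf_mono always_eventually allI le)
  finally show ?thesis by (simp add: Liminf_const)
qed simp

section \<open>The unitary Fourier transform on L2\<close>

lemma tendsto_two_sum_ennreal: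
  fixes X Y :: "'i \<Rightarrow> ennreal"
  assumes "(X \<longlongrightarrow> x) F" "(Y \<longlongrightarrow> y) F"
  shows "((\<lambda>k. 2 * X k + 2 * Y k) \<longlongrightarrow> 2 * x + 2 * y) F"
  using assms by (intro tendsto_add ennreal_tendsto_cmult) auto

lemma tendsto_0_le_ennreal:
  fixes X Y :: "'i \<Rightarrow> ennreal"
  assumes "\<forall>\<^sub>F k in F. X k \<le> Y k" "(Y \<longlongrightarrow> 0) F"
  shows "(X \<longlongrightarrow> 0) F"
  by (rule tendsto_sandwich[OF _ assms(1) tendsto_const assms(2)]) auto

text \<open>
  Continuity and boundedness are what pointwise convergence of Gaussian averages requires;
  integrability makes the integral transform available.
\<close>

definition test_fun :: "('a::euclidean_space \<Rightarrow> complex) \<Rightarrow> bool" where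
  "test_fun w \<longleftrightarrow> continuous_on UNIV w \<and> bounded (range w) \<and> integrable lborel w"

lemma test_fun_Lp2:
  assumes "test_fun w"
  shows "w \<in> Lp 2"
proof -
  have int: "integrable lborel w" using assms by (simp add: test_fun_def)
  then have [measurable]: "w \<in> borel_measurable borel" by (auto dest: borel_measurable_integrable)
  obtain B where B: "\<And>x. norm (w x) \<le> B" using assms by (auto simp: test_fun_def bounded_iff)
  have "integrable lborel (\<lambda>x. (norm (w x))\<^sup>2)"
  proof (rule Bochner_Integration.integrable_bound)
    show "integrable lborel (\<lambda>x. B * norm (w x))" using int by simp
    have "(norm (w x))\<^sup>2 \<le> B * norm (w x)" for x
      using B[of x] by (simp add: power2_eq_square mult_right_mono)
    then show "AE x in lborel. norm ((norm (w x))\<^sup>2) \<le> norm (B * norm (w x))"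
      by (auto intro: order_trans[OF _ abs_ge_self])
  qed measurable
  then show ?thesis by (simp add: Lp_def norm_powr_2)
qed

lemma gauss_Lp2: "(\<lambda>x. complex_of_real (C * gauss 1 x)) \<in> Lp 2"
proof -
  have "test_fun (\<lambda>x. complex_of_real (gauss 1 x))"
    unfolding test_fun_def
  proof (intro conjI)
    show "continuous_on UNIV (\<lambda>x. complex_of_real (gauss 1 x))"
      unfolding gauss_def by (intro continuous_intros) auto
    show "bounded (range (\<lambda>x. complex_of_real (gauss 1 x)))"
      by (auto simp: bounded_iff intro!: exI[of _ 1])
  qed (intro gauss_integrable, simp)
  from Lp2_cmult[OF test_fun_Lp2[OF this], of "complex_of_real C"] show ?thesis by simp
qed

text \<open>
  A measurable function is almost everywhere a limit of continuous functions. Radially clipping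
  these to the same Gaussian envelope keeps them continuous, does not disturb the limit, and makes
  dominated convergence applicable.
\<close>

lemma test_fun_dense_aux:
  fixes f :: "'a::euclidean_space \<Rightarrow> complex"
  assumes [measurable]: "f \<in> borel_measurable borel"
    and R: "R > 0" and bd: "\<And>x. norm (f x) \<le> R * gauss 1 x"
  shows "\<exists>w. (\<forall>k. test_fun (w k)) \<and> (\<lambda>k::nat. nsq (\<lambda>x. w k x - f x)) \<longlonglongrightarrow> 0"
proof -
  define \<omega> where "\<omega> x = R * gauss 1 x" for x :: 'a
  have \<omega>: "\<omega> x > 0" for x using R by (simp add: \<omega>_def gauss_pos)
  have cont_\<omega>: "continuous_on UNIV \<omega>"
    unfolding \<omega>_def gauss_def by (intro continuous_intros) auto
  have "f \<in> borel_measurable lebesgue" by (simp add: measurable_completion)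
  then have "f measurable_on UNIV" by (rule lebesgue_measurable_imp_measurable_on) auto
  then obtain N g where N: "negligible N" and g: "\<And>n::nat. continuous_on UNIV (g n)"
    and lim: "\<And>x. x \<notin> N \<Longrightarrow> (\<lambda>n. g n x) \<longlonglongrightarrow> f x"
    unfolding measurable_on_def by auto
  \<comment> \<open>radial clipping: the identity where \<open>|g| \<le> \<omega>\<close>, otherwise rescaling to modulus \<open>\<omega>\<close>\<close>
  define w where "w n x = g n x / complex_of_real (max 1 (norm (g n x) / \<omega> x))" for n x
  have w_bd: "norm (w n x) \<le> \<omega> x" for n x
  proof (cases "norm (g n x) \<le> \<omega> x")
    case True
    then have "max 1 (norm (g n x) / \<omega> x) = 1" using \<omega>[of x] by (simp add: field_simps)
    then show ?thesis using True by (simp add: w_def)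
  next
    case False
    then have "max 1 (norm (g n x) / \<omega> x) = norm (g n x) / \<omega> x" "norm (g n x) > 0"
      using \<omega>[of x] by (auto simp: field_simps)
    then show ?thesis using \<omega>[of x] by (simp add: w_def norm_divide norm_mult)
  qed
  have cont: "continuous_on UNIV (w n)" for n
  proof -
    have "complex_of_real (max 1 (norm (g n x) / \<omega> x)) \<noteq> 0" "\<omega> x \<noteq> 0" for x
      using \<omega>[of x] by (simp_all only: of_real_eq_0_iff)
    then show ?thesis unfolding w_def
      by (intro continuous_intros g cont_\<omega>) auto
  qed
  have [measurable]: "w n \<in> borel_measurable borel" for n
    by (intro borel_measurable_continuous_onI cont)
  have test: "test_fun (w n)" for n
    unfolding test_fun_def
  proof (intro conjI cont)
    have "\<omega> x \<le> R" for x using R by (simp add: \<omega>_def mult_left_le)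
    then show "bounded (range (w n))"
      unfolding bounded_iff by (intro exI[of _ R]) (auto intro: order_trans[OF w_bd])
    show "integrable lborel (w n)"
    proof (rule Bochner_Integration.integrable_bound)
      show "integrable lborel (\<lambda>x. complex_of_real R * complex_of_real (gauss 1 (x::'a)))"
        by (intro integrable_mult_right gauss_integrable) simp
      show "AE x in lborel. norm (w n x) \<le> norm (complex_of_real R * complex_of_real (gauss 1 x))"
        using w_bd R by (simp add: \<omega>_def norm_mult)
    qed measurable
  qed
  have AE_N: "AE x in lborel. x \<notin> N"
    using N by (subst AE_completion_iff[symmetric]) (auto simp: negligible_iff_null_sets intro: AE_not_in)
  have "(\<lambda>k. nsq (\<lambda>x. w k x - f x)) \<longlonglongrightarrow> 0"
  proof (rule nsq_dominated[OF _ gauss_Lp2[of "2 * R"]])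
    have "norm (w k x - f x) \<le> 2 * R * gauss 1 x" for k x
      using norm_triangle_ineq4[of "w k x" "f x"] w_bd[of k x] bd[of x] by (simp add: \<omega>_def)
    then show "AE x in lborel. norm (w k x - f x) \<le> norm (complex_of_real (2 * R * gauss 1 x))" for k
      using R by (simp add: norm_mult)
    show "AE x in lborel. (\<lambda>k. w k x - f x) \<longlonglongrightarrow> 0"
      using AE_N
    proof eventually_elim
      case (elim x)
      have "max 1 (norm (f x) / \<omega> x) = 1"
        using bd[of x] \<omega>[of x] by (simp add: \<omega>_def field_simps)
      moreover have "(\<lambda>k. w k x - f x) \<longlonglongrightarrow> f x / complex_of_real (max 1 (norm (f x) / \<omega> x)) - f x"
        unfolding w_def using \<omega>[of x] by (intro tendsto_intros lim[OF elim]) auto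
      ultimately show ?case by simp
    qed
  qed measurable
  with test show ?thesis by blast
qed

text \<open>
  Cutting off where \<open>f\<close> exceeds a large multiple of a Gaussian truncates height and support in one
  step.
\<close>

lemma test_fun_dense:
  fixes f :: "'a::euclidean_space \<Rightarrow> complex"
  assumes f: "f \<in> Lp 2"
  shows "\<exists>w. (\<forall>k. test_fun (w k)) \<and> (\<lambda>k::nat. nsq (\<lambda>x. w k x - f x)) \<longlonglongrightarrow> 0"
proof -
  have [measurable]: "f \<in> borel_measurable borel" using f by measurable
  define F where "F k x = (if norm (f x) \<le> real (Suc k) * gauss 1 x then f x else 0)" for k :: nat and x
  have [measurable]: "F k \<in> borel_measurable borel" for k unfolding F_def[abs_def] by measurable
  have F_bd: "norm (F k x) \<le> real (Suc k) * gauss 1 x" for k x by (simp add: F_def)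
  have F: "(\<lambda>k. nsq (\<lambda>x. F k x - f x)) \<longlonglongrightarrow> 0"
  proof (rule nsq_dominated[OF _ f])
    show "AE x in lborel. norm (F k x - f x) \<le> norm (f x)" for k by (auto simp: F_def)
    show "AE x in lborel. (\<lambda>k. F k x - f x) \<longlonglongrightarrow> 0"
    proof (intro AE_I2 tendsto_eventually)
      fix x
      obtain n where n: "norm (f x) / gauss 1 x < real n" using reals_Archimedean2 by blast
      have "F k x - f x = 0" if "k \<ge> n" for k
      proof -
        have "norm (f x) / gauss 1 x \<le> real (Suc k)" using n that by simp
        then show ?thesis using gauss_pos[of 1 x] by (simp add: F_def field_simps)
      qed
      then show "\<forall>\<^sub>F k in sequentially. F k x - f x = 0" by (rule eventually_sequentiallyI)
    qed
  qed measurable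
  have "\<exists>w. test_fun w \<and> nsq (\<lambda>x. w x - F k x) < ennreal (inverse (real (Suc k)))" for k
  proof -
    obtain w where w: "\<And>n. test_fun (w n)" "(\<lambda>n::nat. nsq (\<lambda>x. w n x - F k x)) \<longlonglongrightarrow> 0"
      using test_fun_dense_aux[of "F k" "real (Suc k)", OF _ _ F_bd] by auto
    from order_tendstoD(2)[OF w(2), of "ennreal (inverse (real (Suc k)))"]
    obtain n where "nsq (\<lambda>x. w n x - F k x) < ennreal (inverse (real (Suc k)))"
      by (auto simp: eventually_sequentially)
    with w(1) show ?thesis by blast
  qed
  then obtain w where w: "\<And>k. test_fun (w k)"
    and wF: "\<And>k. nsq (\<lambda>x. w k x - F k x) < ennreal (inverse (real (Suc k)))" by metis
  have [measurable]: "w k \<in> borel_measurable borel" for k using test_fun_Lp2[OF w, of k] by measurable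
  have "(\<lambda>k. nsq (\<lambda>x. w k x - f x)) \<longlonglongrightarrow> 0"
  proof (rule tendsto_0_le_ennreal)
    show "\<forall>\<^sub>F k in sequentially. nsq (\<lambda>x. w k x - f x)
        \<le> 2 * ennreal (inverse (real (Suc k))) + 2 * nsq (\<lambda>x. F k x - f x)"
    proof (intro always_eventually allI)
      fix k
      have "nsq (\<lambda>x. w k x - f x) \<le> 2 * nsq (\<lambda>x. w k x - F k x) + 2 * nsq (\<lambda>x. F k x - f x)"
        by (rule nsq_triangle) measurable
      also have "\<dots> \<le> 2 * ennreal (inverse (real (Suc k))) + 2 * nsq (\<lambda>x. F k x - f x)"
        using wF[of k] by (intro add_mono mult_left_mono) auto
      finally show "nsq (\<lambda>x. w k x - f x)
        \<le> 2 * ennreal (inverse (real (Suc k))) + 2 * nsq (\<lambda>x. F k x - f x)" .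
    qed
    show "(\<lambda>k. 2 * ennreal (inverse (real (Suc k))) + 2 * nsq (\<lambda>x. F k x - f x)) \<longlonglongrightarrow> 0"
      using tendsto_two_sum_ennreal[OF tendsto_ennrealI[OF LIMSEQ_inverse_real_of_nat] F] by simp
  qed
  with w show ?thesis by blast
qed

lemma fourier_L1_diff:
  assumes "integrable lborel f" "integrable lborel g"
  shows "fourier_L1 (\<lambda>x. f x - g x) \<xi> = fourier_L1 f \<xi> - fourier_L1 g \<xi>"
  using integrable_cis_mult[OF assms(1), of "\<lambda>x. - (x \<bullet> \<xi>)"]
    integrable_cis_mult[OF assms(2), of "\<lambda>x. - (x \<bullet> \<xi>)"]
  by (simp add: fourier_L1_def right_diff_distrib scaleR_right_diff_distrib)

lemma fourier_L1_cmult: "fourier_L1 (\<lambda>x. c * f x) \<xi> = c * fourier_L1 f \<xi>"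
proof -
  have "(LINT x|lborel. cis (- (x \<bullet> \<xi>)) * (c * f x)) = (LINT x|lborel. c * (cis (- (x \<bullet> \<xi>)) * f x))"
    by (intro Bochner_Integration.integral_cong) (auto simp: mult_ac)
  then show ?thesis by (simp add: fourier_L1_def)
qed

lemma fourier_L1_reflect:
  fixes f :: "'a::euclidean_space \<Rightarrow> complex"
  assumes [measurable]: "f \<in> borel_measurable borel"
  shows "fourier_L1 (\<lambda>x. f (- x)) \<xi> = fourier_L1 f (- \<xi>)"
  using integral_lborel_uminus[of "\<lambda>x. cis (x \<bullet> \<xi>) * f x"] by (simp add: fourier_L1_def)

lemma fourier_L1_Lp2:
  assumes "integrable lborel h" "h \<in> Lp 2"
  shows "fourier_L1 h \<in> Lp 2"
  using nsq_fourier_L1_le[OF assms(1)] assms(2) by (auto simp: Lp2_iff intro: le_less_trans)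

text \<open>
  The approximation clause of \<^const>\<open>is_fourier_L2\<close>, expressed with the extended norm and named
  so that witnessing sequences can be manipulated.
\<close>

definition fourier_approx ::
  "('a::euclidean_space \<Rightarrow> complex) \<Rightarrow> ('a \<Rightarrow> complex) \<Rightarrow> (nat \<Rightarrow> 'a \<Rightarrow> complex) \<Rightarrow> bool" where
  "fourier_approx f g h \<longleftrightarrow> (\<forall>k. integrable lborel (h k) \<and> h k \<in> Lp 2) \<and>
     (\<lambda>k. nsq (\<lambda>x. h k x - f x)) \<longlonglongrightarrow> 0 \<and> (\<lambda>k. nsq (\<lambda>x. fourier_L1 (h k) x - g x)) \<longlonglongrightarrow> 0"

lemma is_fourier_L2_iff:
  "is_fourier_L2 f g \<longleftrightarrow> f \<in> Lp 2 \<and> g \<in> Lp 2 \<and> (\<exists>h. fourier_approx f g h)"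
  unfolding is_fourier_L2_def fourier_approx_def tendsto_Lp2_iff
  by (auto simp: Lp1_iff Lp2_diff fourier_L1_Lp2)

lemma fourier_approx_diff:
  assumes 1: "fourier_approx f g h" "f \<in> Lp 2" "g \<in> Lp 2"
    and 2: "fourier_approx f' g' h'" "f' \<in> Lp 2" "g' \<in> Lp 2"
  shows "fourier_approx (\<lambda>x. f x - f' x) (\<lambda>x. g x - g' x) (\<lambda>k x. h k x - h' k x)"
proof -
  have h: "integrable lborel (h k)" "h k \<in> Lp 2" "integrable lborel (h' k)" "h' k \<in> Lp 2" for k
    using 1 2 by (auto simp: fourier_approx_def)
  note [measurable] = 1(2,3)[THEN Lp2_measurable] 2(2,3)[THEN Lp2_measurable] h(2,4)[THEN Lp2_measurable]
  have lims: "(\<lambda>k. nsq (\<lambda>x. h k x - f x)) \<longlonglongrightarrow> 0" "(\<lambda>k. nsq (\<lambda>x. h' k x - f' x)) \<longlonglongrightarrow> 0"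
    "(\<lambda>k. nsq (\<lambda>x. fourier_L1 (h k) x - g x)) \<longlonglongrightarrow> 0" "(\<lambda>k. nsq (\<lambda>x. fourier_L1 (h' k) x - g' x)) \<longlonglongrightarrow> 0"
    using 1 2 by (auto simp: fourier_approx_def)
  have "(\<lambda>k. nsq (\<lambda>x. h k x - h' k x - (f x - f' x))) \<longlonglongrightarrow> 0"
  proof (rule tendsto_0_le_ennreal)
    have "nsq (\<lambda>x. (h k x - f x) - (h' k x - f' x)) \<le> 2 * nsq (\<lambda>x. h k x - f x) + 2 * nsq (\<lambda>x. h' k x - f' x)" for k
      by (rule nsq_diff_le) measurable
    then show "\<forall>\<^sub>F k in sequentially. nsq (\<lambda>x. h k x - h' k x - (f x - f' x))
        \<le> 2 * nsq (\<lambda>x. h k x - f x) + 2 * nsq (\<lambda>x. h' k x - f' x)"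
      by (simp add: algebra_simps)
    show "(\<lambda>k. 2 * nsq (\<lambda>x. h k x - f x) + 2 * nsq (\<lambda>x. h' k x - f' x)) \<longlonglongrightarrow> 0"
      using tendsto_two_sum_ennreal[OF lims(1,2)] by simp
  qed
  moreover have "(\<lambda>k. nsq (\<lambda>x. fourier_L1 (\<lambda>x. h k x - h' k x) x - (g x - g' x))) \<longlonglongrightarrow> 0"
  proof (rule tendsto_0_le_ennreal)
    have "nsq (\<lambda>x. (fourier_L1 (h k) x - g x) - (fourier_L1 (h' k) x - g' x))
       \<le> 2 * nsq (\<lambda>x. fourier_L1 (h k) x - g x) + 2 * nsq (\<lambda>x. fourier_L1 (h' k) x - g' x)" for k
      by (rule nsq_diff_le) measurable
    then show "\<forall>\<^sub>F k in sequentially. nsq (\<lambda>x. fourier_L1 (\<lambda>x. h k x - h' k x) x - (g x - g' x))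
        \<le> 2 * nsq (\<lambda>x. fourier_L1 (h k) x - g x) + 2 * nsq (\<lambda>x. fourier_L1 (h' k) x - g' x)"
      by (simp add: fourier_L1_diff h algebra_simps)
    show "(\<lambda>k. 2 * nsq (\<lambda>x. fourier_L1 (h k) x - g x) + 2 * nsq (\<lambda>x. fourier_L1 (h' k) x - g' x)) \<longlonglongrightarrow> 0"
      using tendsto_two_sum_ennreal[OF lims(3,4)] by simp
  qed
  ultimately show ?thesis
    unfolding fourier_approx_def using h by (auto intro: Lp2_diff)
qed

lemma is_fourier_L2_diff:
  assumes "is_fourier_L2 f g" "is_fourier_L2 f' g'"
  shows "is_fourier_L2 (\<lambda>x. f x - f' x) (\<lambda>x. g x - g' x)"
  using assms unfolding is_fourier_L2_iff by (blast intro: Lp2_diff fourier_approx_diff)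

lemma is_fourier_L2_cmult:
  assumes "is_fourier_L2 f g"
  shows "is_fourier_L2 (\<lambda>x. c * f x) (\<lambda>x. c * g x)"
proof -
  obtain h where f: "f \<in> Lp 2" and g: "g \<in> Lp 2" and h: "fourier_approx f g h"
    using assms unfolding is_fourier_L2_iff by blast
  have hk: "integrable lborel (h k)" "h k \<in> Lp 2" for k using h by (auto simp: fourier_approx_def)
  note [measurable] = f[THEN Lp2_measurable] g[THEN Lp2_measurable] hk(2)[THEN Lp2_measurable]
  have lim: "(\<lambda>k. ennreal ((norm c)\<^sup>2) * X k) \<longlonglongrightarrow> 0" if "X \<longlonglongrightarrow> 0" for X
    using ennreal_tendsto_cmult[OF _ that, of "ennreal ((norm c)\<^sup>2)"] by simp
  have "nsq (\<lambda>x. c * u x - c * v x) = ennreal ((norm c)\<^sup>2) * nsq (\<lambda>x. u x - v x)"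
    if [measurable]: "u \<in> borel_measurable borel" "v \<in> borel_measurable borel" for u v :: "'a \<Rightarrow> complex"
    using nsq_cmult[of "\<lambda>x. u x - v x" c] by (simp add: algebra_simps)
  then have "fourier_approx (\<lambda>x. c * f x) (\<lambda>x. c * g x) (\<lambda>k x. c * h k x)"
    using h lim hk by (simp add: fourier_approx_def fourier_L1_cmult Lp2_cmult)
  then show ?thesis using f g unfolding is_fourier_L2_iff by (blast intro: Lp2_cmult)
qed

lemma is_fourier_L2_reflect:
  assumes "is_fourier_L2 f g"
  shows "is_fourier_L2 (\<lambda>x. f (- x)) (\<lambda>x. g (- x))"
proof -
  obtain h where f: "f \<in> Lp 2" and g: "g \<in> Lp 2" and h: "fourier_approx f g h"
    using assms unfolding is_fourier_L2_iff by blast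
  have hk: "integrable lborel (h k)" "h k \<in> Lp 2" for k using h by (auto simp: fourier_approx_def)
  note [measurable] = f[THEN Lp2_measurable] g[THEN Lp2_measurable] hk(2)[THEN Lp2_measurable]
  have "nsq (\<lambda>x. u (- x) - v (- x)) = nsq (\<lambda>x. u x - v x)"
    if [measurable]: "u \<in> borel_measurable borel" "v \<in> borel_measurable borel" for u v :: "'a \<Rightarrow> complex"
    using nsq_reflect[of "\<lambda>x. u x - v x"] by simp
  then have "fourier_approx (\<lambda>x. f (- x)) (\<lambda>x. g (- x)) (\<lambda>k x. h k (- x))"
    using h hk by (simp add: fourier_approx_def fourier_L1_reflect Lp2_reflect integrable_lborel_uminus)
  then show ?thesis using f g unfolding is_fourier_L2_iff by (blast intro: Lp2_reflect)
qed

text \<open>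
  The bound for integrable functions passes to limits; the constant \<open>4\<close> comes from two uses of
  \<open>nsq_add_le\<close>.
\<close>

lemma is_fourier_L2_bound:
  assumes "is_fourier_L2 f g"
  shows "nsq g \<le> 4 * nsq f"
proof -
  obtain h where f: "f \<in> Lp 2" and g: "g \<in> Lp 2" and h: "fourier_approx f g h"
    using assms unfolding is_fourier_L2_iff by blast
  have hk: "integrable lborel (h k)" "h k \<in> Lp 2" for k using h by (auto simp: fourier_approx_def)
  note [measurable] = f[THEN Lp2_measurable] g[THEN Lp2_measurable] hk(2)[THEN Lp2_measurable]
  have "nsq g \<le> 2 * nsq (\<lambda>x. fourier_L1 (h k) x - g x) + 2 * (2 * nsq (\<lambda>x. h k x - f x) + 2 * nsq f)" for k
  proof -
    have "nsq g \<le> 2 * nsq (\<lambda>x. g x - fourier_L1 (h k) x) + 2 * nsq (fourier_L1 (h k))"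
      using nsq_add_le[of "\<lambda>x. g x - fourier_L1 (h k) x" "fourier_L1 (h k)"] by simp
    also have "nsq (fourier_L1 (h k)) \<le> nsq (h k)" by (rule nsq_fourier_L1_le[OF hk(1)])
    also have "nsq (h k) \<le> 2 * nsq (\<lambda>x. h k x - f x) + 2 * nsq f"
      using nsq_add_le[of "\<lambda>x. h k x - f x" f] by simp
    finally show ?thesis by (simp add: nsq_minus_commute mult_left_mono add_left_mono)
  qed
  moreover have "(\<lambda>k. 2 * nsq (\<lambda>x. fourier_L1 (h k) x - g x) + 2 * (2 * nsq (\<lambda>x. h k x - f x) + 2 * nsq f))
     \<longlonglongrightarrow> 2 * 0 + 2 * (2 * 0 + 2 * nsq f)"
    using h by (intro tendsto_two_sum_ennreal tendsto_const) (auto simp: fourier_approx_def)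
  ultimately have "nsq g \<le> 2 * 0 + 2 * (2 * 0 + 2 * nsq f)"
    by (intro LIMSEQ_le_const) auto
  then show ?thesis by (simp flip: mult.assoc)
qed

text \<open>
  Uniqueness up to null sets makes the values chosen by \<^const>\<open>fourier\<close> and \<^const>\<open>inv_fourier\<close>
  interchangeable with any explicitly known transform.
\<close>

lemma is_fourier_L2_unique:
  assumes "is_fourier_L2 f g" "is_fourier_L2 f' g'" "AE x in lborel. f x = f' x"
  shows "AE x in lborel. g x = g' x"
proof -
  have d: "is_fourier_L2 (\<lambda>x. f x - f' x) (\<lambda>x. g x - g' x)" by (rule is_fourier_L2_diff[OF assms(1,2)])
  then have [measurable]: "(\<lambda>x. g x - g' x) \<in> borel_measurable borel" "(\<lambda>x. f x - f' x) \<in> borel_measurable borel"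
    by (auto simp: is_fourier_L2_iff)
  have "nsq (\<lambda>x. f x - f' x) = nsq (\<lambda>x::'a. 0)"
    using assms(3) by (intro nsq_cong_AE) auto
  then have "nsq (\<lambda>x. f x - f' x) = 0" by (simp add: nsq_def)
  then have "nsq (\<lambda>x. g x - g' x) = 0" using is_fourier_L2_bound[OF d] by simp
  from nsq_eq_0_AE[OF _ this] show ?thesis by simp
qed

lemma is_fourier_L2_cong_AE:
  assumes "is_fourier_L2 f g" "AE x in lborel. g x = g' x" and [measurable]: "g' \<in> borel_measurable borel"
  shows "is_fourier_L2 f g'"
proof -
  have g': "g' \<in> Lp 2" using assms by (intro Lp2_bound[of g g']) (auto simp: is_fourier_L2_iff)
  have "nsq (\<lambda>x. u x - g' x) = nsq (\<lambda>x. u x - g x)" for u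
    using assms(2) by (intro nsq_cong_AE) auto
  then show ?thesis using assms(1) g' by (auto simp: is_fourier_L2_iff fourier_approx_def)
qed

lemma is_fourier_L2_test_fun:
  assumes "test_fun w"
  shows "is_fourier_L2 w (fourier_L1 w)"
proof -
  have "integrable lborel w" "w \<in> Lp 2" using assms by (auto simp: test_fun_def test_fun_Lp2)
  moreover have "fourier_approx w (fourier_L1 w) (\<lambda>_. w)"
    using calculation by (simp add: fourier_approx_def nsq_def)
  ultimately show ?thesis by (auto simp: is_fourier_L2_iff fourier_L1_Lp2)
qed

lemma fast_subseq_ennreal:
  fixes X :: "nat \<Rightarrow> ennreal"
  assumes "X \<longlonglongrightarrow> 0"
  shows "\<exists>r. \<forall>k. X (r k) \<le> ennreal ((1/8) ^ k)"
proof -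
  have "\<exists>n. X n \<le> ennreal ((1/8) ^ k)" for k
    using order_tendstoD(2)[OF assms, of "ennreal ((1/8) ^ k)"]
    by (auto simp: eventually_sequentially intro: less_imp_le)
  then show ?thesis by metis
qed

text \<open>
  The transforms of a fast approximating sequence form a fast Cauchy sequence.
\<close>

lemma is_fourier_L2_exists:
  fixes f :: "'a::euclidean_space \<Rightarrow> complex"
  assumes f: "f \<in> Lp 2"
  shows "\<exists>g. is_fourier_L2 f g"
proof -
  obtain w0 where w0: "\<And>k. test_fun (w0 k)" "(\<lambda>k::nat. nsq (\<lambda>x. w0 k x - f x)) \<longlonglongrightarrow> 0"
    using test_fun_dense[OF f] by blast
  obtain r where r: "\<And>k. nsq (\<lambda>x. w0 (r k) x - f x) \<le> ennreal ((1/8) ^ k)"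
    using fast_subseq_ennreal[OF w0(2)] by blast
  define w where "w k = w0 (r k)" for k
  have w: "integrable lborel (w k)" "w k \<in> Lp 2" for k
    using w0(1) by (auto simp: w_def test_fun_def test_fun_Lp2)
  note [measurable] = f[THEN Lp2_measurable] w(2)[THEN Lp2_measurable]
  have "nsq (\<lambda>x. fourier_L1 (w l) x - fourier_L1 (w k) x) \<le> ennreal (4 * (1/8) ^ k)" if "k \<le> l" for k l
  proof -
    have "nsq (\<lambda>x. fourier_L1 (w l) x - fourier_L1 (w k) x) = nsq (fourier_L1 (\<lambda>x. w l x - w k x))"
      by (intro arg_cong[of _ _ nsq] ext) (simp add: fourier_L1_diff w)
    also have "\<dots> \<le> nsq (\<lambda>x. w l x - w k x)"
      by (intro nsq_fourier_L1_le Bochner_Integration.integrable_diff w)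
    also have "\<dots> \<le> 2 * nsq (\<lambda>x. w l x - f x) + 2 * nsq (\<lambda>x. f x - w k x)"
      by (rule nsq_triangle) measurable
    also have "\<dots> \<le> 2 * ennreal ((1/8) ^ l) + 2 * ennreal ((1/8) ^ k)"
      using r[of l] r[of k] by (intro add_mono mult_left_mono) (auto simp: w_def nsq_minus_commute)
    also have "\<dots> = ennreal (2 * (1/8) ^ l + 2 * (1/8) ^ k)"
      by (simp add: ennreal_mult)
    also have "\<dots> \<le> ennreal (4 * (1/8) ^ k)"
      using power_decreasing[OF that, of "1/8::real"] by (intro ennreal_leI) simp
    finally show ?thesis .
  qed
  from L2_complete_fast[of "\<lambda>k. fourier_L1 (w k)", OF fourier_L1_Lp2[OF w] this]
  obtain g where g: "g \<in> Lp 2" "(\<lambda>k. nsq (\<lambda>x. fourier_L1 (w k) x - g x)) \<longlonglongrightarrow> 0" by blast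
  have "(\<lambda>k. nsq (\<lambda>x. w k x - f x)) \<longlonglongrightarrow> 0"
  proof (rule tendsto_0_le_ennreal)
    show "\<forall>\<^sub>F k in sequentially. nsq (\<lambda>x. w k x - f x) \<le> ennreal ((1/8) ^ k)"
      using r by (simp add: w_def)
    have "(\<lambda>k. (1/8::real) ^ k) \<longlonglongrightarrow> 0" by (intro LIMSEQ_power_zero) auto
    from tendsto_ennrealI[OF this] show "(\<lambda>k. ennreal ((1/8) ^ k)) \<longlonglongrightarrow> 0" by simp
  qed
  then have "fourier_approx f g w" using w g by (simp add: fourier_approx_def)
  then show ?thesis using f g by (auto simp: is_fourier_L2_iff)
qed

text \<open>
  The limit of the \<open>g\<close> sequence must be the transform of the limit of the \<open>f\<close> sequence, by the
  boundedness of the transform.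
\<close>

lemma is_fourier_L2_closed:
  assumes fg: "\<And>k::nat. is_fourier_L2 (f k) (g k)" and f0: "f0 \<in> Lp 2" and g0: "g0 \<in> Lp 2"
    and f: "(\<lambda>k. nsq (\<lambda>x. f k x - f0 x)) \<longlonglongrightarrow> 0" and g: "(\<lambda>k. nsq (\<lambda>x. g k x - g0 x)) \<longlonglongrightarrow> 0"
  shows "is_fourier_L2 f0 g0"
proof -
  obtain g1 where g1: "is_fourier_L2 f0 g1" using is_fourier_L2_exists[OF f0] by blast
  have gk: "g k \<in> Lp 2" "g1 \<in> Lp 2" for k using fg g1 by (auto simp: is_fourier_L2_iff)
  note [measurable] = gk[THEN Lp2_measurable] g0[THEN Lp2_measurable]
  have "nsq (\<lambda>x. g1 x - g0 x) \<le> 2 * (4 * nsq (\<lambda>x. f k x - f0 x)) + 2 * nsq (\<lambda>x. g k x - g0 x)" for k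
  proof -
    have "nsq (\<lambda>x. g1 x - g0 x) \<le> 2 * nsq (\<lambda>x. g1 x - g k x) + 2 * nsq (\<lambda>x. g k x - g0 x)"
      by (rule nsq_triangle) measurable
    also have "nsq (\<lambda>x. g1 x - g k x) \<le> 4 * nsq (\<lambda>x. f k x - f0 x)"
      using is_fourier_L2_bound[OF is_fourier_L2_diff[OF fg g1], of k] by (simp add: nsq_minus_commute)
    finally show ?thesis by (simp add: mult_left_mono add_right_mono)
  qed
  moreover have "(\<lambda>k. 2 * (4 * nsq (\<lambda>x. f k x - f0 x)) + 2 * nsq (\<lambda>x. g k x - g0 x)) \<longlonglongrightarrow> 2 * (4 * 0) + 2 * 0"
    by (intro tendsto_two_sum_ennreal ennreal_tendsto_cmult f g) auto
  ultimately have "nsq (\<lambda>x. g1 x - g0 x) \<le> 2 * (4 * 0) + 2 * 0"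
    by (intro LIMSEQ_le_const) auto
  then have "nsq (\<lambda>x. g1 x - g0 x) = 0" by simp
  from nsq_eq_0_AE[OF _ this] have "AE x in lborel. g1 x = g0 x" by simp
  from is_fourier_L2_cong_AE[OF g1 this] show ?thesis by measurable
qed


text \<open>
  In this form the kernel is fixed and the width only enters through the argument of \<open>w\<close>, ready for
  dominated convergence.
\<close>

lemma heat_avg_eq:
  fixes w :: "'a::euclidean_space \<Rightarrow> complex"
  assumes s: "s > 0" and [measurable]: "w \<in> borel_measurable borel"
  shows "heat_avg s w x = (2 * pi) powr (- (real DIM('a) / 2)) *\<^sub>R
    (LINT z|lborel. complex_of_real (gauss 1 z) * w (x + s *\<^sub>R z))"
proof -
  have "(LINT y|lborel. complex_of_real (gauss (1/s) (y - x)) * w y)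
      = s ^ DIM('a) *\<^sub>R (LINT z|lborel. complex_of_real (gauss (1/s) (s *\<^sub>R z)) * w (x + s *\<^sub>R z))"
    using s by (subst lborel_affine[of s x]) (simp_all add: integral_density integral_distr)
  also have "(\<lambda>z::'a. gauss (1/s) (s *\<^sub>R z)) = gauss 1"
    using s by (auto simp: gauss_def)
  then have "(LINT z|lborel. complex_of_real (gauss (1/s) (s *\<^sub>R z)) * w (x + s *\<^sub>R z))
      = (LINT z|lborel. complex_of_real (gauss 1 z) * w (x + s *\<^sub>R z))" by metis
  finally show ?thesis using s by (simp add: heat_avg_def power_divide)
qed

lemma integral_gauss_1:
  "(LINT z|lborel. complex_of_real (gauss 1 (z::'a::euclidean_space))) = complex_of_real ((2 * pi) powr (real DIM('a) / 2))"
  using gaussian_nd(2)[of "0::'a"] by (simp add: gauss_def)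

lemma integral_gauss_1_real:
  "(LINT z|lborel. gauss 1 (z::'a::euclidean_space)) = (2 * pi) powr (real DIM('a) / 2)"
  using integral_gauss_1[where 'a='a] by (simp only: integral_complex_of_real of_real_eq_iff)

lemma heat_avg_test_bound:
  fixes w :: "'a::euclidean_space \<Rightarrow> complex"
  assumes s: "s > 0" and [measurable]: "w \<in> borel_measurable borel" and B: "\<And>x. norm (w x) \<le> B"
  shows "norm (heat_avg s w x) \<le> B"
proof -
  have int: "integrable lborel (\<lambda>z::'a. gauss 1 z)"
    using integrable_Re[OF gauss_integrable(1)[of 1]] by simp
  have "norm (LINT z|lborel. complex_of_real (gauss 1 z) * w (x + s *\<^sub>R z))
      \<le> (LINT z|lborel. B * gauss 1 (z::'a))"
  proof (rule Bochner_Integration.integral_norm_bound_integral)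
    have le: "norm (complex_of_real (gauss 1 z) * w (x + s *\<^sub>R z)) \<le> B * gauss 1 z" for z
      using mult_right_mono[OF B[of "x + s *\<^sub>R z"], of "gauss 1 z"] by (simp add: norm_mult mult.commute)
    then show "norm (complex_of_real (gauss 1 z) * w (x + s *\<^sub>R z)) \<le> B * gauss 1 z" for z .
    show int': "integrable lborel (\<lambda>z::'a. B * gauss 1 z)" using int by simp
    show "integrable lborel (\<lambda>z. complex_of_real (gauss 1 z) * w (x + s *\<^sub>R z))"
      by (rule Bochner_Integration.integrable_bound[OF int'])
         (measurable, intro AE_I2 order_trans[OF le], simp)
  qed
  also have "\<dots> = B * (2 * pi) powr (real DIM('a) / 2)" by (simp add: integral_gauss_1_real)
  finally have "(2 * pi) powr (- (real DIM('a) / 2)) * norm (LINT z|lborel. complex_of_real (gauss 1 z) * w (x + s *\<^sub>R z))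
      \<le> (2 * pi) powr (- (real DIM('a) / 2)) * (B * (2 * pi) powr (real DIM('a) / 2))"
    by (intro mult_left_mono) auto
  also have "\<dots> = B" by (simp add: powr_minus field_simps)
  finally show ?thesis using s by (simp add: heat_avg_eq norm_mult)
qed

lemma heat_avg_tendsto:
  fixes w :: "'a::euclidean_space \<Rightarrow> complex"
  assumes w: "test_fun w"
  shows "(\<lambda>k. heat_avg (1 / real (Suc k)) w x) \<longlonglongrightarrow> w x"
proof -
  have cont: "continuous_on UNIV w" and [measurable]: "w \<in> borel_measurable borel"
    using w by (auto simp: test_fun_def dest: borel_measurable_integrable)
  obtain B where B: "\<And>x. norm (w x) \<le> B" using w by (auto simp: test_fun_def bounded_iff)
  have int: "integrable lborel (\<lambda>z::'a. gauss 1 z)"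
    using integrable_Re[OF gauss_integrable(1)[of 1]] by simp
  have "(\<lambda>k. LINT z|lborel. complex_of_real (gauss 1 z) * w (x + (1 / real (Suc k)) *\<^sub>R z))
     \<longlonglongrightarrow> (LINT z|lborel. complex_of_real (gauss 1 (z::'a)) * w x)"
  proof (rule integral_dominated_convergence)
    show "integrable lborel (\<lambda>z::'a. B * gauss 1 z)" using int by simp
    show "AE z in lborel. norm (complex_of_real (gauss 1 z) * w (x + (1 / real (Suc k)) *\<^sub>R z)) \<le> B * gauss 1 z" for k
      using mult_left_mono[OF B gauss_nonneg] by (auto simp: norm_mult mult.commute[of B] simp del: of_nat_Suc)
    show "AE z in lborel. (\<lambda>k. complex_of_real (gauss 1 z) * w (x + (1 / real (Suc k)) *\<^sub>R z))
        \<longlonglongrightarrow> complex_of_real (gauss 1 z) * w x"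
    proof (intro AE_I2 tendsto_mult tendsto_const)
      fix z
      have "(\<lambda>k. x + (1 / real (Suc k)) *\<^sub>R z) \<longlonglongrightarrow> x + 0 *\<^sub>R z"
        by (intro tendsto_intros) (use LIMSEQ_inverse_real_of_nat in \<open>simp add: inverse_eq_divide\<close>)
      then show "(\<lambda>k. w (x + (1 / real (Suc k)) *\<^sub>R z)) \<longlonglongrightarrow> w x"
        by (intro continuous_on_tendsto_compose[OF cont]) auto
    qed
  qed measurable
  also have "(LINT z|lborel. complex_of_real (gauss 1 (z::'a)) * w x) = complex_of_real ((2 * pi) powr (real DIM('a) / 2)) * w x"
    by (simp add: integral_gauss_1_real)
  finally have "(\<lambda>k. (2 * pi) powr (- (real DIM('a) / 2)) *\<^sub>R (LINT z|lborel. complex_of_real (gauss 1 z) * w (x + (1 / real (Suc k)) *\<^sub>R z)))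
     \<longlonglongrightarrow> (2 * pi) powr (- (real DIM('a) / 2)) *\<^sub>R (complex_of_real ((2 * pi) powr (real DIM('a) / 2)) * w x)"
    by (intro tendsto_intros)
  also have "(2 * pi) powr (- (real DIM('a) / 2)) *\<^sub>R (complex_of_real ((2 * pi) powr (real DIM('a) / 2)) * w x) = w x"
    by (simp add: scaleR_conv_of_real powr_minus)
  finally show ?thesis by (simp add: heat_avg_eq)
qed

lemma Lp2_integrable: "f \<in> Lp 2 \<Longrightarrow> integrable lborel (\<lambda>x. (norm (f x))\<^sup>2)"
  by (simp add: Lp_def norm_powr_2)

lemma nsq_eq_integral: "f \<in> Lp 2 \<Longrightarrow> nsq f = ennreal (LINT x|lborel. (norm (f x))\<^sup>2)"
  unfolding nsq_def by (intro nn_integral_eq_integral Lp2_integrable) auto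

text \<open>
  Since averaging does not increase the norm, the squared distance is at most
  \<open>2 \<parallel>w\<parallel>\<^sup>2\<close> minus twice the real inner product of the average with \<open>w\<close>, and that inner product
  converges to \<open>\<parallel>w\<parallel>\<^sup>2\<close> by dominated convergence.
\<close>

lemma heat_avg_L2_tendsto:
  fixes w :: "'a::euclidean_space \<Rightarrow> complex"
  assumes w: "test_fun w" and le: "\<And>k. nsq (heat_avg (1 / real (Suc k)) w) \<le> nsq w"
    and [measurable]: "\<And>k. heat_avg (1 / real (Suc k)) w \<in> borel_measurable borel"
  shows "(\<lambda>k. nsq (\<lambda>x. heat_avg (1 / real (Suc k)) w x - w x)) \<longlonglongrightarrow> 0"
proof -
  let ?A = "\<lambda>k. heat_avg (1 / real (Suc k)) w"
  have w2: "w \<in> Lp 2" by (rule test_fun_Lp2[OF w])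
  have wi: "integrable lborel w" using w by (simp add: test_fun_def)
  note [measurable] = w2[THEN Lp2_measurable]
  obtain B where B: "\<And>x. norm (w x) \<le> B" using w by (auto simp: test_fun_def bounded_iff)
  have A: "?A k \<in> Lp 2" for k using le[of k] w2 assms(3)[of k] unfolding Lp2_iff by (auto intro: le_less_trans simp del: of_nat_Suc)
  have A_bd: "norm (?A k x * cnj (w x)) \<le> B * norm (w x)" for k x
    using mult_right_mono[OF heat_avg_test_bound[of "1 / real (Suc k)" w B x], of "norm (w x)"] B
    by (simp add: norm_mult)
  have dom: "integrable lborel (\<lambda>x. B * norm (w x))" using wi by simp
  have int: "integrable lborel (\<lambda>x. ?A k x * cnj (w x))" for k
    by (rule Bochner_Integration.integrable_bound[OF dom])
       (measurable, intro AE_I2 order_trans[OF A_bd], simp)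
  let ?I = "LINT x|lborel. (norm (w x))\<^sup>2"
  have "(\<lambda>k. LINT x|lborel. ?A k x * cnj (w x)) \<longlonglongrightarrow> (LINT x|lborel. w x * cnj (w x))"
  proof (rule integral_dominated_convergence[OF _ _ dom])
    show "AE x in lborel. (\<lambda>k. ?A k x * cnj (w x)) \<longlonglongrightarrow> w x * cnj (w x)"
      by (intro AE_I2 tendsto_mult tendsto_const heat_avg_tendsto w)
  qed (use A_bd in \<open>auto simp del: of_nat_Suc\<close>)
  also have "(LINT x|lborel. w x * cnj (w x)) = complex_of_real ?I"
    by (simp add: complex_norm_square[symmetric] del: of_real_power)
  finally have lim: "(\<lambda>k. Re (LINT x|lborel. ?A k x * cnj (w x))) \<longlonglongrightarrow> ?I"
    by (auto dest: tendsto_Re)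
  have bd: "nsq (\<lambda>x. ?A k x - w x) \<le> ennreal (2 * ?I - 2 * Re (LINT x|lborel. ?A k x * cnj (w x)))" for k
  proof -
    have "(norm (?A k x - w x))\<^sup>2 = (norm (?A k x))\<^sup>2 - 2 * Re (?A k x * cnj (w x)) + (norm (w x))\<^sup>2" for x
      unfolding cmod_power2 by (simp add: power2_eq_square algebra_simps)
    then have "(LINT x|lborel. (norm (?A k x - w x))\<^sup>2)
       = (LINT x|lborel. (norm (?A k x))\<^sup>2) - 2 * Re (LINT x|lborel. ?A k x * cnj (w x)) + ?I"
      using Lp2_integrable[OF A[of k]] Lp2_integrable[OF w2] int[of k] integrable_Re[OF int[of k]]
      by (simp del: complex_cnj_cnj Re_complex_of_real times_complex.sel)
    moreover have "(LINT x|lborel. (norm (?A k x))\<^sup>2) \<le> ?I"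
      using le[of k] nsq_eq_integral[OF A[of k]] nsq_eq_integral[OF w2]
      by (simp add: ennreal_le_iff Bochner_Integration.integral_nonneg)
    ultimately show ?thesis
      using nsq_eq_integral[OF Lp2_diff[OF A[of k] w2]] by (simp add: ennreal_leI)
  qed
  have lim0: "(\<lambda>k. ennreal (2 * ?I - 2 * Re (LINT x|lborel. ?A k x * cnj (w x)))) \<longlonglongrightarrow> 0"
    using tendsto_ennrealI[OF tendsto_diff[OF tendsto_const[of "2 * ?I"] tendsto_mult[OF tendsto_const[of 2] lim]]]
    by simp
  show ?thesis by (rule tendsto_0_le_ennreal[OF _ lim0]) (intro always_eventually allI bd)
qed

text \<open>
  Multiplying the transform of \<open>w\<close> by Gaussians yields integrable approximants, whose transforms are
  reflected Gaussian averages of \<open>w\<close> and so converge to the reflection of \<open>w\<close>.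
\<close>

lemma is_fourier_L2_inverse_test_fun:
  fixes w :: "'a::euclidean_space \<Rightarrow> complex"
  assumes w: "test_fun w"
  shows "is_fourier_L2 (fourier_L1 w) (\<lambda>x. w (- x))"
proof -
  have w2: "w \<in> Lp 2" by (rule test_fun_Lp2[OF w])
  have wi: "integrable lborel w" using w by (simp add: test_fun_def)
  have Fw: "fourier_L1 w \<in> Lp 2" by (rule fourier_L1_Lp2[OF wi w2])
  note [measurable] = w2[THEN Lp2_measurable]
  define s where "s k = 1 / real (Suc k)" for k
  have s: "s k > 0" for k by (simp add: s_def)
  define h where "h k \<xi> = complex_of_real (gauss (s k) \<xi>) * fourier_L1 w \<xi>" for k \<xi>
  have [measurable]: "h k \<in> borel_measurable borel" for k unfolding h_def[abs_def] by measurable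
  have h_le: "norm (h k \<xi>) \<le> norm (fourier_L1 w \<xi>)" for k \<xi>
    by (simp add: h_def norm_mult mult_left_le_one_le)
  have h2: "h k \<in> Lp 2" for k
    by (rule Lp2_bound[OF Fw]) (use h_le in auto)
  have hi: "integrable lborel (h k)" for k
    unfolding h_def[abs_def] by (rule integrable_gauss_fourier[OF s wi])
  have Fh: "fourier_L1 (h k) (- x) = heat_avg (s k) w x" for k x
    unfolding h_def[abs_def] by (rule fourier_L1_gauss_fourier_L1[OF s wi])
  have A: "heat_avg (s k) w = (\<lambda>x. fourier_L1 (h k) (- x))" for k
    by (simp add: Fh)
  have Am [measurable]: "heat_avg (s k) w \<in> borel_measurable borel" for k unfolding A by measurable
  have "nsq (heat_avg (s k) w) \<le> nsq w" for k
  proof -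
    have "nsq (heat_avg (s k) w) = nsq (fourier_L1 (h k))" unfolding A by (rule nsq_reflect) measurable
    also have "\<dots> \<le> nsq (h k)" by (rule nsq_fourier_L1_le[OF hi])
    also have "\<dots> \<le> nsq (fourier_L1 w)" by (intro nsq_mono_AE) (simp add: h_le)
    also have "\<dots> \<le> nsq w" by (rule nsq_fourier_L1_le[OF wi])
    finally show ?thesis .
  qed
  from heat_avg_L2_tendsto[OF w this[unfolded s_def] Am[unfolded s_def]]
  have lim: "(\<lambda>k. nsq (\<lambda>x. heat_avg (s k) w x - w x)) \<longlonglongrightarrow> 0" by (simp add: s_def)
  have "nsq (\<lambda>x. fourier_L1 (h k) x - w (- x)) = nsq (\<lambda>x. heat_avg (s k) w x - w x)" for k
    using nsq_reflect[of "\<lambda>x. fourier_L1 (h k) x - w (- x)"] by (simp add: A)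
  moreover have "(\<lambda>k. nsq (\<lambda>x. h k x - fourier_L1 w x)) \<longlonglongrightarrow> 0"
  proof (rule nsq_dominated[OF _ Fw])
    fix k
    have "norm (h k x - fourier_L1 w x) \<le> norm (fourier_L1 w x)" for x
    proof -
      have "h k x - fourier_L1 w x = complex_of_real (gauss (s k) x - 1) * fourier_L1 w x"
        by (simp add: h_def algebra_simps)
      moreover have "\<bar>gauss (s k) x - 1\<bar> \<le> 1" using gauss_nonneg[of "s k" x] gauss_le_1[of "s k" x] by linarith
      ultimately show ?thesis by (simp only: norm_mult norm_of_real) (simp add: mult_left_le_one_le)
    qed
    then show "AE x in lborel. norm (h k x - fourier_L1 w x) \<le> norm (fourier_L1 w x)" by simp
  next
    show "AE x in lborel. (\<lambda>k. h k x - fourier_L1 w x) \<longlonglongrightarrow> 0"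
    proof (intro AE_I2)
      fix x
      have "(\<lambda>k. h k x - fourier_L1 w x) \<longlonglongrightarrow> complex_of_real 1 * fourier_L1 w x - fourier_L1 w x"
        unfolding h_def s_def by (intro tendsto_intros gauss_tendsto_1)
      then show "(\<lambda>k. h k x - fourier_L1 w x) \<longlonglongrightarrow> 0" by simp
    qed
  qed measurable
  ultimately have "fourier_approx (fourier_L1 w) (\<lambda>x. w (- x)) h"
    using lim h2 hi by (simp add: fourier_approx_def)
  then show ?thesis using Fw w2 by (auto simp: is_fourier_L2_iff Lp2_reflect)
qed

text \<open>
  Fourier inversion: the transform applied twice is the reflection.
\<close>

lemma is_fourier_L2_inverse:
  assumes "is_fourier_L2 f g"
  shows "is_fourier_L2 g (\<lambda>x. f (- x))"
proof -
  have f: "f \<in> Lp 2" and g: "g \<in> Lp 2" using assms by (auto simp: is_fourier_L2_iff)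
  obtain w where w: "\<And>k. test_fun (w k)" "(\<lambda>k::nat. nsq (\<lambda>x. w k x - f x)) \<longlonglongrightarrow> 0"
    using test_fun_dense[OF f] by blast
  note [measurable] = f[THEN Lp2_measurable] test_fun_Lp2[OF w(1), THEN Lp2_measurable]
  show ?thesis
  proof (rule is_fourier_L2_closed[OF is_fourier_L2_inverse_test_fun[OF w(1)] g Lp2_reflect[OF f]])
    show "(\<lambda>k. nsq (\<lambda>x. fourier_L1 (w k) x - g x)) \<longlonglongrightarrow> 0"
    proof (rule tendsto_0_le_ennreal)
      show "\<forall>\<^sub>F k in sequentially. nsq (\<lambda>x. fourier_L1 (w k) x - g x) \<le> 4 * nsq (\<lambda>x. w k x - f x)"
        using is_fourier_L2_bound[OF is_fourier_L2_diff[OF is_fourier_L2_test_fun[OF w(1)] assms]] by simp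
      show "(\<lambda>k. 4 * nsq (\<lambda>x. w k x - f x)) \<longlonglongrightarrow> 0"
        using ennreal_tendsto_cmult[OF _ w(2), of 4] by simp
    qed
    show "(\<lambda>k. nsq (\<lambda>x. w k (- x) - f (- x))) \<longlonglongrightarrow> 0"
      using w(2) nsq_reflect[of "\<lambda>x. w k x - f x" for k] by simp
  qed
qed

lemma is_fourier_L2_surj:
  assumes "g \<in> Lp 2"
  shows "\<exists>f. is_fourier_L2 f g"
proof -
  obtain h where "is_fourier_L2 g h" using is_fourier_L2_exists[OF assms] by blast
  from is_fourier_L2_reflect[OF is_fourier_L2_inverse[OF this]]
  have "is_fourier_L2 (\<lambda>x. h (- x)) g" by simp
  then show ?thesis by blast
qed

lemma is_fourier_L2_bound_inverse:
  assumes "is_fourier_L2 f g"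
  shows "nsq f \<le> 4 * nsq g"
proof -
  have "f \<in> Lp 2" using assms by (simp add: is_fourier_L2_iff)
  then have "nsq (\<lambda>x. f (- x)) = nsq f" by (intro nsq_reflect Lp2_measurable)
  with is_fourier_L2_bound[OF is_fourier_L2_inverse[OF assms]] show ?thesis by simp
qed

lemma is_fourier_L2_fourier: "f \<in> Lp 2 \<Longrightarrow> is_fourier_L2 f (fourier f)"
  unfolding fourier_def by (rule someI_ex[OF is_fourier_L2_exists])

lemma is_fourier_L2_inv_fourier: "g \<in> Lp 2 \<Longrightarrow> is_fourier_L2 (inv_fourier g) g"
  unfolding inv_fourier_def by (rule someI_ex[OF is_fourier_L2_surj])

lemma fourier_Lp2: "f \<in> Lp 2 \<Longrightarrow> fourier f \<in> Lp 2"
  using is_fourier_L2_fourier by (auto simp: is_fourier_L2_iff)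

lemma inv_fourier_Lp2: "f \<in> Lp 2 \<Longrightarrow> inv_fourier f \<in> Lp 2"
  using is_fourier_L2_inv_fourier by (auto simp: is_fourier_L2_iff)

text \<open>
  Truncation in space puts \<open>w\<close> into \<open>L\<^sup>1\<close> without increasing its \<open>L\<^sup>m\<close> norm; the truncations converge
  in \<open>L\<^sup>2\<close>, so the bound passes to the limit with a harmless factor \<open>2\<close>.
\<close>

lemma fourier_gauss_bound_Lm:
  fixes w :: "'a::euclidean_space \<Rightarrow> complex"
  assumes s: "s > 0" and m: "1 \<le> m" "m \<le> 2" and w2: "w \<in> Lp 2" and wm: "w \<in> Lp m"
  shows "(\<integral>\<^sup>+\<xi>. ennreal (gauss s \<xi>) * ennreal ((norm (fourier w \<xi>))\<^sup>2) \<partial>lborel)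
    \<le> 2 * ennreal (((2 * pi) powr (real DIM('a) / 2) * s ^ DIM('a)) powr (1 - 2 / m) * (Lp_norm m w)\<^sup>2)"
proof -
  let ?\<kappa> = "(2 * pi) powr (real DIM('a) / 2) * s ^ DIM('a)"
  note [measurable] = w2[THEN Lp2_measurable] fourier_Lp2[OF w2, THEN Lp2_measurable]
  define A where "A = (LINT x|lborel. norm (w x) powr m)"
  have int_m: "integrable lborel (\<lambda>x. norm (w x) powr m)" using wm by (simp add: Lp_def)
  have A0: "A \<ge> 0" by (simp add: A_def)
  have A: "A powr (2 / m) = (Lp_norm m w)\<^sup>2"
    using A0 m by (simp add: Lp_norm_def A_def[symmetric] powr_powr flip: powr_numeral)
  \<comment> \<open>on a ball, \<open>|w| \<le> 1 + |w|\<^sup>2\<close> makes the truncation integrable\<close>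
  define h where "h k x = (if norm x \<le> real k then w x else 0)" for k :: nat and x
  have [measurable]: "h k \<in> borel_measurable borel" for k unfolding h_def[abs_def] by measurable
  have h_le: "norm (h k x) \<le> norm (w x)" for k x by (simp add: h_def)
  have h2: "h k \<in> Lp 2" for k
    by (rule Lp2_bound[OF w2]) (use h_le in auto)
  have hi: "integrable lborel (h k)" for k
  proof (rule Bochner_Integration.integrable_bound)
    show "integrable lborel (\<lambda>x. indicator (cball 0 (real k)) x + (norm (w x))\<^sup>2)"
      by (intro Bochner_Integration.integrable_add Lp2_integrable w2)
         (auto intro!: integrable_real_indicator emeasure_bounded_finite)
    have "norm (h k x) \<le> indicator (cball 0 (real k)) x + (norm (w x))\<^sup>2" for x
    proof (cases "norm x \<le> real k")
      case True
      have "norm (w x) \<le> 1 + (norm (w x))\<^sup>2"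
      proof -
        have "2 * norm (w x) \<le> (norm (w x))\<^sup>2 + 1" using sum_squares_bound[of "norm (w x)" 1] by simp
        then show ?thesis using norm_ge_zero[of "w x"] by linarith
      qed
      then show ?thesis using True by (simp add: h_def)
    qed (simp add: h_def)
    then show "AE x in lborel. norm (h k x) \<le> norm (indicator (cball 0 (real k)) x + (norm (w x))\<^sup>2)"
      by (auto intro: order_trans[OF _ abs_ge_self])
  qed measurable
  have h_lim: "(\<lambda>k. nsq (\<lambda>x. h k x - w x)) \<longlonglongrightarrow> 0"
  proof (rule nsq_dominated[OF _ w2])
    show "AE x in lborel. norm (h k x - w x) \<le> norm (w x)" for k by (simp add: h_def)
    show "AE x in lborel. (\<lambda>k. h k x - w x) \<longlonglongrightarrow> 0"
    proof (intro AE_I2 tendsto_eventually)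
      fix x :: 'a
      obtain n where "norm x < real n" using reals_Archimedean2 by blast
      then show "\<forall>\<^sub>F k in sequentially. h k x - w x = 0"
        by (intro eventually_sequentiallyI[of n]) (simp add: h_def)
    qed
  qed measurable
  have bound: "(\<integral>\<^sup>+\<xi>. ennreal (gauss s \<xi> * (norm (fourier_L1 (h k) \<xi>))\<^sup>2) \<partial>lborel)
      \<le> ennreal (?\<kappa> powr (1 - 2 / m) * A powr (2 / m))" for k
  proof -
    have le: "norm (h k x) powr m \<le> norm (w x) powr m" for x
      using h_le m by (intro powr_mono2) auto
    have int: "integrable lborel (\<lambda>x. norm (h k x) powr m)"
      by (rule Bochner_Integration.integrable_bound[OF int_m]) (use le in auto)
    let ?A = "LINT x|lborel. norm (h k x) powr m"
    have "(\<integral>\<^sup>+\<xi>. ennreal (gauss s \<xi> * (norm (fourier_L1 (h k) \<xi>))\<^sup>2) \<partial>lborel)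
      \<le> ennreal (?\<kappa> powr (1 - 2 / m) * ?A powr (2 / m))"
      by (intro fourier_gauss_bound s m hi nn_integral_eq_integral int) auto
    also have "\<dots> \<le> ennreal (?\<kappa> powr (1 - 2 / m) * A powr (2 / m))"
      unfolding A_def using m le h_le
      by (intro ennreal_leI mult_left_mono powr_mono2 integral_mono int int_m) auto
    finally show ?thesis .
  qed
  have "(\<integral>\<^sup>+\<xi>. ennreal (gauss s \<xi>) * ennreal ((norm (fourier w \<xi>))\<^sup>2) \<partial>lborel)
      \<le> 2 * (4 * nsq (\<lambda>x. h k x - w x)) + 2 * ennreal (?\<kappa> powr (1 - 2 / m) * A powr (2 / m))" for k
  proof -
    have hk: "is_fourier_L2 (h k) (fourier_L1 (h k))"
    proof -
      have "fourier_approx (h k) (fourier_L1 (h k)) (\<lambda>_. h k)"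
        using hi h2 by (simp add: fourier_approx_def nsq_def)
      then show ?thesis using h2 fourier_L1_Lp2[OF hi h2] by (auto simp: is_fourier_L2_iff)
    qed
    have "(\<integral>\<^sup>+\<xi>. ennreal (gauss s \<xi>) * ennreal ((norm (fourier w \<xi>))\<^sup>2) \<partial>lborel)
        = nsq (\<lambda>\<xi>. complex_of_real (sqrt (gauss s \<xi>)) * fourier w \<xi>)"
      unfolding nsq_def by (intro nn_integral_cong) (simp add: norm_mult power_mult_distrib ennreal_mult)
    also have "\<dots> = nsq (\<lambda>\<xi>. complex_of_real (sqrt (gauss s \<xi>)) * (fourier w \<xi> - fourier_L1 (h k) \<xi>)
         + complex_of_real (sqrt (gauss s \<xi>)) * fourier_L1 (h k) \<xi>)"
      by (simp add: algebra_simps)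
    also have "\<dots> \<le> 2 * nsq (\<lambda>\<xi>. complex_of_real (sqrt (gauss s \<xi>)) * (fourier w \<xi> - fourier_L1 (h k) \<xi>))
         + 2 * nsq (\<lambda>\<xi>. complex_of_real (sqrt (gauss s \<xi>)) * fourier_L1 (h k) \<xi>)"
      by (rule nsq_add_le) measurable
    also have "nsq (\<lambda>\<xi>. complex_of_real (sqrt (gauss s \<xi>)) * (fourier w \<xi> - fourier_L1 (h k) \<xi>))
        \<le> nsq (\<lambda>\<xi>. fourier_L1 (h k) \<xi> - fourier w \<xi>)"
      by (intro nsq_mono_AE AE_I2) (simp add: norm_mult norm_minus_commute mult_left_le_one_le)
    also have "\<dots> \<le> 4 * nsq (\<lambda>x. h k x - w x)"
      by (rule is_fourier_L2_bound[OF is_fourier_L2_diff[OF hk is_fourier_L2_fourier[OF w2]]])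
    also have "nsq (\<lambda>\<xi>. complex_of_real (sqrt (gauss s \<xi>)) * fourier_L1 (h k) \<xi>)
        = (\<integral>\<^sup>+\<xi>. ennreal (gauss s \<xi> * (norm (fourier_L1 (h k) \<xi>))\<^sup>2) \<partial>lborel)"
      unfolding nsq_def by (intro nn_integral_cong) (simp add: norm_mult power_mult_distrib)
    also note bound[of k]
    finally show ?thesis by (simp add: mult_left_mono add_mono)
  qed
  moreover have "(\<lambda>k. 2 * (4 * nsq (\<lambda>x. h k x - w x)) + 2 * ennreal (?\<kappa> powr (1 - 2 / m) * A powr (2 / m)))
     \<longlonglongrightarrow> 2 * (4 * 0) + 2 * ennreal (?\<kappa> powr (1 - 2 / m) * A powr (2 / m))"
    by (intro tendsto_two_sum_ennreal ennreal_tendsto_cmult h_lim tendsto_const) auto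
  ultimately have "(\<integral>\<^sup>+\<xi>. ennreal (gauss s \<xi>) * ennreal ((norm (fourier w \<xi>))\<^sup>2) \<partial>lborel)
     \<le> 2 * (4 * 0) + 2 * ennreal (?\<kappa> powr (1 - 2 / m) * A powr (2 / m))"
    by (intro LIMSEQ_le_const) auto
  then show ?thesis by (simp add: A)
qed

section \<open>Pointwise bounds for the kernels\<close>

text \<open>
  The discriminant is real, so the roots are two real numbers or a conjugate pair; the two cases are
  made explicit here.
\<close>

lemma char_disc_nonneg:
  "r powr (4 * \<delta>) - 4 * r powr (2 * \<sigma>) \<ge> 0 \<Longrightarrow>
    char_disc \<sigma> \<delta> r = of_real (sqrt (r powr (4 * \<delta>) - 4 * r powr (2 * \<sigma>)))"
  unfolding char_disc_def by (rule of_real_sqrt[symmetric])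

lemma char_disc_neg:
  assumes "r powr (4 * \<delta>) - 4 * r powr (2 * \<sigma>) < 0"
  shows "char_disc \<sigma> \<delta> r = \<i> * of_real (sqrt (4 * r powr (2 * \<sigma>) - r powr (4 * \<delta>)))"
proof -
  have "complex_of_real (r powr (4 * \<delta>) - 4 * r powr (2 * \<sigma>))
      = complex_of_real (- (4 * r powr (2 * \<sigma>) - r powr (4 * \<delta>)))" by simp
  then show ?thesis unfolding char_disc_def
    using assms by (simp only: csqrt_of_real_nonpos) simp
qed

lemma char_disc_measurable [measurable]: "char_disc \<sigma> \<delta> \<in> borel_measurable borel"
proof -
  have "char_disc \<sigma> \<delta> r = (if r powr (4 * \<delta>) - 4 * r powr (2 * \<sigma>) \<ge> 0
      then of_real (sqrt (r powr (4 * \<delta>) - 4 * r powr (2 * \<sigma>)))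
      else \<i> * of_real (sqrt (4 * r powr (2 * \<sigma>) - r powr (4 * \<delta>))))" for r
    using char_disc_nonneg[where r=r] char_disc_neg[where r=r] by (simp add: not_le)
  then have "char_disc \<sigma> \<delta> = (\<lambda>r. if r powr (4 * \<delta>) - 4 * r powr (2 * \<sigma>) \<ge> 0
      then of_real (sqrt (r powr (4 * \<delta>) - 4 * r powr (2 * \<sigma>)))
      else \<i> * of_real (sqrt (4 * r powr (2 * \<sigma>) - r powr (4 * \<delta>))))" by (rule ext)
  then show ?thesis by simp
qed

lemma lambda_measurable [measurable]:
  "lambda1 \<sigma> \<delta> \<in> borel_measurable borel" "lambda2 \<sigma> \<delta> \<in> borel_measurable borel"
  unfolding lambda1_def[abs_def] lambda2_def[abs_def] by measurable

lemma kernel_measurable [measurable]: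
  "kernel0 \<sigma> \<delta> t \<in> borel_measurable borel" "kernel1 \<sigma> \<delta> t \<in> borel_measurable borel"
proof -
  have "{r. lambda1 \<sigma> \<delta> r = lambda2 \<sigma> \<delta> r} \<in> sets borel"
    using measurable_sets[OF borel_measurable_diff[OF lambda_measurable(1)[of \<sigma> \<delta>] lambda_measurable(2)[of \<sigma> \<delta>]], of "{0}"]
    by (simp add: vimage_def)
  then have P [measurable]: "Measurable.pred borel (\<lambda>r. lambda1 \<sigma> \<delta> r = lambda2 \<sigma> \<delta> r)"
    by (simp add: pred_def)
  show "kernel0 \<sigma> \<delta> t \<in> borel_measurable borel"
    unfolding kernel0_def[abs_def] Let_def by (rule measurable_If) (measurable)
  show "kernel1 \<sigma> \<delta> t \<in> borel_measurable borel"
    unfolding kernel1_def[abs_def] Let_def by (rule measurable_If) (measurable)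
qed

lemma lambda_sum: "lambda1 \<sigma> \<delta> r + lambda2 \<sigma> \<delta> r = - of_real (r powr (2 * \<delta>))"
  by (simp add: lambda1_def lambda2_def field_simps)

lemma lambda_prod: "lambda1 \<sigma> \<delta> r * lambda2 \<sigma> \<delta> r = of_real (r powr (2 * \<sigma>))"
proof -
  have "(char_disc \<sigma> \<delta> r)\<^sup>2 = of_real (r powr (4 * \<delta>) - 4 * r powr (2 * \<sigma>))"
    by (simp add: char_disc_def)
  moreover have "r powr (4 * \<delta>) = (r powr (2 * \<delta>))\<^sup>2"
    by (simp add: power2_eq_square flip: powr_add)
  ultimately show ?thesis
    by (simp add: lambda1_def lambda2_def field_simps power2_eq_square)
qed

text \<open>
  Eliminates the numerator with two exponentials: every property of the first kernel reduces to one
  of the second, uniformly through the double root.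
\<close>

lemma kernel0_eq:
  "kernel0 \<sigma> \<delta> t r = exp (lambda1 \<sigma> \<delta> r * of_real t) - lambda1 \<sigma> \<delta> r * kernel1 \<sigma> \<delta> t r"
proof (cases "lambda1 \<sigma> \<delta> r = lambda2 \<sigma> \<delta> r")
  case False
  have gen: "(a * eb - (a - d) * ea) / d = ea - a * ((ea - eb) / d)" if "d \<noteq> 0" for a d ea eb :: complex
    using that by (simp add: field_simps)
  have "lambda1 \<sigma> \<delta> r - lambda2 \<sigma> \<delta> r \<noteq> 0" using False by simp
  from gen[OF this, of "lambda1 \<sigma> \<delta> r"] show ?thesis
    unfolding kernel0_def kernel1_def Let_def if_not_P[OF False] by simp
next
  case True
  show ?thesis unfolding kernel0_def kernel1_def Let_def if_P[OF True] by (simp add: left_diff_distrib mult.assoc)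
qed

text \<open>
  Both kernels away from the double root are of this form.
\<close>

lemma exp_combination_deriv:
  fixes a b c :: complex
  shows "((\<lambda>t. (p * exp (a * of_real t) - q * exp (b * of_real t)) / c) has_vector_derivative
     (p * (a * exp (a * of_real t)) - q * (b * exp (b * of_real t))) / c) (at t)"
proof (rule has_vector_derivative_real_field)
  have "((\<lambda>z. p * exp (a * z) - q * exp (b * z)) has_field_derivative
     p * (a * exp (a * of_real t)) - q * (b * exp (b * of_real t))) (at (of_real t))"
    by (auto intro!: derivative_eq_intros)
  then show "((\<lambda>z. (p * exp (a * z) - q * exp (b * z)) / c) has_field_derivative
     (p * (a * exp (a * of_real t)) - q * (b * exp (b * of_real t))) / c) (at (of_real t))"
    by (rule DERIV_cdivide)
qed

lemma kernel0_deriv: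
  "((\<lambda>t. kernel0 \<sigma> \<delta> t r) has_vector_derivative - of_real (r powr (2 * \<sigma>)) * kernel1 \<sigma> \<delta> t r) (at t)"
proof (cases "lambda1 \<sigma> \<delta> r = lambda2 \<sigma> \<delta> r")
  case True
  show ?thesis
    unfolding kernel0_def kernel1_def Let_def lambda_prod[of \<sigma> \<delta> r, symmetric] if_P[OF True] True[symmetric]
    by (rule has_vector_derivative_real_field)
       (auto intro!: derivative_eq_intros simp: algebra_simps)
next
  case False
  have "(a * (b * eb) - b * (a * ea)) / c = - (a * b) * ((ea - eb) / c)" for a b c ea eb :: complex
    unfolding times_divide_eq_right by (rule arg_cong[of _ _ "\<lambda>x. x / c"]) (simp add: algebra_simps)
  note eq = this
  show ?thesis
    unfolding kernel0_def kernel1_def Let_def lambda_prod[of \<sigma> \<delta> r, symmetric] if_not_P[OF False] eq[symmetric]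
    by (rule exp_combination_deriv)
qed

lemma kernel1_deriv:
  "((\<lambda>t. kernel1 \<sigma> \<delta> t r) has_vector_derivative
     kernel0 \<sigma> \<delta> t r - of_real (r powr (2 * \<delta>)) * kernel1 \<sigma> \<delta> t r) (at t)"
proof -
  have s: "complex_of_real (r powr (2 * \<delta>)) = - (lambda1 \<sigma> \<delta> r + lambda2 \<sigma> \<delta> r)"
    by (simp add: lambda_sum)
  show ?thesis
  proof (cases "lambda1 \<sigma> \<delta> r = lambda2 \<sigma> \<delta> r")
    case True
    show ?thesis
      unfolding s kernel0_def kernel1_def Let_def if_P[OF True] True[symmetric]
      by (rule has_vector_derivative_real_field)
         (auto intro!: derivative_eq_intros simp: algebra_simps)
  next
    case False
    have "(1 * (a * ea) - 1 * (b * eb)) / c = (a * eb - b * ea) / c - - (a + b) * ((ea - eb) / c)" for a b c ea eb :: complex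
      unfolding times_divide_eq_right diff_divide_distrib[symmetric]
      by (rule arg_cong[of _ _ "\<lambda>x. x / c"]) (simp add: algebra_simps)
    note eq = this
    have "((\<lambda>t. (1 * exp (lambda1 \<sigma> \<delta> r * of_real t) - 1 * exp (lambda2 \<sigma> \<delta> r * of_real t))
        / (lambda1 \<sigma> \<delta> r - lambda2 \<sigma> \<delta> r)) has_vector_derivative
       (1 * (lambda1 \<sigma> \<delta> r * exp (lambda1 \<sigma> \<delta> r * of_real t)) - 1 * (lambda2 \<sigma> \<delta> r * exp (lambda2 \<sigma> \<delta> r * of_real t)))
         / (lambda1 \<sigma> \<delta> r - lambda2 \<sigma> \<delta> r)) (at t)"
      by (rule exp_combination_deriv)
    then show ?thesis
      unfolding s kernel0_def kernel1_def Let_def if_not_P[OF False] eq by simp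
  qed
qed

text \<open>
  The mean value inequality on a half-plane.
\<close>

lemma norm_exp_diff_le:
  fixes x y :: complex
  assumes "Re x \<le> c" "Re y \<le> c"
  shows "norm (exp x - exp y) \<le> exp c * norm (x - y)"
proof (rule field_differentiable_bound[where S="{z. Re z \<le> c}" and f'=exp])
  show "convex {z. Re z \<le> c}" by (rule convex_halfspace_Re_le)
qed (use assms in \<open>auto intro: DERIV_subset[OF DERIV_exp]\<close>)

text \<open>
  Uniform in the distance between the roots, since it only uses a divided difference of the
  exponential.
\<close>

lemma kernel1_le:
  assumes t: "t \<ge> 0" and re: "Re (lambda2 \<sigma> \<delta> r) \<le> Re (lambda1 \<sigma> \<delta> r)"
  shows "norm (kernel1 \<sigma> \<delta> t r) \<le> t * exp (Re (lambda1 \<sigma> \<delta> r) * t)"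
proof (cases "lambda1 \<sigma> \<delta> r = lambda2 \<sigma> \<delta> r")
  case True
  then show ?thesis using t by (simp add: kernel1_def norm_mult)
next
  case False
  let ?a = "lambda1 \<sigma> \<delta> r" and ?b = "lambda2 \<sigma> \<delta> r"
  have "norm (exp (?a * of_real t) - exp (?b * of_real t)) \<le> exp (Re ?a * t) * norm (?a * of_real t - ?b * of_real t)"
    using re t by (intro norm_exp_diff_le) (auto intro: mult_right_mono)
  also have "?a * of_real t - ?b * of_real t = (?a - ?b) * of_real t" by (simp add: algebra_simps)
  finally show ?thesis using False t
    by (simp add: kernel1_def Let_def norm_divide norm_mult divide_simps mult_ac)
qed

text \<open>
  From \<open>ln y \<le> y - 1\<close> at \<open>y = x / (8 p)\<close>, with equality at the maximum \<open>x = 8 p\<close>.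
\<close>

lemma powr_exp_bounded:
  assumes "p \<ge> 0"
  shows "\<exists>C>0. \<forall>x\<ge>0. x powr p * exp (- x / 8) \<le> (C::real)"
proof (cases "p = 0")
  case True
  then show ?thesis by (intro exI[of _ 1]) auto
next
  case False
  with assms have p: "p > 0" by simp
  show ?thesis
  proof (intro exI[of _ "exp (p * ln (8 * p))"] conjI allI impI)
    fix x :: real
    assume "x \<ge> 0"
    show "x powr p * exp (- x / 8) \<le> exp (p * ln (8 * p))"
    proof (cases "x = 0")
      case False
      with \<open>x \<ge> 0\<close> have x: "x > 0" by simp
      have "ln (x / (8 * p)) \<le> x / (8 * p) - 1"
        using x p by (intro ln_le_minus_one) simp
      then have "p * (ln x - ln (8 * p)) \<le> p * (x / (8 * p) - 1)"
        using x p by (intro mult_left_mono) (auto simp: ln_div)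
      also have "\<dots> \<le> x / 8" using p by (simp add: field_simps)
      finally have "p * ln x - x / 8 \<le> p * ln (8 * p)" by (simp add: algebra_simps)
      then show ?thesis using x by (simp add: powr_def mult_exp_exp)
    qed simp
  qed simp
qed

text \<open>
  The derivative of order \<open>j\<close> (zero or one) in time of the kernel multiplying the datum \<open>w\<^sub>l\<close>,
  with derivatives of kernels already expressed through the kernels themselves.
\<close>

definition time_kernel :: "real \<Rightarrow> real \<Rightarrow> nat \<Rightarrow> nat \<Rightarrow> real \<Rightarrow> real \<Rightarrow> complex" where
  "time_kernel \<sigma> \<delta> j l t r =
    (if j = 0 then (if l = 0 then kernel0 \<sigma> \<delta> t r else kernel1 \<sigma> \<delta> t r)
     else (if l = 0 then - of_real (r powr (2 * \<sigma>)) * kernel1 \<sigma> \<delta> t r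
           else kernel0 \<sigma> \<delta> t r - of_real (r powr (2 * \<delta>)) * kernel1 \<sigma> \<delta> t r))"

lemma time_kernel_measurable [measurable]: "time_kernel \<sigma> \<delta> j l t \<in> borel_measurable borel"
  unfolding time_kernel_def[abs_def] by measurable

lemma time_kernel_deriv:
  "((\<lambda>t. time_kernel \<sigma> \<delta> 0 l t r) has_vector_derivative time_kernel \<sigma> \<delta> 1 l t r) (at t)"
  using kernel0_deriv kernel1_deriv by (auto simp: time_kernel_def)

text \<open>
  The exponent is arbitrary: on high frequencies this pays for any power of time, in particular for
  the extra decay that belongs to \<open>L\<^sup>m\<close> data.
\<close>

lemma exp_decay_powr:
  fixes p :: real
  shows "\<exists>C>0. \<forall>t\<ge>0. exp (- t / 2) \<le> C * (1 + t) powr p"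
proof -
  obtain C where C: "C > 0" "\<And>x. x \<ge> 0 \<Longrightarrow> x powr \<bar>p\<bar> * exp (- x / 8) \<le> C"
    using powr_exp_bounded[OF abs_ge_zero[of p]] by blast
  have "exp (- t / 2) \<le> (exp (1/2) * C) * (1 + t) powr p" if t: "t \<ge> 0" for t
  proof -
    have "exp (- t / 2) = exp (1/2) * exp (- (4 * (1 + t)) / 8)"
      by (simp add: mult_exp_exp) (simp add: field_simps)
    also have "exp (- (4 * (1 + t)) / 8) \<le> C * (1 + t) powr p"
    proof -
      have "(1 + t) powr (- p) \<le> (1 + t) powr \<bar>p\<bar>" using t by (intro powr_mono) auto
      also have "\<dots> \<le> (4 * (1 + t)) powr \<bar>p\<bar>" using t by (intro powr_mono2) auto
      finally have "(1 + t) powr (- p) * exp (- (4 * (1 + t)) / 8) \<le> (4 * (1 + t)) powr \<bar>p\<bar> * exp (- (4 * (1 + t)) / 8)"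
        by (intro mult_right_mono) auto
      also have "\<dots> \<le> C" using t by (intro C(2)) auto
      finally show ?thesis using t by (simp add: powr_minus field_simps)
    qed
    finally show ?thesis by (simp add: mult_ac)
  qed
  then show ?thesis using C(1) by (intro exI[of _ "exp (1/2) * C"]) auto
qed

lemma powr_le_bessel:
  fixes r q s :: real
  assumes "1 \<le> r" "q \<le> s" "0 \<le> s"
  shows "r powr q \<le> (1 + r\<^sup>2) powr (s / 2)"
proof -
  have "r powr q \<le> r powr s" using assms by (intro powr_mono) auto
  also have "\<dots> = (r\<^sup>2) powr (s / 2)" using assms by (simp add: powr_powr flip: powr_numeral)
  also have "\<dots> \<le> (1 + r\<^sup>2) powr (s / 2)" using assms by (intro powr_mono2) auto
  finally show ?thesis .
qed

text \<open>
  The power of \<open>1 + t\<close> that the theorem attributes to the datum \<open>w\<^sub>l\<close> when it is measured in \<open>L\<^sup>2\<close>.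
\<close>

abbreviation decay :: "real \<Rightarrow> real \<Rightarrow> real \<Rightarrow> nat \<Rightarrow> nat \<Rightarrow> real" where
  "decay \<sigma> \<delta> a j l \<equiv> real l - (a + 2 * real j * \<delta>) / (2 * (\<sigma> - \<delta>))"

text \<open>
  The Sobolev regularity that the theorem requires of the datum \<open>w\<^sub>l\<close>.
\<close>

definition data_order :: "real \<Rightarrow> real \<Rightarrow> nat \<Rightarrow> nat \<Rightarrow> real" where
  "data_order \<sigma> a j l = (if l = 0 then a + real j * \<sigma> else max (a + (real j - 1) * \<sigma>) 0)"

context
  fixes \<sigma> \<delta> :: real
  assumes sd: "\<sigma> \<ge> 1" "0 < \<delta>" "\<delta> < \<sigma> / 2"
begin

private abbreviation "\<theta> \<equiv> 2 * (\<sigma> - \<delta>)"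
private abbreviation "\<Lambda>1 \<equiv> lambda1 \<sigma> \<delta>"
private abbreviation "\<Lambda>2 \<equiv> lambda2 \<sigma> \<delta>"
private abbreviation "K0 \<equiv> kernel0 \<sigma> \<delta>"
private abbreviation "K1 \<equiv> kernel1 \<sigma> \<delta>"
private abbreviation "K \<equiv> time_kernel \<sigma> \<delta>"

text \<open>
  For real roots, \<open>- \<lambda>\<^sub>1\<close> is the product \<open>r\<^bsup>2\<sigma>\<^esup>\<close> of the roots divided by \<open>- \<lambda>\<^sub>2\<close>, which is comparable with
  \<open>r\<^bsup>2\<delta>\<^esup>\<close>. Complex roots occur only where \<open>r\<^bsup>\<sigma>\<^esup>\<close> and \<open>r\<^bsup>2\<delta>\<^esup>\<close> are comparable, that is, for \<open>r\<close>
  bounded below, where all these powers are comparable.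
\<close>

lemma lambda_low:
  assumes r: "0 < r" "r \<le> 1"
  shows "Re (\<Lambda>1 r) \<le> - (r powr (\<theta>)) / 2"
    and "norm (\<Lambda>1 r) \<le> 2 * r powr (\<theta>)"
    and "Re (\<Lambda>2 r) \<le> Re (\<Lambda>1 r)"
proof -
  define b e where "b = r powr (2 * \<delta>)" and "e = r powr (\<theta>)"
  have pos: "b > 0" "e > 0" using r by (auto simp: b_def e_def)
  have be: "r powr (2 * \<sigma>) = b * e" by (simp add: b_def e_def algebra_simps flip: powr_add)
  have b2: "r powr (4 * \<delta>) = b\<^sup>2" by (simp add: b_def power2_eq_square flip: powr_add)
  have eb: "e \<le> b" unfolding b_def e_def using r sd by (intro powr_mono') auto
  have "Re (\<Lambda>1 r) \<le> - e / 2 \<and> norm (\<Lambda>1 r) \<le> 2 * e \<and> Re (\<Lambda>2 r) \<le> Re (\<Lambda>1 r)"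
  proof (cases "r powr (4 * \<delta>) - 4 * r powr (2 * \<sigma>) \<ge> 0")
    case True
    define d where "d = sqrt (r powr (4 * \<delta>) - 4 * r powr (2 * \<sigma>))"
    have d0: "d \<ge> 0" using True by (simp add: d_def)
    have d2: "d\<^sup>2 = b\<^sup>2 - 4 * (b * e)" using real_sqrt_pow2[OF True] unfolding d_def b2 be .
    have db: "d \<le> b" by (rule power2_le_imp_le) (use pos d2 in auto)
    have l1: "\<Lambda>1 r = of_real ((d - b) / 2)" and l2: "\<Lambda>2 r = of_real ((- d - b) / 2)"
      unfolding lambda1_def lambda2_def char_disc_nonneg[OF True] by (simp_all add: d_def b_def)
    \<comment> \<open>with \<open>\<lambda>\<^sub>1 = - (b - d) / 2\<close> and \<open>b \<le> b + d \<le> 2 b\<close> this pins down \<open>\<lambda>\<^sub>1\<close> up to a factor two\<close>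
    have prod: "(b - d) * (b + d) = 4 * (b * e)" using d2 by (simp add: power2_eq_square algebra_simps)
    have "2 * e * (b + d) \<le> 2 * e * (2 * b)" using pos db by (intro mult_left_mono) auto
    then have "2 * e * (b + d) \<le> (b - d) * (b + d)" using prod by simp
    then have lo: "2 * e \<le> b - d" using pos d0 by (simp only: mult_le_cancel_right)
    have "4 * e * b \<le> 4 * e * (b + d)" using pos d0 by (intro mult_left_mono) auto
    then have "(b - d) * (b + d) \<le> 4 * e * (b + d)" by (simp only: prod mult_ac)
    then have hi: "b - d \<le> 4 * e" using pos d0 by (simp only: mult_le_cancel_right)
    have "norm (\<Lambda>1 r) = \<bar>(d - b) / 2\<bar>" unfolding l1 by (rule norm_of_real)
    moreover have "Re (\<Lambda>1 r) = (d - b) / 2" "Re (\<Lambda>2 r) = (- d - b) / 2"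
      unfolding l1 l2 by (simp_all only: Re_complex_of_real)
    ultimately show ?thesis using lo hi pos d0 db by simp
  next
    case False
    then have D: "r powr (4 * \<delta>) - 4 * r powr (2 * \<sigma>) < 0" by simp
    define d where "d = sqrt (4 * r powr (2 * \<sigma>) - r powr (4 * \<delta>))"
    have "0 \<le> 4 * r powr (2 * \<sigma>) - r powr (4 * \<delta>)" using D by simp
    then have d2: "d\<^sup>2 = 4 * (b * e) - b\<^sup>2"
      using real_sqrt_pow2 unfolding d_def b2 be by blast
    have l1: "\<Lambda>1 r = Complex (- b / 2) (d / 2)" and l2: "\<Lambda>2 r = Complex (- b / 2) (- d / 2)"
      unfolding lambda1_def lambda2_def char_disc_neg[OF D] by (simp_all add: d_def b_def complex_eq_iff)
    have "b < 4 * e" using D pos unfolding b2 be by (simp add: power2_eq_square)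
    have "(norm (\<Lambda>1 r))\<^sup>2 = b * e"
      unfolding l1 cmod_power2 using d2 by (simp add: power_divide field_simps)
    also have "\<dots> \<le> (2 * e)\<^sup>2" using \<open>b < 4 * e\<close> pos by (simp add: power2_eq_square)
    finally have "norm (\<Lambda>1 r) \<le> 2 * e" by (rule power2_le_imp_le) (use pos in auto)
    then show ?thesis using eb by (simp add: l1 l2)
  qed
  then show "Re (\<Lambda>1 r) \<le> - (r powr (\<theta>)) / 2"
    and "norm (\<Lambda>1 r) \<le> 2 * r powr (\<theta>)"
    and "Re (\<Lambda>2 r) \<le> Re (\<Lambda>1 r)" by (auto simp: e_def)
qed

text \<open>
  Here \<open>2\<delta> < \<sigma>\<close> forces complex roots, and the discriminant is at most \<open>- 3 r\<^bsup>2\<sigma>\<^esup>\<close>, so the roots are well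
  separated.
\<close>

lemma lambda_high:
  assumes r: "1 \<le> r"
  shows "Re (\<Lambda>1 r) \<le> - 1 / 2" "Re (\<Lambda>2 r) \<le> - 1 / 2"
    and "norm (\<Lambda>1 r) = r powr \<sigma>" "norm (\<Lambda>2 r) = r powr \<sigma>"
    and "norm (\<Lambda>1 r - \<Lambda>2 r) \<ge> r powr \<sigma>"
proof -
  define b where "b = r powr (2 * \<delta>)"
  have b1: "b \<ge> 1" unfolding b_def using r sd by (intro ge_one_powr_ge_zero) auto
  have b2: "r powr (4 * \<delta>) = b\<^sup>2" by (simp add: b_def power2_eq_square flip: powr_add)
  have s2: "r powr (2 * \<sigma>) = (r powr \<sigma>)\<^sup>2" by (simp add: power2_eq_square flip: powr_add)
  have s1: "r powr \<sigma> > 0" using r by simp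
  have bs: "b \<le> r powr \<sigma>" unfolding b_def using r sd by (intro powr_mono) auto
  have bs2: "b\<^sup>2 \<le> (r powr \<sigma>)\<^sup>2" using bs b1 by (intro power_mono) auto
  have D: "r powr (4 * \<delta>) - 4 * r powr (2 * \<sigma>) < 0" using bs2 s1 unfolding b2 s2 by (smt (verit) zero_less_power)
  define d where "d = sqrt (4 * r powr (2 * \<sigma>) - r powr (4 * \<delta>))"
  have "0 \<le> 4 * r powr (2 * \<sigma>) - r powr (4 * \<delta>)" using D by simp
  then have d2: "d\<^sup>2 = 4 * (r powr \<sigma>)\<^sup>2 - b\<^sup>2"
    using real_sqrt_pow2 unfolding d_def b2 s2 by blast
  have d0: "d \<ge> 0" using D by (simp add: d_def)
  have l1: "\<Lambda>1 r = Complex (- b / 2) (d / 2)" and l2: "\<Lambda>2 r = Complex (- b / 2) (- d / 2)"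
    unfolding lambda1_def lambda2_def char_disc_neg[OF D] by (simp_all add: d_def b_def complex_eq_iff)
  show "Re (\<Lambda>1 r) \<le> - 1 / 2" "Re (\<Lambda>2 r) \<le> - 1 / 2"
    using b1 by (simp_all add: l1 l2)
  have "(norm (\<Lambda>1 r))\<^sup>2 = (r powr \<sigma>)\<^sup>2" "(norm (\<Lambda>2 r))\<^sup>2 = (r powr \<sigma>)\<^sup>2"
    unfolding l1 l2 cmod_power2 using d2 by (simp_all add: power_divide field_simps)
  then show "norm (\<Lambda>1 r) = r powr \<sigma>" "norm (\<Lambda>2 r) = r powr \<sigma>"
    using s1 by (auto simp: power2_eq_iff_nonneg)
  have "norm (\<Lambda>1 r - \<Lambda>2 r) = d"
    unfolding l1 l2 using d0 by (simp add: cmod_def)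
  moreover have "r powr \<sigma> \<le> d"
  proof (rule power2_le_imp_le[OF _ d0])
    show "(r powr \<sigma>)\<^sup>2 \<le> d\<^sup>2" unfolding d2 using bs2 zero_le_power2[of "r powr \<sigma>"] by linarith
  qed
  ultimately show "norm (\<Lambda>1 r - \<Lambda>2 r) \<ge> r powr \<sigma>" by simp
qed

lemma kernel_low:
  assumes r: "0 < r" "r \<le> 1" and t: "t \<ge> 0"
  shows "norm (K1 t r) \<le> t * exp (- (r powr (\<theta>) * t) / 2)"
    and "norm (K0 t r) \<le> 8 * exp (- (r powr (\<theta>) * t) / 4)"
proof -
  let ?e = "r powr (\<theta>)"
  note low = lambda_low[OF r]
  have ex: "exp (Re (\<Lambda>1 r) * t) \<le> exp (- (?e * t) / 2)"
    using mult_right_mono[OF low(1) t] by simp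
  have "norm (K1 t r) \<le> t * exp (Re (\<Lambda>1 r) * t)"
    by (rule kernel1_le[OF t low(3)])
  also have "\<dots> \<le> t * exp (- (?e * t) / 2)" by (rule mult_left_mono[OF ex t])
  finally show k1: "norm (K1 t r) \<le> t * exp (- (?e * t) / 2)" .
  have "norm (K0 t r) \<le> exp (Re (\<Lambda>1 r) * t) + norm (\<Lambda>1 r) * norm (K1 t r)"
    unfolding kernel0_eq using norm_triangle_ineq4[of "exp (\<Lambda>1 r * of_real t)" "\<Lambda>1 r * K1 t r"]
    by (simp add: norm_mult)
  also have "\<dots> \<le> exp (- (?e * t) / 2) + (2 * ?e) * (t * exp (- (?e * t) / 2))"
    by (intro add_mono mult_mono ex low k1) auto
  also have "\<dots> = (1 + 2 * (?e * t)) * exp (- (?e * t) / 2)" by (simp add: algebra_simps)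
  also have "\<dots> \<le> (8 * exp (?e * t / 4)) * exp (- (?e * t) / 2)"
  proof (intro mult_right_mono)
    have "1 + 2 * (?e * t) \<le> 8 * (1 + ?e * t / 4)" by simp
    also have "\<dots> \<le> 8 * exp (?e * t / 4)" by (intro mult_left_mono exp_ge_add_one_self) auto
    finally show "1 + 2 * (?e * t) \<le> 8 * exp (?e * t / 4)" .
  qed auto
  also have "\<dots> = 8 * exp (- (?e * t) / 4)" by (simp add: mult_exp_exp)
  finally show "norm (K0 t r) \<le> 8 * exp (- (?e * t) / 4)" .
qed

lemma kernel_high:
  assumes r: "1 \<le> r" and t: "t \<ge> 0"
  shows "norm (K1 t r) \<le> 2 * exp (- t / 2) * r powr (- \<sigma>)"
    and "norm (K0 t r) \<le> 2 * exp (- t / 2)"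
proof -
  let ?a = "\<Lambda>1 r" and ?b = "\<Lambda>2 r"
  note high = lambda_high[OF r]
  have s1: "r powr \<sigma> > 0" using r by simp
  have ne: "?a \<noteq> ?b" using high(5) s1 by auto
  have ea: "norm (exp (?a * of_real t)) \<le> exp (- t / 2)" and eb: "norm (exp (?b * of_real t)) \<le> exp (- t / 2)"
    using mult_right_mono[OF high(1) t] mult_right_mono[OF high(2) t] by simp_all
  have "norm (exp (?a * of_real t) - exp (?b * of_real t)) \<le> 2 * exp (- t / 2)"
    using norm_triangle_ineq4[of "exp (?a * of_real t)" "exp (?b * of_real t)"] ea eb by linarith
  then have "norm (K1 t r) \<le> 2 * exp (- t / 2) / r powr \<sigma>"
    unfolding kernel1_def Let_def if_not_P[OF ne] norm_divide using s1 high(5)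
    by (intro frac_le) auto
  then show "norm (K1 t r) \<le> 2 * exp (- t / 2) * r powr (- \<sigma>)"
    by (simp add: powr_minus field_simps)
  have "norm (?a * exp (?b * of_real t) - ?b * exp (?a * of_real t))
      \<le> r powr \<sigma> * exp (- t / 2) + r powr \<sigma> * exp (- t / 2)"
    using norm_triangle_ineq4[of "?a * exp (?b * of_real t)" "?b * exp (?a * of_real t)"]
      mult_left_mono[OF ea, of "r powr \<sigma>"] mult_left_mono[OF eb, of "r powr \<sigma>"] s1
    unfolding norm_mult high(3,4) by linarith
  then have "norm (K0 t r) \<le> (r powr \<sigma> * exp (- t / 2) + r powr \<sigma> * exp (- t / 2)) / r powr \<sigma>"
    unfolding kernel0_def Let_def if_not_P[OF ne] norm_divide using s1 high(5)
    by (intro frac_le) auto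
  then show "norm (K0 t r) \<le> 2 * exp (- t / 2)" using s1 by simp
qed

lemma heat_order_pos: "\<theta> > 0" and heat_order_ge: "2 * \<delta> \<le> \<theta>"
  using sd by auto

text \<open>
  Scaling in the heat variable \<open>r\<^bsup>\<theta>\<^esup> (1 + t)\<close>. Replacing \<open>t\<close> by \<open>1 + t\<close> costs a constant because
  \<open>r \<le> 1\<close>; half of the exponential is spent on the power and half is kept.
\<close>

lemma powr_kernel_low:
  assumes b: "b \<ge> 0"
  shows "\<exists>C>0. \<forall>t r. 0 \<le> t \<longrightarrow> 0 < r \<longrightarrow> r \<le> 1 \<longrightarrow> r powr b * exp (- (r powr \<theta> * t) / 4)
    \<le> C * (1 + t) powr (- b / \<theta>) * exp (- (r powr \<theta> * (1 + t)) / 8)"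
proof -
  obtain C where C: "C > 0" "\<And>x. x \<ge> 0 \<Longrightarrow> x powr (b / \<theta>) * exp (- x / 8) \<le> C"
    using powr_exp_bounded[OF divide_nonneg_pos[OF b heat_order_pos]] by blast
  have "r powr b * exp (- (r powr \<theta> * t) / 4)
    \<le> (exp (1/4) * C) * (1 + t) powr (- b / \<theta>) * exp (- (r powr \<theta> * (1 + t)) / 8)"
    if t: "0 \<le> t" and r: "0 < r" "r \<le> 1" for t r
  proof -
    define x where "x = r powr \<theta> * (1 + t)"
    have x: "x > 0" using r t by (simp add: x_def)
    have e1: "r powr \<theta> \<le> 1" using r heat_order_pos by (simp add: powr_le_one_le powr_le1)
    have "x powr (b / \<theta>) = r powr b * (1 + t) powr (b / \<theta>)"
      using r t heat_order_pos by (simp add: x_def powr_mult powr_powr)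
    then have rb: "r powr b = x powr (b / \<theta>) * (1 + t) powr (- b / \<theta>)"
      using t by (simp add: powr_minus field_simps)
    have "exp (- (r powr \<theta> * t) / 4) = exp (r powr \<theta> / 4) * exp (- x / 4)"
      by (simp add: x_def mult_exp_exp) (simp add: field_simps)
    also have "\<dots> \<le> exp (1 / 4) * exp (- x / 4)"
      using e1 by (intro mult_right_mono) auto
    also have "\<dots> = exp (1 / 4) * (exp (- x / 8) * exp (- x / 8))"
      by (simp add: mult_exp_exp)
    finally have "r powr b * exp (- (r powr \<theta> * t) / 4) \<le> r powr b * (exp (1 / 4) * (exp (- x / 8) * exp (- x / 8)))"
      by (intro mult_left_mono) auto
    also have "\<dots> = (x powr (b / \<theta>) * exp (- x / 8)) * (exp (1 / 4) * (1 + t) powr (- b / \<theta>) * exp (- x / 8))"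
      unfolding rb by (simp only: mult_ac)
    also have "\<dots> \<le> C * (exp (1 / 4) * (1 + t) powr (- b / \<theta>) * exp (- x / 8))"
      using C(2)[of x] x by (intro mult_right_mono) auto
    finally show ?thesis by (simp only: x_def mult_ac)
  qed
  then show ?thesis using C(1) by (intro exI[of _ "exp (1/4) * C"]) auto
qed

text \<open>
  The factor \<open>r\<^bsup>2\<sigma>\<^esup> = r\<^bsup>2\<delta>\<^esup> r\<^bsup>\<theta>\<^esup>\<close> in \<open>K\<^sub>0'\<close> absorbs the growth \<open>t\<close> of \<open>K\<^sub>1\<close> and leaves \<open>r\<^bsup>2\<delta>\<^esup>\<close>. In
  \<open>K\<^sub>1'\<close> the term \<open>K\<^sub>0\<close> has no such factor, but it decays fast enough since \<open>2\<delta> \<le> \<theta>\<close>.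
\<close>

lemma time_kernel_low:
  fixes j l :: nat
  assumes a: "a \<ge> 0" and j: "j \<le> 1" and l: "l \<le> 1"
  shows "\<exists>C>0. \<forall>t r. 0 \<le> t \<longrightarrow> 0 < r \<longrightarrow> r \<le> 1 \<longrightarrow> r powr a * norm (K j l t r)
     \<le> C * (1 + t) powr (decay \<sigma> \<delta> a j l) * exp (- (r powr \<theta> * (1 + t)) / 8)"
proof -
  obtain A where A: "A > 0" "\<And>t r. 0 \<le> t \<Longrightarrow> 0 < r \<Longrightarrow> r \<le> 1 \<Longrightarrow> r powr a * exp (- (r powr \<theta> * t) / 4)
    \<le> A * (1 + t) powr (- a / \<theta>) * exp (- (r powr \<theta> * (1 + t)) / 8)"
    using powr_kernel_low[OF a] by blast
  have ab: "0 \<le> a + 2 * \<delta>" using a sd by simp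
  obtain B where B: "B > 0" "\<And>t r. 0 \<le> t \<Longrightarrow> 0 < r \<Longrightarrow> r \<le> 1 \<Longrightarrow> r powr (a + 2 * \<delta>) * exp (- (r powr \<theta> * t) / 4)
    \<le> B * (1 + t) powr (- (a + 2 * \<delta>) / \<theta>) * exp (- (r powr \<theta> * (1 + t)) / 8)"
    using powr_kernel_low[OF ab] by blast
  have "r powr a * norm (K j l t r)
     \<le> (8 * A + 4 * B) * (1 + t) powr (decay \<sigma> \<delta> a j l) * exp (- (r powr \<theta> * (1 + t)) / 8)"
    if t: "0 \<le> t" and r: "0 < r" "r \<le> 1" for t r
  proof -
    define e where "e = r powr \<theta>"
    define E where "E = exp (- (e * t) / 4)"
    define X where "X = exp (- (e * (1 + t)) / 8)"
    define P where "P = (1 + t) powr (- a / \<theta>)"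
    define Q where "Q = (1 + t) powr (- (a + 2 * \<delta>) / \<theta>)"
    have nn: "e \<ge> 0" "E \<ge> 0" "X \<ge> 0" "P \<ge> 0" "Q \<ge> 0" by (auto simp: e_def E_def X_def P_def Q_def)
    have rA: "r powr a * E \<le> A * P * X" using A(2)[OF t r] by (simp add: E_def X_def P_def e_def)
    have rB: "r powr (a + 2 * \<delta>) * E \<le> B * Q * X" using B(2)[OF t r] by (simp add: E_def X_def Q_def e_def)
    have E2: "exp (- (e * t) / 2) \<le> E" unfolding E_def using nn t by simp
    have k0: "norm (K0 t r) \<le> 8 * E"
      using kernel_low(2)[OF r t] by (simp add: E_def e_def)
    have k1': "norm (K1 t r) \<le> t * exp (- (e * t) / 2)"
      using kernel_low(1)[OF r t] by (simp add: e_def)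
    also have "\<dots> \<le> t * E" using E2 t by (intro mult_left_mono)
    finally have k1: "norm (K1 t r) \<le> t * E" .
    have k1e: "e * norm (K1 t r) \<le> 4 * E"
    proof -
      have "e * norm (K1 t r) \<le> e * (t * exp (- (e * t) / 2))"
        using k1' nn by (intro mult_left_mono)
      also have "\<dots> = (e * t) * exp (- (e * t) / 2)" by simp
      also have "\<dots> \<le> (4 * exp (e * t / 4)) * exp (- (e * t) / 2)"
      proof (intro mult_right_mono)
        show "e * t \<le> 4 * exp (e * t / 4)" using exp_ge_add_one_self[of "e * t / 4"] by linarith
      qed auto
      also have "\<dots> = 4 * E" by (simp add: E_def mult_exp_exp)
      finally show ?thesis .
    qed
    have r2: "r powr (2 * \<sigma>) = r powr (2 * \<delta>) * e" by (simp add: e_def algebra_simps flip: powr_add)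
    have T: "(1 + t) * P = (1 + t) powr (1 - a / \<theta>)" "(1 + t) * Q = (1 + t) powr (1 - (a + 2 * \<delta>) / \<theta>)"
    proof -
      have "(1 + t) * (1 + t) powr (- q / \<theta>) = (1 + t) powr (1 - q / \<theta>)" for q
        using t powr_add[of "1 + t" 1 "- q / \<theta>"] by simp
      then show "(1 + t) * P = (1 + t) powr (1 - a / \<theta>)" "(1 + t) * Q = (1 + t) powr (1 - (a + 2 * \<delta>) / \<theta>)"
        unfolding P_def Q_def by blast+
    qed
    \<comment> \<open>this is where \<open>2 \<delta> \<le> \<theta>\<close> enters\<close>
    have PQ: "P \<le> (1 + t) * Q"
    proof -
      have "2 * \<delta> / \<theta> \<le> 1" using heat_order_ge heat_order_pos by (subst pos_divide_le_eq) auto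
      then have "- a / \<theta> \<le> 1 - (a + 2 * \<delta>) / \<theta>" by (simp add: add_divide_distrib)
      then show ?thesis unfolding T(2) unfolding P_def using t by (intro powr_mono) auto
    qed
    have AB: "A * Y \<le> (8 * A + 4 * B) * Y" "8 * (A * Y) \<le> (8 * A + 4 * B) * Y" "4 * (B * Y) \<le> (8 * A + 4 * B) * Y" if "Y \<ge> 0" for Y
      using A(1) B(1) that by (auto simp: algebra_simps)
    consider "j = 0" "l = 0" | "j = 0" "l = 1" | "j = 1" "l = 0" | "j = 1" "l = 1" using j l by linarith
    then have "r powr a * norm (K j l t r)
      \<le> (8 * A + 4 * B) * ((1 + t) powr (decay \<sigma> \<delta> a j l) * X)"
    proof cases
      case 1
      have "r powr a * norm (K0 t r) \<le> 8 * (r powr a * E)"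
        using mult_left_mono[OF k0, of "r powr a"] by simp
      also have "\<dots> \<le> 8 * (A * (P * X))" using rA by simp
      also have "\<dots> \<le> (8 * A + 4 * B) * (P * X)" using nn by (intro AB) auto
      finally show ?thesis using 1 by (simp add: time_kernel_def P_def)
    next
      case 2
      have "r powr a * norm (K1 t r) \<le> t * (r powr a * E)"
        using mult_left_mono[OF k1, of "r powr a"] by (simp add: mult_ac)
      also have "\<dots> \<le> (1 + t) * (A * P * X)" by (rule mult_mono) (use rA t nn in auto)
      also have "\<dots> = A * ((1 + t) * P * X)" by (simp add: mult_ac)
      also have "\<dots> \<le> (8 * A + 4 * B) * ((1 + t) * P * X)" using nn t by (intro AB) auto
      finally show ?thesis using 2 unfolding T by (simp add: time_kernel_def)
    next
      case 3
      have "norm (K j l t r) = r powr (2 * \<delta>) * (e * norm (K1 t r))"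
        using 3 nn by (simp add: time_kernel_def norm_mult r2)
      also have "\<dots> \<le> r powr (2 * \<delta>) * (4 * E)" using k1e by (intro mult_left_mono) auto
      finally have "r powr a * norm (K j l t r) \<le> r powr a * (r powr (2 * \<delta>) * (4 * E))"
        by (intro mult_left_mono) auto
      also have "\<dots> = 4 * (r powr (a + 2 * \<delta>) * E)" by (simp add: powr_add)
      also have "\<dots> \<le> 4 * (B * (Q * X))" using rB by simp
      also have "\<dots> \<le> (8 * A + 4 * B) * (Q * X)" using nn by (intro AB) auto
      finally have fin: "r powr a * norm (K j l t r) \<le> (8 * A + 4 * B) * (Q * X)" .
      have "decay \<sigma> \<delta> a j l = - ((a + 2 * \<delta>) / \<theta>)" using 3 by simp
      also have "\<dots> = - (a + 2 * \<delta>) / \<theta>" by (rule minus_divide_left)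
      finally show ?thesis using fin unfolding Q_def by (simp only:)
    next
      case 4
      have "norm (K j l t r) \<le> norm (K0 t r) + r powr (2 * \<delta>) * norm (K1 t r)"
        using 4 norm_triangle_ineq4[of "K0 t r" "of_real (r powr (2 * \<delta>)) * K1 t r"]
        by (simp add: time_kernel_def norm_mult)
      also have "\<dots> \<le> 8 * E + r powr (2 * \<delta>) * (t * E)"
        using k0 k1 by (intro add_mono mult_left_mono) auto
      finally have "r powr a * norm (K j l t r) \<le> r powr a * (8 * E + r powr (2 * \<delta>) * (t * E))"
        by (intro mult_left_mono) auto
      also have "\<dots> = 8 * (r powr a * E) + t * (r powr (a + 2 * \<delta>) * E)" by (simp add: powr_add algebra_simps)
      also have "\<dots> \<le> 8 * (A * P * X) + (1 + t) * (B * Q * X)"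
      proof (rule add_mono)
        show "8 * (r powr a * E) \<le> 8 * (A * P * X)" using rA by simp
        show "t * (r powr (a + 2 * \<delta>) * E) \<le> (1 + t) * (B * Q * X)"
          by (rule mult_mono) (use rB t nn in auto)
      qed
      also have "\<dots> \<le> 8 * (A * ((1 + t) * Q) * X) + (1 + t) * (B * Q * X)"
        using mult_right_mono[OF mult_left_mono[OF PQ, of A], of X] A(1) nn by simp
      also have "\<dots> = (8 * A + B) * ((1 + t) * Q * X)" by (simp add: algebra_simps)
      also have "\<dots> \<le> (8 * A + 4 * B) * ((1 + t) * Q * X)"
        using B nn t by (intro mult_right_mono) auto
      finally show ?thesis using 4 unfolding T by simp
    qed
    then show ?thesis by (simp only: X_def e_def mult.assoc)
  qed
  then show ?thesis using A(1) B(1) by (intro exI[of _ "8 * A + 4 * B"]) auto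
qed

text \<open>
  Each kernel contributes a fixed power of \<open>r\<close>, and \<open>data_order\<close> is the least nonnegative order
  that dominates it.
\<close>

lemma time_kernel_high:
  fixes j l :: nat
  assumes a: "a \<ge> 0" and j: "j \<le> 1" and l: "l \<le> 1" and r: "1 \<le> r" and t: "0 \<le> t"
  shows "r powr a * norm (K j l t r) \<le> 4 * exp (- t / 2) * (1 + r\<^sup>2) powr (data_order \<sigma> a j l / 2)"
proof -
  define E where "E = exp (- t / 2)"
  have E: "E \<ge> 0" by (simp add: E_def)
  have k1: "norm (K1 t r) \<le> 2 * E * r powr (- \<sigma>)" and k0: "norm (K0 t r) \<le> 2 * E"
    using kernel_high[OF r t] by (auto simp: E_def)
  have fin: "r powr a * X \<le> 4 * E * (1 + r\<^sup>2) powr (data_order \<sigma> a j l / 2)"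
    if X: "X \<le> 4 * E * r powr q" and q: "a + q \<le> data_order \<sigma> a j l" for X q
  proof -
    have s0: "0 \<le> data_order \<sigma> a j l" using a sd by (simp add: data_order_def)
    have "r powr a * X \<le> r powr a * (4 * E * r powr q)" using X by (intro mult_left_mono) auto
    also have "\<dots> = 4 * E * r powr (a + q)" by (simp add: powr_add)
    also have "\<dots> \<le> 4 * E * (1 + r\<^sup>2) powr (data_order \<sigma> a j l / 2)"
      using E by (intro mult_left_mono powr_le_bessel r q s0) auto
    finally show ?thesis .
  qed
  have up: "2 * E * r powr q \<le> 4 * E * r powr q" for q using E by (intro mult_right_mono) auto
  consider "j = 0" "l = 0" | "j = 0" "l = 1" | "j = 1" "l = 0" | "j = 1" "l = 1" using j l by linarith
  then have "r powr a * norm (K j l t r) \<le> 4 * E * (1 + r\<^sup>2) powr (data_order \<sigma> a j l / 2)"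
  proof cases
    case 1
    show ?thesis by (rule fin[of _ 0]) (use 1 k0 E r in \<open>auto simp: time_kernel_def data_order_def\<close>)
  next
    case 2
    show ?thesis by (rule fin[of _ "- \<sigma>"]) (use 2 order_trans[OF k1 up] in \<open>auto simp: time_kernel_def data_order_def\<close>)
  next
    case 3
    have "norm (K j l t r) = r powr (2 * \<sigma>) * norm (K1 t r)"
      using 3 by (simp add: time_kernel_def norm_mult)
    also have "\<dots> \<le> r powr (2 * \<sigma>) * (2 * E * r powr (- \<sigma>))" using k1 by (intro mult_left_mono) auto
    also have "\<dots> = 2 * E * r powr \<sigma>"
      by (simp add: mult.left_commute[of "r powr (2 * \<sigma>)"] flip: powr_add)
    finally show ?thesis by (intro fin[of _ \<sigma>]) (use 3 up[of \<sigma>] in \<open>auto simp: data_order_def\<close>)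
  next
    case 4
    have "norm (K j l t r) \<le> norm (K0 t r) + r powr (2 * \<delta>) * norm (K1 t r)"
      using 4 norm_triangle_ineq4[of "K0 t r" "of_real (r powr (2 * \<delta>)) * K1 t r"]
      by (simp add: time_kernel_def norm_mult)
    also have "\<dots> \<le> 2 * E + r powr (2 * \<delta>) * (2 * E * r powr (- \<sigma>))"
      using k0 k1 by (intro add_mono mult_left_mono) auto
    also have "\<dots> = 2 * E + 2 * E * r powr (2 * \<delta> - \<sigma>)"
      by (simp add: powr_diff powr_minus field_simps)
    also have "\<dots> \<le> 2 * E + 2 * E * r powr 0"
      using E r sd by (intro add_left_mono mult_left_mono powr_mono) auto
    also have "\<dots> = 4 * E * r powr 0" using r by simp
    finally show ?thesis by (intro fin[of _ 0]) (use 4 a in \<open>auto simp: data_order_def\<close>)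
  qed
  then show ?thesis by (simp add: E_def)
qed

text \<open>
  The exponent \<open>N\<close> is free: zero for data in \<open>L\<^sup>2\<close>, and the additional decay rate of the low
  frequencies for data in \<open>L\<^sup>m\<close>.
\<close>

lemma time_kernel_bound:
  fixes j l :: nat and N :: real
  assumes a: "a \<ge> 0" and j: "j \<le> 1" and l: "l \<le> 1"
  shows "\<exists>C>0. \<forall>t r. 0 \<le> t \<longrightarrow> 0 < r \<longrightarrow> r powr a * norm (K j l t r)
     \<le> C * (1 + t) powr (decay \<sigma> \<delta> a j l) *
        (if r \<le> 1 then exp (- (r powr \<theta> * (1 + t)) / 8)
         else (1 + t) powr (- N) * (1 + r\<^sup>2) powr (data_order \<sigma> a j l / 2))"
proof -
  obtain A where A: "A > 0" "\<And>t r. 0 \<le> t \<Longrightarrow> 0 < r \<Longrightarrow> r \<le> 1 \<Longrightarrow> r powr a * norm (K j l t r)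
     \<le> A * (1 + t) powr (decay \<sigma> \<delta> a j l) * exp (- (r powr \<theta> * (1 + t)) / 8)"
    using time_kernel_low[OF a j l] by blast
  obtain B where B: "B > 0" "\<And>t. 0 \<le> t \<Longrightarrow> exp (- t / 2) \<le> B * (1 + t) powr (decay \<sigma> \<delta> a j l - N)"
    using exp_decay_powr by blast
  have "r powr a * norm (K j l t r)
     \<le> (A + 4 * B) * (1 + t) powr (decay \<sigma> \<delta> a j l) *
        (if r \<le> 1 then exp (- (r powr \<theta> * (1 + t)) / 8)
         else (1 + t) powr (- N) * (1 + r\<^sup>2) powr (data_order \<sigma> a j l / 2))" if t: "0 \<le> t" and r: "0 < r" for t r
  proof (cases "r \<le> 1")
    case True
    have "A * (1 + t) powr (decay \<sigma> \<delta> a j l) * exp (- (r powr \<theta> * (1 + t)) / 8)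
      \<le> (A + 4 * B) * (1 + t) powr (decay \<sigma> \<delta> a j l) * exp (- (r powr \<theta> * (1 + t)) / 8)"
      using B(1) by (intro mult_right_mono) auto
    with A(2)[OF t r True] True show ?thesis by simp
  next
    case False
    define W where "W = (1 + r\<^sup>2) powr (data_order \<sigma> a j l / 2)"
    have "r powr a * norm (K j l t r) \<le> 4 * exp (- t / 2) * W"
      unfolding W_def using False by (intro time_kernel_high a j l t) auto
    also have "\<dots> \<le> 4 * (B * (1 + t) powr (decay \<sigma> \<delta> a j l - N)) * W"
      by (intro mult_right_mono mult_left_mono B t) (auto simp: W_def)
    also have "\<dots> = (4 * B) * ((1 + t) powr (decay \<sigma> \<delta> a j l) * ((1 + t) powr (- N) * W))"
    proof -
      have "(1 + t) powr (u - N) = (1 + t) powr u * (1 + t) powr (- N)" for u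
        by (simp flip: powr_add)
      then show ?thesis by (simp only: mult_ac)
    qed
    also have "\<dots> \<le> (A + 4 * B) * ((1 + t) powr (decay \<sigma> \<delta> a j l) * ((1 + t) powr (- N) * W))"
      using A(1) by (intro mult_right_mono) (auto simp: W_def)
    finally show ?thesis using False by (simp add: W_def mult.assoc)
  qed
  then show ?thesis using A(1) B(1) by (intro exI[of _ "A + 4 * B"]) auto
qed

end

section \<open>Low frequencies of Lm data\<close>

text \<open>
  A single Gaussian does not dominate \<open>exp (- \<rho>\<^bsup>\<theta>\<^esup> / 4)\<close> when \<open>\<theta> < 2\<close>, but a suitable member of a
  dyadic family does, with weights that decay as fast as desired. The index is the least \<open>k\<close> with
  \<open>\<rho> \<le> 2\<^sup>k\<close>.
\<close>

lemma exp_powr_dyadic: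
  fixes \<theta> p :: real
  assumes \<theta>: "\<theta> > 0" and p: "p \<ge> 0"
  shows "\<exists>C>0. \<forall>\<rho>\<ge>0. \<exists>k::nat. exp (- (\<rho> powr \<theta>) / 4)
    \<le> C * ((1/2) ^ k) powr p * exp (- ((1/2) ^ k * \<rho>)\<^sup>2 / 2)"
proof -
  obtain C where C: "C > 0" "\<And>x. x \<ge> 0 \<Longrightarrow> x powr (p / \<theta>) * exp (- x / 8) \<le> C"
    using powr_exp_bounded[OF divide_nonneg_pos[OF p \<theta>]] by blast
  define D where "D = exp (1/2) * (1 + 2 powr p * C)"
  have D: "D > 0" using C(1) by (simp add: D_def add_pos_pos)
  have "\<exists>k::nat. exp (- (\<rho> powr \<theta>) / 4) \<le> D * ((1/2) ^ k) powr p * exp (- ((1/2) ^ k * \<rho>)\<^sup>2 / 2)"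
    if \<rho>: "\<rho> \<ge> 0" for \<rho> :: real
  proof -
    define k where "k = (LEAST k. \<rho> \<le> 2 ^ k)"
    have "\<exists>k. \<rho> \<le> 2 ^ k"
      using real_arch_pow[of 2 \<rho>] by (auto intro: less_imp_le)
    then have k: "\<rho> \<le> 2 ^ k" unfolding k_def by (rule LeastI_ex)
    have "(1/2) ^ k * \<rho> \<le> 1" using k by (simp add: power_divide field_simps)
    then have "((1/2) ^ k * \<rho>)\<^sup>2 \<le> 1" using \<rho> by (simp add: power_le_one)
    then have g: "exp (- 1 / 2) \<le> exp (- ((1/2) ^ k * \<rho>)\<^sup>2 / 2)" by simp
    have main: "exp (- (\<rho> powr \<theta>) / 4) \<le> (1 + 2 powr p * C) * ((1/2) ^ k) powr p"
    proof (cases k)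
      case 0
      have "exp (- (\<rho> powr \<theta>) / 4) \<le> 1" by simp
      also have "\<dots> \<le> 1 + 2 powr p * C" using C(1) by simp
      finally show ?thesis using 0 by simp
    next
      case (Suc i)
      have "\<not> \<rho> \<le> 2 ^ i" using not_less_Least[of i "\<lambda>k. \<rho> \<le> 2 ^ k"] Suc by (simp add: k_def)
      then have lt: "2 ^ k < 2 * \<rho>" using Suc by simp
      moreover have "(0::real) < 2 ^ k" by simp
      ultimately have \<rho>0: "\<rho> > 0" by linarith
      have "exp (- (\<rho> powr \<theta>) / 4) * (2 ^ k) powr p \<le> exp (- (\<rho> powr \<theta>) / 4) * (2 * \<rho>) powr p"
        using lt p by (intro mult_left_mono powr_mono2) auto
      also have "\<dots> = 2 powr p * (exp (- (\<rho> powr \<theta>) / 4) * \<rho> powr p)"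
        using \<rho>0 by (simp add: powr_mult)
      also have "\<rho> powr p \<le> (2 * \<rho> powr \<theta>) powr (p / \<theta>)"
      proof -
        have "\<rho> powr p = (\<rho> powr \<theta>) powr (p / \<theta>)" using \<theta> by (simp add: powr_powr)
        also have "\<dots> \<le> (2 * \<rho> powr \<theta>) powr (p / \<theta>)" using \<theta> p by (intro powr_mono2) auto
        finally show ?thesis .
      qed
      also have "exp (- (\<rho> powr \<theta>) / 4) * (2 * \<rho> powr \<theta>) powr (p / \<theta>) \<le> C"
        using C(2)[of "2 * \<rho> powr \<theta>"] by (simp add: mult.commute)
      finally have "exp (- (\<rho> powr \<theta>) / 4) * (2 ^ k) powr p \<le> 2 powr p * C"
        by simp
      also have "\<dots> \<le> 1 + 2 powr p * C" by simp
      finally have "exp (- (\<rho> powr \<theta>) / 4) * (2 ^ k) powr p * ((1/2) ^ k) powr p \<le> (1 + 2 powr p * C) * ((1/2) ^ k) powr p"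
        by (intro mult_right_mono) auto
      moreover have "(2 ^ k) powr p * ((1/2) ^ k) powr p = (1::real)"
        by (simp add: power_divide powr_divide)
      ultimately show ?thesis by (simp add: mult.assoc)
    qed
    also have "\<dots> = D * ((1/2) ^ k) powr p * exp (- 1 / 2)"
      by (simp add: D_def mult_exp_exp[of "1/2" "-1/2"] mult_ac) (simp add: exp_minus field_simps)
    also have "\<dots> \<le> D * ((1/2) ^ k) powr p * exp (- ((1/2) ^ k * \<rho>)\<^sup>2 / 2)"
      using D g by (intro mult_left_mono) auto
    finally show ?thesis by blast
  qed
  with D show ?thesis by blast
qed

text \<open>
  Sum the Gaussian bounds over the dyadic family: the \<open>k\<close>-th Gaussian costs the factor \<open>2\<^bsup>kq\<^esup>\<close>, and
  the weights \<open>2\<^bsup>-k(q+1)\<^esup>\<close> make the series geometric.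
\<close>

lemma fourier_low_frequency_Lm:
  fixes \<theta> m :: real
  assumes m: "1 \<le> m" "m \<le> 2" and \<theta>: "\<theta> > 0"
  shows "\<exists>C>0. \<forall>(w::'a::euclidean_space \<Rightarrow> complex) t. w \<in> Lp 2 \<longrightarrow> w \<in> Lp m \<longrightarrow> 0 \<le> t \<longrightarrow>
    (\<integral>\<^sup>+\<xi>. ennreal (exp (- (norm \<xi> powr \<theta> * (1 + t)) / 4)) * ennreal ((norm (fourier w \<xi>))\<^sup>2) \<partial>lborel)
    \<le> ennreal (C * (1 + t) powr (- (real DIM('a) * (2 / m - 1)) / \<theta>) * (Lp_norm m w)\<^sup>2)"
proof -
  define q where "q = real DIM('a) * (2 / m - 1)"
  have q: "q \<ge> 0" using m by (simp add: q_def field_simps)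
  obtain D where D: "D > 0" "\<And>\<rho>. \<rho> \<ge> 0 \<Longrightarrow> \<exists>k::nat. exp (- (\<rho> powr \<theta>) / 4)
    \<le> D * ((1/2) ^ k) powr (q + 1) * exp (- ((1/2) ^ k * \<rho>)\<^sup>2 / 2)"
    using exp_powr_dyadic[of \<theta> "q + 1"] \<theta> q by (metis add_nonneg_nonneg zero_le_one)
  define L where "L = ((2 * pi) powr (real DIM('a) / 2)) powr (1 - 2 / m)"
  have L: "L > 0" by (simp add: L_def)
  show ?thesis
  proof (intro exI[of _ "4 * D * L"] conjI allI impI)
    show "4 * D * L > 0" using D(1) L by simp
    fix w :: "'a \<Rightarrow> complex" and t :: real
    assume w2: "w \<in> Lp 2" and wm: "w \<in> Lp m" and t: "0 \<le> t"
    note [measurable] = fourier_Lp2[OF w2, THEN Lp2_measurable]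
    \<comment> \<open>in the variable \<open>\<rho> = \<tau> |\<xi>|\<close> the profile no longer depends on time\<close>
    define \<tau> where "\<tau> = (1 + t) powr (1 / \<theta>)"
    have \<tau>: "\<tau> > 0" using t by (simp add: \<tau>_def)
    define A where "A = (Lp_norm m w)\<^sup>2"
    have A: "A \<ge> 0" by (simp add: A_def)
    have \<tau>q: "\<tau> powr (- q) = (1 + t) powr (- q / \<theta>)"
      using t by (simp add: \<tau>_def powr_powr)
    let ?f = "\<lambda>\<xi>. ennreal ((norm (fourier w \<xi>))\<^sup>2)"
    let ?c = "\<lambda>k. D * ((1/2) ^ k) powr (q + 1)"
    have piece: "ennreal (?c k) * (\<integral>\<^sup>+\<xi>. ennreal (gauss ((1/2) ^ k * \<tau>) \<xi>) * ?f \<xi> \<partial>lborel)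
        \<le> ennreal (2 * D * L * (1 + t) powr (- q / \<theta>) * A * (1/2) ^ k)" for k :: nat
    proof -
      have h: "(1/2::real) ^ k > 0" by simp
      have e: "(((1/2) ^ k * \<tau>) ^ DIM('a)) powr (1 - 2 / m) = ((1/2) ^ k) powr (- q) * \<tau> powr (- q)"
      proof -
        have "(((1/2) ^ k * \<tau>) ^ DIM('a)) powr (1 - 2 / m) = (((1/2) ^ k * \<tau>) powr real DIM('a)) powr (1 - 2 / m)"
          using h \<tau> by (simp only: powr_realpow mult_pos_pos)
        also have "\<dots> = ((1/2) ^ k * \<tau>) powr (- q)" by (simp add: powr_powr q_def algebra_simps)
        finally show ?thesis using h \<tau> by (simp add: powr_mult)
      qed
      have "ennreal (?c k) * (\<integral>\<^sup>+\<xi>. ennreal (gauss ((1/2) ^ k * \<tau>) \<xi>) * ?f \<xi> \<partial>lborel)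
        \<le> ennreal (?c k) * (2 * ennreal (((2 * pi) powr (real DIM('a) / 2) * ((1/2) ^ k * \<tau>) ^ DIM('a)) powr (1 - 2 / m) * A))"
        unfolding A_def using h \<tau> by (intro mult_left_mono fourier_gauss_bound_Lm m w2 wm mult_pos_pos) auto
      also have "\<dots> = ennreal (?c k * (2 * (L * (((1/2) ^ k) powr (- q) * \<tau> powr (- q)) * A)))"
      proof -
        have "((2 * pi) powr (real DIM('a) / 2) * ((1/2) ^ k * \<tau>) ^ DIM('a)) powr (1 - 2 / m)
            = L * (((1/2) ^ k) powr (- q) * \<tau> powr (- q))"
          unfolding L_def e[symmetric] using h \<tau> by (intro powr_mult)
        moreover have "2 * ennreal x = ennreal (2 * x)" if "x \<ge> 0" for x :: real
          using that by (simp add: ennreal_mult)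
        ultimately show ?thesis using A L D(1)
          by (simp add: ennreal_mult[symmetric] del: powr_minus)
      qed
      also have "?c k * (2 * (L * (((1/2) ^ k) powr (- q) * \<tau> powr (- q)) * A))
          = 2 * D * L * \<tau> powr (- q) * A * (((1/2) ^ k) powr (q + 1) * ((1/2) ^ k) powr (- q))"
        by (simp only: mult_ac)
      also have "((1/2) ^ k) powr (q + 1) * ((1/2) ^ k) powr (- q) = (1/2::real) ^ k"
        by (subst powr_add[symmetric]) simp
      finally show ?thesis unfolding \<tau>q .
    qed
    have "(\<integral>\<^sup>+\<xi>. ennreal (exp (- (norm \<xi> powr \<theta> * (1 + t)) / 4)) * ?f \<xi> \<partial>lborel)
        \<le> (\<integral>\<^sup>+\<xi>. (\<Sum>k. ennreal (?c k) * (ennreal (gauss ((1/2) ^ k * \<tau>) \<xi>) * ?f \<xi>)) \<partial>lborel)"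
    proof (rule nn_integral_mono)
      fix \<xi> :: 'a
      define \<rho> where "\<rho> = \<tau> * norm \<xi>"
      have \<rho>: "\<rho> \<ge> 0" using \<tau> by (simp add: \<rho>_def)
      have "\<rho> powr \<theta> = norm \<xi> powr \<theta> * (1 + t)"
        using \<tau> t \<theta> by (simp add: \<rho>_def powr_mult \<tau>_def powr_powr)
      with D(2)[OF \<rho>] obtain k :: nat where
        "exp (- (norm \<xi> powr \<theta> * (1 + t)) / 4) \<le> ?c k * exp (- ((1/2) ^ k * \<rho>)\<^sup>2 / 2)" by auto
      also have "exp (- ((1/2) ^ k * \<rho>)\<^sup>2 / 2) = gauss ((1/2) ^ k * \<tau>) \<xi>" by (simp add: gauss_def \<rho>_def mult.assoc)
      finally have "ennreal (exp (- (norm \<xi> powr \<theta> * (1 + t)) / 4)) * ?f \<xi>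
          \<le> ennreal (?c k * gauss ((1/2) ^ k * \<tau>) \<xi>) * ?f \<xi>"
        by (intro mult_right_mono ennreal_leI) auto
      also have "\<dots> = ennreal (?c k) * (ennreal (gauss ((1/2) ^ k * \<tau>) \<xi>) * ?f \<xi>)"
        using D(1) by (simp add: ennreal_mult mult.assoc)
      also have "\<dots> \<le> (\<Sum>k. ennreal (?c k) * (ennreal (gauss ((1/2) ^ k * \<tau>) \<xi>) * ?f \<xi>))"
        by (rule ennreal_term_le_suminf)
      finally show "ennreal (exp (- (norm \<xi> powr \<theta> * (1 + t)) / 4)) * ?f \<xi>
          \<le> (\<Sum>k. ennreal (?c k) * (ennreal (gauss ((1/2) ^ k * \<tau>) \<xi>) * ?f \<xi>))" .
    qed
    also have "\<dots> = (\<Sum>k. ennreal (?c k) * (\<integral>\<^sup>+\<xi>. ennreal (gauss ((1/2) ^ k * \<tau>) \<xi>) * ?f \<xi> \<partial>lborel))"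
      by (simp add: nn_integral_suminf nn_integral_cmult)
    also have "\<dots> \<le> (\<Sum>k. ennreal (2 * D * L * (1 + t) powr (- q / \<theta>) * A * (1/2) ^ k))"
      by (intro suminf_le piece) auto
    also have "\<dots> = ennreal (\<Sum>k. 2 * D * L * (1 + t) powr (- q / \<theta>) * A * (1/2) ^ k)"
      using D(1) L A by (intro suminf_ennreal2 summable_mult summable_geometric) auto
    also have "(\<Sum>k. 2 * D * L * (1 + t) powr (- q / \<theta>) * A * (1/2) ^ k)
        = 2 * D * L * (1 + t) powr (- q / \<theta>) * A * 2"
      by (subst suminf_mult) (auto simp: suminf_geometric)
    finally show "(\<integral>\<^sup>+\<xi>. ennreal (exp (- (norm \<xi> powr \<theta> * (1 + t)) / 4)) * ?f \<xi> \<partial>lborel)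
      \<le> ennreal (4 * D * L * (1 + t) powr (- (real DIM('a) * (2 / m - 1)) / \<theta>) * (Lp_norm m w)\<^sup>2)"
      by (simp add: A_def q_def mult_ac)
  qed
qed

section \<open>Decay estimates for the solution\<close>

lemma norm_bessel_weight: "norm (bessel_weight s f \<xi>) = (1 + (norm \<xi>)\<^sup>2) powr (s / 2) * norm (fourier f \<xi>)"
  by (simp add: bessel_weight_def norm_mult)

lemma bessel_weight_measurable [measurable]:
  assumes "f \<in> Lp 2"
  shows "bessel_weight s f \<in> borel_measurable borel"
proof -
  note [measurable] = fourier_Lp2[OF assms, THEN Lp2_measurable]
  show ?thesis unfolding bessel_weight_def[abs_def] by measurable
qed

lemma bessel_weight_mono: "s \<le> s' \<Longrightarrow> norm (bessel_weight s f \<xi>) \<le> norm (bessel_weight s' f \<xi>)"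
  unfolding norm_bessel_weight by (intro mult_right_mono powr_mono) auto

lemma Hs_mono: "s \<le> s' \<Longrightarrow> Hs s' \<subseteq> Hs s"
  by (auto simp: Hs_def intro!: Lp2_bound[of "bessel_weight s' _" "bessel_weight s _"] bessel_weight_measurable bessel_weight_mono)

lemma Hs_norm_sq: "w \<in> Hs s \<Longrightarrow> nsq (bessel_weight s w) = ennreal ((Hs_norm s w)\<^sup>2)"
  by (auto simp: Hs_def Hs_norm_def Lp_norm_2 bessel_weight_measurable Lp2_iff)

lemma Hs_norm_nonneg: "0 \<le> Hs_norm s w"
  by (simp add: Hs_norm_def Lp_norm_def)

lemma Lp_norm_nonneg: "0 \<le> Lp_norm p w"
  by (simp add: Lp_norm_def)

text \<open>
  The return from the frequency side: squared norms of the two contributions give a linear bound.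
\<close>

lemma Lp_norm_le_of_fourier:
  assumes f: "is_fourier_L2 v (\<lambda>\<xi>. G0 \<xi> + G1 \<xi>)"
    and [measurable]: "G0 \<in> borel_measurable borel" "G1 \<in> borel_measurable borel"
    and G: "nsq G0 \<le> ennreal (X0\<^sup>2)" "nsq G1 \<le> ennreal (X1\<^sup>2)" and X: "0 \<le> X0" "0 \<le> X1"
  shows "Lp_norm 2 v \<le> 3 * (X0 + X1)"
proof -
  have v: "v \<in> borel_measurable borel" using f by (auto simp: is_fourier_L2_iff)
  have "nsq v \<le> 4 * nsq (\<lambda>\<xi>. G0 \<xi> + G1 \<xi>)" by (rule is_fourier_L2_bound_inverse[OF f])
  also have "nsq (\<lambda>\<xi>. G0 \<xi> + G1 \<xi>) \<le> 2 * nsq G0 + 2 * nsq G1" by (rule nsq_add_le) measurable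
  also have "\<dots> \<le> 2 * ennreal (X0\<^sup>2) + 2 * ennreal (X1\<^sup>2)" by (intro add_mono mult_left_mono G) auto
  also have "4 * (2 * ennreal (X0\<^sup>2) + 2 * ennreal (X1\<^sup>2)) = ennreal (8 * X0\<^sup>2 + 8 * X1\<^sup>2)"
    by (simp add: ennreal_mult algebra_simps)
  also have "8 * X0\<^sup>2 + 8 * X1\<^sup>2 \<le> (3 * (X0 + X1))\<^sup>2"
    using X by (simp add: power2_eq_square algebra_simps)
  finally have "nsq v \<le> ennreal ((3 * (X0 + X1))\<^sup>2)" by (simp add: ennreal_leI mult_left_mono)
  then have "enn2real (nsq v) \<le> (3 * (X0 + X1))\<^sup>2" by (intro enn2real_leI) auto
  then have "sqrt (enn2real (nsq v)) \<le> sqrt ((3 * (X0 + X1))\<^sup>2)" by (rule real_sqrt_le_mono)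
  then show ?thesis using v X by (simp add: Lp_norm_2)
qed

text \<open>
  The contribution of the datum \<open>w\<^sub>l\<close> to the Fourier transform of the \<open>j\<close>-th time derivative of
  \<open>|D|\<^sup>a w\<close>.
\<close>

definition mode :: "real \<Rightarrow> real \<Rightarrow> real \<Rightarrow> nat \<Rightarrow> nat \<Rightarrow> ('a::euclidean_space \<Rightarrow> complex) \<Rightarrow> real \<Rightarrow> 'a \<Rightarrow> complex" where
  "mode \<sigma> \<delta> a j l w t \<xi> = of_real (norm \<xi> powr a) * time_kernel \<sigma> \<delta> j l t (norm \<xi>) * fourier w \<xi>"

lemma mode_measurable [measurable]:
  assumes "w \<in> Lp 2"
  shows "mode \<sigma> \<delta> a j l w t \<in> borel_measurable borel"
proof -
  note [measurable] = fourier_Lp2[OF assms, THEN Lp2_measurable]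
  show ?thesis unfolding mode_def[abs_def] by measurable
qed

lemma mode_deriv:
  "((\<lambda>t. mode \<sigma> \<delta> a 0 l w t \<xi>) has_vector_derivative mode \<sigma> \<delta> a 1 l w t \<xi>) (at t)"
  unfolding mode_def
  by (intro has_vector_derivative_mult_left has_vector_derivative_mult_right time_kernel_deriv)

definition solution_mode ::
  "real \<Rightarrow> real \<Rightarrow> real \<Rightarrow> nat \<Rightarrow> ('a::euclidean_space \<Rightarrow> complex) \<Rightarrow> ('a \<Rightarrow> complex) \<Rightarrow> real \<Rightarrow> 'a \<Rightarrow> complex" where
  "solution_mode \<sigma> \<delta> a j w0 w1 t \<xi> = mode \<sigma> \<delta> a j 0 w0 t \<xi> + mode \<sigma> \<delta> a j 1 w1 t \<xi>"

lemma has_vector_derivative_quotient_seq: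
  fixes f :: "real \<Rightarrow> complex"
  assumes f: "(f has_vector_derivative D) (at t)" and s: "s \<longlonglongrightarrow> t" "\<And>k. s k \<noteq> t"
  shows "(\<lambda>k. (f (s k) - f t) / of_real (s k - t)) \<longlonglongrightarrow> D"
proof -
  have "((\<lambda>y. norm ((f y - f t) - (y - t) *\<^sub>R D) / norm (y - t)) \<longlongrightarrow> 0) (at t)"
    using f unfolding has_vector_derivative_def has_derivative_iff_norm by simp
  moreover have "filterlim s (at t) sequentially" using s by (simp add: filterlim_at)
  ultimately have "(\<lambda>k. norm ((f (s k) - f t) - (s k - t) *\<^sub>R D) / norm (s k - t)) \<longlonglongrightarrow> 0"
    by (rule filterlim_compose)
  moreover have "norm ((f (s k) - f t) - (s k - t) *\<^sub>R D) / norm (s k - t)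
      = norm ((f (s k) - f t) / of_real (s k - t) - D)" for k
  proof -
    have "(f (s k) - f t) / of_real (s k - t) - D = ((f (s k) - f t) - (s k - t) *\<^sub>R D) / of_real (s k - t)"
      using s(2)[of k] by (simp add: diff_divide_distrib scaleR_conv_of_real)
    then show ?thesis by (simp add: norm_divide flip: of_real_diff)
  qed
  ultimately have "(\<lambda>k. norm ((f (s k) - f t) / of_real (s k - t) - D)) \<longlonglongrightarrow> 0" by simp
  then show ?thesis using LIM_zero_iff tendsto_norm_zero_iff by blast
qed

context
  fixes \<sigma> \<delta> :: real
  assumes sd: "\<sigma> \<ge> 1" "0 < \<delta>" "\<delta> < \<sigma> / 2"
begin

private abbreviation "M \<equiv> mode \<sigma> \<delta>"
private abbreviation "S \<equiv> solution_mode \<sigma> \<delta>"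
private abbreviation "sol \<equiv> sobolev_solution \<sigma> \<delta>"

lemma mode_bessel_bound:
  fixes j l :: nat
  assumes a: "a \<ge> 0" and j: "j \<le> 1" and l: "l \<le> 1"
  shows "\<exists>C>0. \<forall>(w::'a::euclidean_space \<Rightarrow> complex) t \<xi>. 0 \<le> t \<longrightarrow>
    norm (M a j l w t \<xi>) \<le> C * (1 + t) powr decay \<sigma> \<delta> a j l * norm (bessel_weight (data_order \<sigma> a j l) w \<xi>)"
proof -
  obtain C where C: "C > 0" "\<And>t r. 0 \<le> t \<Longrightarrow> 0 < r \<Longrightarrow> r powr a * norm (time_kernel \<sigma> \<delta> j l t r)
     \<le> C * (1 + t) powr decay \<sigma> \<delta> a j l *
        (if r \<le> 1 then exp (- (r powr (2 * (\<sigma> - \<delta>)) * (1 + t)) / 8)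
         else (1 + t) powr (- 0) * (1 + r\<^sup>2) powr (data_order \<sigma> a j l / 2))"
    using time_kernel_bound[OF sd a j l, of 0] by blast
  have s0: "0 \<le> data_order \<sigma> a j l" using a sd by (simp add: data_order_def)
  have "norm (M a j l w t \<xi>) \<le> C * (1 + t) powr decay \<sigma> \<delta> a j l * norm (bessel_weight (data_order \<sigma> a j l) w \<xi>)"
    if t: "0 \<le> t" for w :: "'a \<Rightarrow> complex" and t \<xi>
  proof (cases "\<xi> = 0")
    case True
    then show ?thesis using C(1) by (simp add: mode_def)
  next
    case False
    let ?r = "norm \<xi>"
    have W: "1 \<le> (1 + ?r\<^sup>2) powr (data_order \<sigma> a j l / 2)" using s0 by (intro ge_one_powr_ge_zero) auto
    have "(if ?r \<le> 1 then exp (- (?r powr (2 * (\<sigma> - \<delta>)) * (1 + t)) / 8)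
         else (1 + t) powr (- 0) * (1 + ?r\<^sup>2) powr (data_order \<sigma> a j l / 2)) \<le> (1 + ?r\<^sup>2) powr (data_order \<sigma> a j l / 2)"
      using t by (auto intro!: order_trans[OF _ W])
    then have "?r powr a * norm (time_kernel \<sigma> \<delta> j l t ?r) \<le> C * (1 + t) powr decay \<sigma> \<delta> a j l * (1 + ?r\<^sup>2) powr (data_order \<sigma> a j l / 2)"
      using C(1) False by (intro order_trans[OF C(2)[OF t]] mult_left_mono) auto
    then show ?thesis unfolding mode_def norm_bessel_weight
      using mult_right_mono[of _ _ "norm (fourier w \<xi>)"] by (simp add: norm_mult mult.assoc[symmetric])
  qed
  with C(1) show ?thesis by blast
qed

lemma mode_L2_bound:
  fixes j l :: nat
  assumes a: "a \<ge> 0" and j: "j \<le> 1" and l: "l \<le> 1"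
  shows "\<exists>C>0. \<forall>(w::'a::euclidean_space \<Rightarrow> complex) t. w \<in> Hs (data_order \<sigma> a j l) \<longrightarrow> 0 \<le> t \<longrightarrow>
    nsq (M a j l w t) \<le> ennreal ((C * (1 + t) powr decay \<sigma> \<delta> a j l * Hs_norm (data_order \<sigma> a j l) w)\<^sup>2)"
proof -
  obtain C where C: "C > 0" "\<And>(w::'a \<Rightarrow> complex) t \<xi>. 0 \<le> t \<Longrightarrow>
    norm (M a j l w t \<xi>) \<le> C * (1 + t) powr decay \<sigma> \<delta> a j l * norm (bessel_weight (data_order \<sigma> a j l) w \<xi>)"
    using mode_bessel_bound[OF a j l] by blast
  have "nsq (M a j l w t) \<le> ennreal ((C * (1 + t) powr decay \<sigma> \<delta> a j l * Hs_norm (data_order \<sigma> a j l) w)\<^sup>2)"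
    if w: "w \<in> Hs (data_order \<sigma> a j l)" and t: "0 \<le> t" for w :: "'a \<Rightarrow> complex" and t
  proof -
    let ?B = "bessel_weight (data_order \<sigma> a j l) w"
    let ?c = "C * (1 + t) powr decay \<sigma> \<delta> a j l"
    have [measurable]: "?B \<in> borel_measurable borel" using w by (auto simp: Hs_def intro: bessel_weight_measurable)
    have "nsq (M a j l w t) \<le> nsq (\<lambda>\<xi>. complex_of_real ?c * ?B \<xi>)"
      using C t by (intro nsq_mono_AE) (simp add: norm_mult)
    also have "\<dots> = ennreal (?c\<^sup>2) * ennreal ((Hs_norm (data_order \<sigma> a j l) w)\<^sup>2)"
      by (subst nsq_cmult) (use Hs_norm_sq[OF w] C(1) in \<open>auto simp: norm_mult\<close>)
    finally show ?thesis by (simp add: power_mult_distrib ennreal_mult)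
  qed
  with C(1) show ?thesis by blast
qed

text \<open>
  Low frequencies are estimated through \<open>L\<^sup>m\<close>, high frequencies through \<open>H\<^sup>s\<close>; the choice of
  \<open>N\<close> gives both parts the same decay.
\<close>

lemma mode_Lm_bound:
  fixes j l :: nat and m :: real
  assumes a: "a \<ge> 0" and j: "j \<le> 1" and l: "l \<le> 1" and m: "1 \<le> m" "m \<le> 2"
  shows "\<exists>C>0. \<forall>(w::'a::euclidean_space \<Rightarrow> complex) t. w \<in> Lp m \<longrightarrow> w \<in> Hs (data_order \<sigma> a j l) \<longrightarrow> 0 \<le> t \<longrightarrow>
    nsq (M a j l w t) \<le> ennreal ((C * (1 + t) powr (decay \<sigma> \<delta> a j l - real DIM('a) / (2 * (\<sigma> - \<delta>)) * (1 / m - 1 / 2))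
       * Lp_Hs_norm m (data_order \<sigma> a j l) w)\<^sup>2)"
proof -
  \<comment> \<open>half of the exponent in \<open>fourier_low_frequency_Lm\<close>, because norms are squared there\<close>
  define N where "N = real DIM('a) / (2 * (\<sigma> - \<delta>)) * (1 / m - 1 / 2)"
  have \<theta>: "(2 * (\<sigma> - \<delta>)) > 0" using sd by simp
  have N2: "- (real DIM('a) * (2 / m - 1)) / (2 * (\<sigma> - \<delta>)) = - (2 * N)"
    using \<theta> m by (simp add: N_def field_simps)
  obtain C where C: "C > 0" "\<And>t r. 0 \<le> t \<Longrightarrow> 0 < r \<Longrightarrow> r powr a * norm (time_kernel \<sigma> \<delta> j l t r)
     \<le> C * (1 + t) powr decay \<sigma> \<delta> a j l *
        (if r \<le> 1 then exp (- (r powr (2 * (\<sigma> - \<delta>)) * (1 + t)) / 8)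
         else (1 + t) powr (- N) * (1 + r\<^sup>2) powr (data_order \<sigma> a j l / 2))"
    using time_kernel_bound[OF sd a j l, of N] by blast
  obtain D where D: "D > 0" "\<And>(w::'a \<Rightarrow> complex) t. w \<in> Lp 2 \<Longrightarrow> w \<in> Lp m \<Longrightarrow> 0 \<le> t \<Longrightarrow>
    (\<integral>\<^sup>+\<xi>. ennreal (exp (- (norm \<xi> powr (2 * (\<sigma> - \<delta>)) * (1 + t)) / 4)) * ennreal ((norm (fourier w \<xi>))\<^sup>2) \<partial>lborel)
    \<le> ennreal (D * (1 + t) powr (- (2 * N)) * (Lp_norm m w)\<^sup>2)"
    using fourier_low_frequency_Lm[OF m \<theta>, where 'a='a] unfolding N2 by blast
  define K where "K = sqrt (C\<^sup>2 * (1 + D))"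
  have K: "K > 0" using C(1) D(1) by (simp add: K_def)
  have K2: "K\<^sup>2 = C\<^sup>2 * (1 + D)" using D(1) by (simp add: K_def)
  have "nsq (M a j l w t) \<le> ennreal ((K * (1 + t) powr (decay \<sigma> \<delta> a j l - N) * Lp_Hs_norm m (data_order \<sigma> a j l) w)\<^sup>2)"
    if wm: "w \<in> Lp m" and w: "w \<in> Hs (data_order \<sigma> a j l)" and t: "0 \<le> t" for w :: "'a \<Rightarrow> complex" and t
  proof -
    let ?s = "data_order \<sigma> a j l"
    have w2: "w \<in> Lp 2" using w by (simp add: Hs_def)
    note [measurable] = fourier_Lp2[OF w2, THEN Lp2_measurable] bessel_weight_measurable[OF w2]
    define c where "c = C * (1 + t) powr decay \<sigma> \<delta> a j l"
    define d where "d = (1 + t) powr (- N)"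
    have c: "c > 0" using C(1) t by (simp add: c_def)
    have d: "d > 0" using t by (simp add: d_def)
    have d2: "d\<^sup>2 = (1 + t) powr (- (2 * N))" by (simp add: d_def power2_eq_square flip: powr_add)
    define e where "e \<xi> = exp (- (norm \<xi> powr (2 * (\<sigma> - \<delta>)) * (1 + t)) / 4)" for \<xi> :: 'a
    have pw: "(norm (M a j l w t \<xi>))\<^sup>2
        \<le> c\<^sup>2 * (e \<xi> * (norm (fourier w \<xi>))\<^sup>2 + d\<^sup>2 * (norm (bessel_weight ?s w \<xi>))\<^sup>2)" for \<xi>
    proof (cases "\<xi> = 0")
      case True
      then show ?thesis by (simp add: mode_def e_def)
    next
      case False
      define r where "r = norm \<xi>"
      have r: "r > 0" using False by (simp add: r_def)
      define F where "F = norm (fourier w \<xi>)"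
      define W where "W = (1 + r\<^sup>2) powr (?s / 2)"
      have eq: "norm (M a j l w t \<xi>) = (r powr a * norm (time_kernel \<sigma> \<delta> j l t r)) * F"
        by (simp add: mode_def norm_mult r_def F_def)
      have bq: "norm (bessel_weight ?s w \<xi>) = W * F" by (simp add: norm_bessel_weight W_def F_def r_def)
      have ee: "(exp (- (r powr (2 * (\<sigma> - \<delta>)) * (1 + t)) / 8))\<^sup>2 = e \<xi>"
        by (simp add: e_def r_def power2_eq_square mult_exp_exp)
      have le: "r powr a * norm (time_kernel \<sigma> \<delta> j l t r) \<le> c * (if r \<le> 1 then exp (- (r powr (2 * (\<sigma> - \<delta>)) * (1 + t)) / 8) else d * W)"
        using C(2)[OF t r] unfolding c_def d_def W_def .
      have "(norm (M a j l w t \<xi>))\<^sup>2 \<le> (c * (if r \<le> 1 then exp (- (r powr (2 * (\<sigma> - \<delta>)) * (1 + t)) / 8) else d * W) * F)\<^sup>2"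
        unfolding eq by (intro power_mono mult_right_mono le) (auto simp: F_def)
      also have "\<dots> = c\<^sup>2 * ((if r \<le> 1 then e \<xi> else (d * W)\<^sup>2) * F\<^sup>2)"
        by (simp add: power_mult_distrib ee[symmetric] mult_ac)
      also have "\<dots> \<le> c\<^sup>2 * (e \<xi> * F\<^sup>2 + (d * W)\<^sup>2 * F\<^sup>2)"
        by (intro mult_left_mono) (auto simp: e_def)
      also have "\<dots> = c\<^sup>2 * (e \<xi> * F\<^sup>2 + d\<^sup>2 * (W * F)\<^sup>2)" by (simp add: power_mult_distrib)
      finally show ?thesis unfolding bq F_def .
    qed
    have [measurable]: "e \<in> borel_measurable borel" unfolding e_def[abs_def] by measurable
    have e0: "0 \<le> e \<xi>" for \<xi> by (simp add: e_def)
    let ?Hn = "Hs_norm ?s w" and ?Ln = "Lp_norm m w"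
    have "nsq (M a j l w t) \<le> (\<integral>\<^sup>+\<xi>. ennreal (c\<^sup>2) * (ennreal (e \<xi>) * ennreal ((norm (fourier w \<xi>))\<^sup>2)
        + ennreal (d\<^sup>2) * ennreal ((norm (bessel_weight ?s w \<xi>))\<^sup>2)) \<partial>lborel)"
      unfolding nsq_def
      by (intro nn_integral_mono) (use pw e0 in \<open>simp flip: ennreal_mult ennreal_plus add: ennreal_leI\<close>)
    also have "\<dots> = ennreal (c\<^sup>2) * ((\<integral>\<^sup>+\<xi>. ennreal (e \<xi>) * ennreal ((norm (fourier w \<xi>))\<^sup>2) \<partial>lborel)
        + ennreal (d\<^sup>2) * nsq (bessel_weight ?s w))"
      by (simp add: nn_integral_cmult nn_integral_add nsq_def)
    also have "\<dots> \<le> ennreal (c\<^sup>2) * (ennreal (D * d\<^sup>2 * ?Ln\<^sup>2) + ennreal (d\<^sup>2) * ennreal (?Hn\<^sup>2))"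
      unfolding Hs_norm_sq[OF w] d2 e_def by (intro mult_left_mono add_right_mono D(2) w2 wm t) auto
    also have "\<dots> = ennreal (c\<^sup>2 * (D * d\<^sup>2 * ?Ln\<^sup>2 + d\<^sup>2 * ?Hn\<^sup>2))"
      using D(1) by (simp flip: ennreal_mult ennreal_plus)
    also have "\<dots> \<le> ennreal ((K * (1 + t) powr (decay \<sigma> \<delta> a j l - N) * Lp_Hs_norm m ?s w)\<^sup>2)"
    proof (rule ennreal_leI)
      have cd: "(1 + t) powr (decay \<sigma> \<delta> a j l - N) = (1 + t) powr decay \<sigma> \<delta> a j l * d" by (simp add: d_def flip: powr_add)
      have sq: "D * ?Ln\<^sup>2 + ?Hn\<^sup>2 \<le> (1 + D) * (?Ln + ?Hn)\<^sup>2"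
      proof -
        have "?Ln\<^sup>2 \<le> (?Ln + ?Hn)\<^sup>2" "?Hn\<^sup>2 \<le> (?Ln + ?Hn)\<^sup>2"
          by (intro power_mono; simp add: Lp_norm_nonneg Hs_norm_nonneg)+
        then have "D * ?Ln\<^sup>2 + ?Hn\<^sup>2 \<le> D * (?Ln + ?Hn)\<^sup>2 + (?Ln + ?Hn)\<^sup>2"
          using D(1) by (intro add_mono mult_left_mono) auto
        then show ?thesis by (simp add: algebra_simps)
      qed
      have "c\<^sup>2 * (D * d\<^sup>2 * ?Ln\<^sup>2 + d\<^sup>2 * ?Hn\<^sup>2) = (c\<^sup>2 * d\<^sup>2) * (D * ?Ln\<^sup>2 + ?Hn\<^sup>2)" by (simp add: algebra_simps)
      also have "\<dots> \<le> (c\<^sup>2 * d\<^sup>2) * ((1 + D) * (?Ln + ?Hn)\<^sup>2)" by (intro mult_left_mono sq) auto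
      also have "\<dots> = (K * (1 + t) powr (decay \<sigma> \<delta> a j l - N) * Lp_Hs_norm m ?s w)\<^sup>2"
        unfolding cd Lp_Hs_norm_def power_mult_distrib K2 c_def by (simp only: mult_ac)
      finally show "c\<^sup>2 * (D * d\<^sup>2 * ?Ln\<^sup>2 + d\<^sup>2 * ?Hn\<^sup>2)
        \<le> (K * (1 + t) powr (decay \<sigma> \<delta> a j l - N) * Lp_Hs_norm m ?s w)\<^sup>2" .
    qed
    finally show ?thesis .
  qed
  with K show ?thesis unfolding N_def by blast
qed

lemma data_order_mono: "data_order \<sigma> a 0 l \<le> data_order \<sigma> a j l"
proof -
  have "0 \<le> real j * \<sigma>" using sd by simp
  moreover have "a + (real 0 - 1) * \<sigma> \<le> a + (real j - 1) * \<sigma>"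
    using sd by (intro add_left_mono mult_right_mono) auto
  ultimately show ?thesis unfolding data_order_def by (cases "l = 0") (auto intro: max.mono)
qed

lemma mode_Lp2:
  fixes j l :: nat
  assumes a: "a \<ge> 0" and j: "j \<le> 1" and l: "l \<le> 1" and w: "w \<in> Hs (data_order \<sigma> a j l)" and t: "0 \<le> t"
  shows "M a j l w t \<in> Lp 2"
proof -
  have w2: "w \<in> Lp 2" using w by (simp add: Hs_def)
  obtain C where "nsq (M a j l w t) \<le> ennreal ((C * (1 + t) powr decay \<sigma> \<delta> a j l * Hs_norm (data_order \<sigma> a j l) w)\<^sup>2)"
    using mode_L2_bound[OF a j l] w t by blast
  then show ?thesis using mode_measurable[OF w2] by (auto simp: Lp2_iff intro: le_less_trans)
qed

text \<open>
  The mean value theorem at each frequency. On bounded time intervals the derivative is dominated by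
  the Bessel weight of the datum, which is square integrable.
\<close>

lemma mode_lipschitz:
  fixes l :: nat
  assumes a: "a \<ge> 0" and l: "l \<le> 1"
  shows "\<exists>C>0. \<forall>(w::'a::euclidean_space \<Rightarrow> complex) T \<xi> s t. 0 \<le> s \<longrightarrow> s \<le> T \<longrightarrow> 0 \<le> t \<longrightarrow> t \<le> T \<longrightarrow>
    norm (M a 1 l w t \<xi>) \<le> C * (1 + T) * norm (bessel_weight (data_order \<sigma> a 1 l) w \<xi>) \<and>
    norm (M a 0 l w s \<xi> - M a 0 l w t \<xi>) \<le> C * (1 + T) * norm (bessel_weight (data_order \<sigma> a 1 l) w \<xi>) * \<bar>s - t\<bar>"
proof -
  obtain C where C: "C > 0" "\<And>(w::'a \<Rightarrow> complex) t \<xi>. 0 \<le> t \<Longrightarrow>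
    norm (M a 1 l w t \<xi>) \<le> C * (1 + t) powr decay \<sigma> \<delta> a 1 l * norm (bessel_weight (data_order \<sigma> a 1 l) w \<xi>)"
    using mode_bessel_bound[OF a _ l, of 1] by blast
  have bd: "norm (M a 1 l w t \<xi>) \<le> C * (1 + T) * norm (bessel_weight (data_order \<sigma> a 1 l) w \<xi>)"
    if "0 \<le> t" "t \<le> T" for w :: "'a \<Rightarrow> complex" and T t \<xi>
  proof -
    have "(a + 2 * real 1 * \<delta>) / (2 * (\<sigma> - \<delta>)) \<ge> 0" using a sd by (intro divide_nonneg_nonneg) auto
    then have "decay \<sigma> \<delta> a 1 l \<le> 1" using l by simp
    then have "(1 + t) powr decay \<sigma> \<delta> a 1 l \<le> (1 + t) powr 1" using that by (intro powr_mono) auto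
    also have "\<dots> \<le> 1 + T" using that by simp
    finally have "C * (1 + t) powr decay \<sigma> \<delta> a 1 l * norm (bessel_weight (data_order \<sigma> a 1 l) w \<xi>)
      \<le> C * (1 + T) * norm (bessel_weight (data_order \<sigma> a 1 l) w \<xi>)"
      using C(1) by (intro mult_right_mono mult_left_mono) auto
    with C(2)[OF that(1), of w \<xi>] show ?thesis by linarith
  qed
  moreover have "norm (M a 0 l w s \<xi> - M a 0 l w t \<xi>) \<le> C * (1 + T) * norm (bessel_weight (data_order \<sigma> a 1 l) w \<xi>) * \<bar>s - t\<bar>"
    if "0 \<le> s" "s \<le> T" "0 \<le> t" "t \<le> T" for w :: "'a \<Rightarrow> complex" and T \<xi> s t
    unfolding real_norm_def[symmetric]
  proof (rule differentiable_bound[where S="{0..T}" and f'="\<lambda>\<tau> h. h *\<^sub>R M a 1 l w \<tau> \<xi>"])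
    show "((\<lambda>\<tau>. M a 0 l w \<tau> \<xi>) has_derivative (\<lambda>h. h *\<^sub>R M a 1 l w \<tau> \<xi>)) (at \<tau> within {0..T})" for \<tau>
      using has_vector_derivative_at_within[OF mode_deriv] unfolding has_vector_derivative_def by blast
    show "onorm (\<lambda>h. h *\<^sub>R M a 1 l w \<tau> \<xi>) \<le> C * (1 + T) * norm (bessel_weight (data_order \<sigma> a 1 l) w \<xi>)"
      if "\<tau> \<in> {0..T}" for \<tau>
      using that bd[of \<tau> T w \<xi>] by (intro onorm_le) (simp add: mult.commute mult_left_mono)
  qed (use that in auto)
  ultimately show ?thesis using C(1) by blast
qed

lemma solution_mode_Lp2:
  assumes a: "a \<ge> 0" and j: "j \<le> 1" and w0: "w0 \<in> Hs (data_order \<sigma> a j 0)" and w1: "w1 \<in> Hs (data_order \<sigma> a j 1)" and t: "0 \<le> t"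
  shows "S a j w0 w1 t \<in> Lp 2"
  unfolding solution_mode_def[abs_def] by (intro Lp2_add mode_Lp2 a j w0 w1 t) auto

text \<open>
  The multiplier operators are defined through choices of transforms; uniqueness shows that their
  composition has the expected symbol almost everywhere. The origin has to be left out because
  \<open>0 powr 0 = 0\<close>.
\<close>

lemma abs_D_solution_fourier:
  fixes w0 w1 :: "'a::euclidean_space \<Rightarrow> complex"
  assumes a: "a \<ge> 0" and w0: "w0 \<in> Hs (data_order \<sigma> a 0 0)" and w1: "w1 \<in> Hs (data_order \<sigma> a 0 1)" and t: "0 \<le> t"
  shows "is_fourier_L2 (abs_D a (sol w0 w1 t)) (S a 0 w0 w1 t)"
proof -
  let ?u = "sol w0 w1 t"
  let ?g = "\<lambda>\<xi>. kernel0 \<sigma> \<delta> t (norm \<xi>) * fourier w0 \<xi> + kernel1 \<sigma> \<delta> t (norm \<xi>) * fourier w1 \<xi>"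
  have nz: "AE \<xi> in lborel. \<xi> \<noteq> (0::'a)" by (rule AE_lborel_singleton)
  have w: "w0 \<in> Lp 2" "w1 \<in> Lp 2" using w0 w1 by (auto simp: Hs_def)
  note [measurable] = w[THEN fourier_Lp2, THEN Lp2_measurable]
  have d0: "data_order \<sigma> 0 0 l \<le> data_order \<sigma> a 0 l" for l using a sd by (simp add: data_order_def le_max_iff_disj)
  have "S 0 0 w0 w1 t \<in> Lp 2"
    by (rule solution_mode_Lp2) (use Hs_mono[OF d0] w0 w1 t in auto)
  then have g: "?g \<in> Lp 2"
  proof (rule Lp2_bound)
    show "AE \<xi> in lborel. norm (?g \<xi>) \<le> norm (S 0 0 w0 w1 t \<xi>)"
      using nz by eventually_elim (simp add: solution_mode_def mode_def time_kernel_def)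
  qed measurable
  have u: "is_fourier_L2 ?u ?g"
    unfolding sobolev_solution_def by (rule is_fourier_L2_inv_fourier[OF g])
  then have u2: "?u \<in> Lp 2" by (simp add: is_fourier_L2_iff)
  have "AE \<xi> in lborel. fourier ?u \<xi> = ?g \<xi>"
    using is_fourier_L2_unique[OF is_fourier_L2_fourier[OF u2] u] by simp
  then have eq: "AE \<xi> in lborel. of_real (norm \<xi> powr a) * fourier ?u \<xi> = S a 0 w0 w1 t \<xi>"
    by eventually_elim (simp add: solution_mode_def mode_def time_kernel_def algebra_simps)
  have m: "S a 0 w0 w1 t \<in> Lp 2" by (rule solution_mode_Lp2[OF a _ w0 w1 t]) simp
  note [measurable] = u2[THEN fourier_Lp2, THEN Lp2_measurable]
  have "(\<lambda>\<xi>. of_real (norm \<xi> powr a) * fourier ?u \<xi>) \<in> Lp 2"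
    by (rule Lp2_bound[OF m]) (measurable, use eq in \<open>auto elim!: eventually_mono\<close>)
  from is_fourier_L2_cong_AE[OF is_fourier_L2_inv_fourier[OF this] eq Lp2_measurable[OF m]]
  show ?thesis by (simp add: abs_D_def fourier_multiplier_def)
qed

text \<open>
  Difference quotients converge in \<open>L\<^sup>2\<close>, by dominated convergence with the bound of
  \<open>mode_lipschitz\<close>.
\<close>

lemma mode_quotient:
  fixes w :: "'a::euclidean_space \<Rightarrow> complex" and l :: nat
  assumes a: "a \<ge> 0" and l: "l \<le> 1" and w: "w \<in> Hs (data_order \<sigma> a 1 l)"
    and t: "0 \<le> t" and s: "s \<longlonglongrightarrow> t" "\<And>k. 0 \<le> s k" "\<And>k. s k \<noteq> t"
  shows "(\<lambda>k. nsq (\<lambda>\<xi>. (M a 0 l w (s k) \<xi> - M a 0 l w t \<xi>) / of_real (s k - t) - M a 1 l w t \<xi>)) \<longlonglongrightarrow> 0"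
proof -
  let ?q = "\<lambda>k \<xi>. (M a 0 l w (s k) \<xi> - M a 0 l w t \<xi>) / of_real (s k - t)"
  let ?B = "bessel_weight (data_order \<sigma> a 1 l) w"
  have w2: "w \<in> Lp 2" and B: "?B \<in> Lp 2" using w by (auto simp: Hs_def)
  note [measurable] = mode_measurable[OF w2]
  obtain C where C: "C > 0" "\<And>(w::'a \<Rightarrow> complex) T \<xi> s t. 0 \<le> s \<Longrightarrow> s \<le> T \<Longrightarrow> 0 \<le> t \<Longrightarrow> t \<le> T \<Longrightarrow>
    norm (M a 1 l w t \<xi>) \<le> C * (1 + T) * norm (bessel_weight (data_order \<sigma> a 1 l) w \<xi>) \<and>
    norm (M a 0 l w s \<xi> - M a 0 l w t \<xi>) \<le> C * (1 + T) * norm (bessel_weight (data_order \<sigma> a 1 l) w \<xi>) * \<bar>s - t\<bar>"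
    using mode_lipschitz[OF a l] by blast
  obtain T0 where "\<And>k. norm (s k) \<le> T0"
    using convergent_imp_Bseq[OF convergentI[OF s(1)]] by (auto simp: Bseq_def)
  then have T0: "s k \<le> max T0 t" for k using abs_le_D1[of "s k" T0] by (auto simp: le_max_iff_disj)
  define T where "T = max T0 t"
  have T: "s k \<le> T" "t \<le> T" for k using T0 by (auto simp: T_def)
  define c where "c = C * (1 + T)"
  have c: "c \<ge> 0" using C(1) T t by (simp add: c_def)
  show ?thesis
  proof (rule nsq_dominated[OF _ Lp2_cmult[OF B, of "complex_of_real (2 * c)"]])
    show "AE \<xi> in lborel. norm (?q k \<xi> - M a 1 l w t \<xi>) \<le> norm (complex_of_real (2 * c) * ?B \<xi>)" for k
    proof (rule AE_I2)
      fix \<xi> :: 'a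
      have 1: "norm (M a 1 l w t \<xi>) \<le> c * norm (?B \<xi>)"
        and 0: "norm (M a 0 l w (s k) \<xi> - M a 0 l w t \<xi>) \<le> c * norm (?B \<xi>) * \<bar>s k - t\<bar>"
        using C(2)[OF s(2) T(1) t T(2)] unfolding c_def by blast+
      have "norm (?q k \<xi>) \<le> c * norm (?B \<xi>)"
        using 0 s(3)[of k] by (simp add: norm_divide divide_le_eq flip: of_real_diff)
      with 1 have "norm (?q k \<xi> - M a 1 l w t \<xi>) \<le> 2 * c * norm (?B \<xi>)"
        by (intro order_trans[OF norm_triangle_ineq4]) simp
      also have "\<dots> = norm (complex_of_real (2 * c) * ?B \<xi>)"
        unfolding norm_mult norm_of_real using c by simp
      finally show "norm (?q k \<xi> - M a 1 l w t \<xi>) \<le> norm (complex_of_real (2 * c) * ?B \<xi>)" .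
    qed
    show "AE \<xi> in lborel. (\<lambda>k. ?q k \<xi> - M a 1 l w t \<xi>) \<longlonglongrightarrow> 0"
      by (intro AE_I2 LIM_zero has_vector_derivative_quotient_seq[OF mode_deriv s(1,3)])
  qed measurable
qed

lemma solution_mode_quotient:
  fixes w0 w1 :: "'a::euclidean_space \<Rightarrow> complex"
  assumes a: "a \<ge> 0" and w0: "w0 \<in> Hs (data_order \<sigma> a 1 0)" and w1: "w1 \<in> Hs (data_order \<sigma> a 1 1)"
    and t: "0 \<le> t" and s: "s \<longlonglongrightarrow> t" "\<And>k. 0 \<le> s k" "\<And>k. s k \<noteq> t"
  shows "(\<lambda>k. nsq (\<lambda>\<xi>. (S a 0 w0 w1 (s k) \<xi> - S a 0 w0 w1 t \<xi>) / of_real (s k - t)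
     - S a 1 w0 w1 t \<xi>)) \<longlonglongrightarrow> 0"
proof -
  let ?q = "\<lambda>l w k \<xi>. (M a 0 l w (s k) \<xi> - M a 0 l w t \<xi>) / of_real (s k - t) - M a 1 l w t \<xi>"
  have w: "w0 \<in> Lp 2" "w1 \<in> Lp 2" using w0 w1 by (auto simp: Hs_def)
  note [measurable] = w[THEN mode_measurable]
  have "nsq (\<lambda>\<xi>. ?q 0 w0 k \<xi> + ?q 1 w1 k \<xi>) \<le> 2 * nsq (?q 0 w0 k) + 2 * nsq (?q 1 w1 k)" for k
    by (rule nsq_add_le) measurable
  moreover have "?q 0 w0 k \<xi> + ?q 1 w1 k \<xi>
      = (S a 0 w0 w1 (s k) \<xi> - S a 0 w0 w1 t \<xi>) / of_real (s k - t) - S a 1 w0 w1 t \<xi>" for k \<xi>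
    unfolding solution_mode_def diff_divide_distrib add_divide_distrib by simp
  ultimately have le: "nsq (\<lambda>\<xi>. (S a 0 w0 w1 (s k) \<xi> - S a 0 w0 w1 t \<xi>) / of_real (s k - t)
     - S a 1 w0 w1 t \<xi>) \<le> 2 * nsq (?q 0 w0 k) + 2 * nsq (?q 1 w1 k)" for k
    by (simp only:)
  show ?thesis
  proof (rule tendsto_0_le_ennreal)
    show "(\<lambda>k. 2 * nsq (?q 0 w0 k) + 2 * nsq (?q 1 w1 k)) \<longlonglongrightarrow> 0"
      using tendsto_two_sum_ennreal[OF mode_quotient[OF a zero_le_one w0 t s] mode_quotient[OF a order_refl w1 t s]]
      by (simp only: mult_zero_right add_0)
  qed (intro always_eventually allI le)
qed

text \<open>
  The transform is bounded in both directions, so convergence of difference quotients carries over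
  from the frequency side.
\<close>

lemma solution_time_deriv:
  fixes w0 w1 :: "'a::euclidean_space \<Rightarrow> complex"
  assumes a: "a \<ge> 0" and j: "j \<le> 1"
    and w0: "w0 \<in> Hs (data_order \<sigma> a j 0)" and w1: "w1 \<in> Hs (data_order \<sigma> a j 1)"
  shows "\<exists>v. has_time_deriv j (\<lambda>t. abs_D a (sol w0 w1 t)) v \<and>
    (\<forall>t\<ge>0. is_fourier_L2 (v t) (S a j w0 w1 t))"
proof -
  let ?u = "\<lambda>t. abs_D a (sol w0 w1 t)"
  have w0': "w0 \<in> Hs (data_order \<sigma> a 0 0)" and w1': "w1 \<in> Hs (data_order \<sigma> a 0 1)"
    using Hs_mono[OF data_order_mono[of a _ j]] w0 w1 by blast+
  have u: "is_fourier_L2 (?u t) (S a 0 w0 w1 t)" if "0 \<le> t" for t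
    by (rule abs_D_solution_fourier[OF a w0' w1' that])
  then have u2: "?u t \<in> Lp 2" if "0 \<le> t" for t using that by (simp add: is_fourier_L2_iff)
  have td0: "has_time_deriv 0 ?u ?u" using u2 by simp
  consider "j = 0" | "j = 1" using j by linarith
  then show ?thesis
  proof cases
    case 1
    then show ?thesis using td0 u by blast
  next
    case 2
    define v where "v t = inv_fourier (S a 1 w0 w1 t)" for t
    have v: "is_fourier_L2 (v t) (S a 1 w0 w1 t)" if "0 \<le> t" for t
      unfolding v_def using w0 w1 2 that by (intro is_fourier_L2_inv_fourier solution_mode_Lp2[OF a]) auto
    have "tendsto_Lp 2 (\<lambda>s x. (?u s x - ?u t x) / of_real (s - t)) (v t) (at t within {0..})" if t: "0 \<le> t" for t
    proof -
      have q: "is_fourier_L2 (\<lambda>x. (?u s x - ?u t x) / of_real (s - t) - v t x)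
        (\<lambda>\<xi>. (S a 0 w0 w1 s \<xi> - S a 0 w0 w1 t \<xi>) / of_real (s - t) - S a 1 w0 w1 t \<xi>)"
        if "0 \<le> s" for s
        using is_fourier_L2_diff[OF is_fourier_L2_cmult[OF is_fourier_L2_diff[OF u[OF that] u[OF t]], of "1 / of_real (s - t)"] v[OF t]]
        by (simp del: of_real_diff)
      have ev: "\<forall>\<^sub>F s in at t within {0..}. 0 \<le> s" by (simp add: eventually_at_filter)
      have "\<forall>\<^sub>F s in at t within {0..}. (\<lambda>x. (?u s x - ?u t x) / of_real (s - t) - v t x) \<in> Lp 2"
        using ev by eventually_elim (use q in \<open>auto simp: is_fourier_L2_iff\<close>)
      moreover have "((\<lambda>s. nsq (\<lambda>x. (?u s x - ?u t x) / of_real (s - t) - v t x)) \<longlongrightarrow> 0) (at t within {0..})"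
      proof (rule tendsto_0_le_ennreal)
        let ?q = "\<lambda>s. nsq (\<lambda>\<xi>. (S a 0 w0 w1 s \<xi> - S a 0 w0 w1 t \<xi>) / of_real (s - t) - S a 1 w0 w1 t \<xi>)"
        show "\<forall>\<^sub>F s in at t within {0..}. nsq (\<lambda>x. (?u s x - ?u t x) / of_real (s - t) - v t x) \<le> 4 * ?q s"
          using ev by eventually_elim (rule is_fourier_L2_bound_inverse[OF q])
        have "(?q \<longlongrightarrow> 0) (at t within {0..})"
          unfolding tendsto_at_iff_sequentially comp_def
          using solution_mode_quotient[OF a _ _ t] w0 w1 2 by auto
        from ennreal_tendsto_cmult[OF _ this, of 4] show "((\<lambda>s. 4 * ?q s) \<longlongrightarrow> 0) (at t within {0..})" by simp
      qed
      ultimately show ?thesis unfolding tendsto_Lp2_iff by blast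
    qed
    moreover have "v t \<in> Lp 2" if "0 \<le> t" for t using v[OF that] by (simp add: is_fourier_L2_iff)
    ultimately have "has_time_deriv 1 ?u v" using td0 by (auto simp del: has_time_deriv.simps(1))
    then show ?thesis using v 2 by blast
  qed
qed

end

theorem proposition2p2:
  fixes \<sigma> \<delta> m a :: real and j :: nat
  assumes "\<sigma> \<ge> 1" and "0 < \<delta>" and "\<delta> < \<sigma> / 2"
    and "1 \<le> m" and "m < 2" and "a \<ge> 0" and "j \<in> {0, 1}"
  shows
    "(\<exists>C>0. \<forall>(w\<^sub>0 :: real ^ 'n \<Rightarrow> complex) (w\<^sub>1 :: real ^ 'n \<Rightarrow> complex).
        w\<^sub>0 \<in> Lp m \<inter> Hs (a + real j * \<sigma>) \<longrightarrow>
        w\<^sub>1 \<in> Lp m \<inter> Hs (max (a + (real j - 1) * \<sigma>) 0) \<longrightarrow>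
        (\<exists>v. has_time_deriv j (\<lambda>t. abs_D a (sobolev_solution \<sigma> \<delta> w\<^sub>0 w\<^sub>1 t)) v \<and>
          (\<forall>t\<ge>0. Lp_norm 2 (v t) \<le> C *
             ((1 + t) powr (- (real CARD('n) / (2 * (\<sigma> - \<delta>))) * (1 / m - 1 / 2)
                              - (a + 2 * real j * \<delta>) / (2 * (\<sigma> - \<delta>)))
                * Lp_Hs_norm m (a + real j * \<sigma>) w\<^sub>0
              + (1 + t) powr (1 - (real CARD('n) / (2 * (\<sigma> - \<delta>))) * (1 / m - 1 / 2)
                              - (a + 2 * real j * \<delta>) / (2 * (\<sigma> - \<delta>)))
                * Lp_Hs_norm m (max (a + (real j - 1) * \<sigma>) 0) w\<^sub>1))))
     \<and>
     (\<exists>C>0. \<forall>(w\<^sub>0 :: real ^ 'n \<Rightarrow> complex) (w\<^sub>1 :: real ^ 'n \<Rightarrow> complex).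
        w\<^sub>0 \<in> Hs (a + real j * \<sigma>) \<longrightarrow>
        w\<^sub>1 \<in> Hs (max (a + (real j - 1) * \<sigma>) 0) \<longrightarrow>
        (\<exists>v. has_time_deriv j (\<lambda>t. abs_D a (sobolev_solution \<sigma> \<delta> w\<^sub>0 w\<^sub>1 t)) v \<and>
          (\<forall>t\<ge>0. Lp_norm 2 (v t) \<le> C *
             ((1 + t) powr (- (a + 2 * real j * \<delta>) / (2 * (\<sigma> - \<delta>)))
                * Hs_norm (a + real j * \<sigma>) w\<^sub>0
              + (1 + t) powr (1 - (a + 2 * real j * \<delta>) / (2 * (\<sigma> - \<delta>)))
                * Hs_norm (max (a + (real j - 1) * \<sigma>) 0) w\<^sub>1))))"
proof -
  note sd = assms(1-3)
  have m: "1 \<le> m" "m \<le> 2" and a: "a \<ge> 0" and j: "j \<le> 1" using assms by auto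
  let ?N = "real CARD('n) / (2 * (\<sigma> - \<delta>)) * (1 / m - 1 / 2)"
  let ?e = "(a + 2 * real j * \<delta>) / (2 * (\<sigma> - \<delta>))"
  have orders: "a + real j * \<sigma> = data_order \<sigma> a j 0" "max (a + (real j - 1) * \<sigma>) 0 = data_order \<sigma> a j 1"
    by (simp_all add: data_order_def)
  have dim: "real DIM(real ^ 'n) = real CARD('n)" by simp
  \<comment> \<open>Both estimates have this shape; they differ in the class of data, the norms and the exponents.\<close>
  have combine: "\<exists>C>0. \<forall>(w0::real ^ 'n \<Rightarrow> complex) w1. w0 \<in> A \<inter> Hs (data_order \<sigma> a j 0) \<longrightarrow> w1 \<in> A \<inter> Hs (data_order \<sigma> a j 1) \<longrightarrow>
     (\<exists>v. has_time_deriv j (\<lambda>t. abs_D a (sobolev_solution \<sigma> \<delta> w0 w1 t)) v \<and>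
      (\<forall>t\<ge>0. Lp_norm 2 (v t) \<le> C * ((1 + t) powr e0 * nrm 0 w0 + (1 + t) powr e1 * nrm 1 w1)))"
    if C0: "\<exists>C>0. \<forall>(w::real ^ 'n \<Rightarrow> complex) t. w \<in> A \<longrightarrow> w \<in> Hs (data_order \<sigma> a j 0) \<longrightarrow> 0 \<le> t \<longrightarrow>
      nsq (mode \<sigma> \<delta> a j 0 w t) \<le> ennreal ((C * (1 + t) powr e0 * nrm 0 w)\<^sup>2)"
    and C1: "\<exists>C>0. \<forall>(w::real ^ 'n \<Rightarrow> complex) t. w \<in> A \<longrightarrow> w \<in> Hs (data_order \<sigma> a j 1) \<longrightarrow> 0 \<le> t \<longrightarrow>
      nsq (mode \<sigma> \<delta> a j 1 w t) \<le> ennreal ((C * (1 + t) powr e1 * nrm 1 w)\<^sup>2)"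
    and nrm: "\<And>l w. 0 \<le> nrm l w"
    for A :: "(real ^ 'n \<Rightarrow> complex) set" and nrm :: "nat \<Rightarrow> (real ^ 'n \<Rightarrow> complex) \<Rightarrow> real" and e0 e1
  proof -
    obtain C0 where C0: "C0 > 0" "\<And>(w::real ^ 'n \<Rightarrow> complex) t. w \<in> A \<Longrightarrow> w \<in> Hs (data_order \<sigma> a j 0) \<Longrightarrow> 0 \<le> t \<Longrightarrow>
      nsq (mode \<sigma> \<delta> a j 0 w t) \<le> ennreal ((C0 * (1 + t) powr e0 * nrm 0 w)\<^sup>2)" using C0 by blast
    obtain C1 where C1: "C1 > 0" "\<And>(w::real ^ 'n \<Rightarrow> complex) t. w \<in> A \<Longrightarrow> w \<in> Hs (data_order \<sigma> a j 1) \<Longrightarrow> 0 \<le> t \<Longrightarrow>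
      nsq (mode \<sigma> \<delta> a j 1 w t) \<le> ennreal ((C1 * (1 + t) powr e1 * nrm 1 w)\<^sup>2)" using C1 by blast
    show ?thesis
    proof (intro exI[of _ "3 * (C0 + C1)"] conjI allI impI)
      show "3 * (C0 + C1) > 0" using C0(1) C1(1) by simp
      fix w0 w1 :: "real ^ 'n \<Rightarrow> complex"
      assume w0: "w0 \<in> A \<inter> Hs (data_order \<sigma> a j 0)" and w1: "w1 \<in> A \<inter> Hs (data_order \<sigma> a j 1)"
      then have w: "w0 \<in> Lp 2" "w1 \<in> Lp 2" by (auto simp: Hs_def)
      obtain v where v: "has_time_deriv j (\<lambda>t. abs_D a (sobolev_solution \<sigma> \<delta> w0 w1 t)) v"
        and vf: "\<And>t. 0 \<le> t \<Longrightarrow> is_fourier_L2 (v t) (solution_mode \<sigma> \<delta> a j w0 w1 t)"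
        using solution_time_deriv[OF sd a j] w0 w1 by blast
      have "Lp_norm 2 (v t) \<le> 3 * (C0 + C1) * ((1 + t) powr e0 * nrm 0 w0 + (1 + t) powr e1 * nrm 1 w1)"
        if t: "0 \<le> t" for t
      proof -
        let ?x = "(1 + t) powr e0 * nrm 0 w0" and ?y = "(1 + t) powr e1 * nrm 1 w1"
        have xy: "0 \<le> ?x" "0 \<le> ?y" using nrm by auto
        have "Lp_norm 2 (v t) \<le> 3 * (C0 * (1 + t) powr e0 * nrm 0 w0 + C1 * (1 + t) powr e1 * nrm 1 w1)"
          by (rule Lp_norm_le_of_fourier[OF vf[OF t, unfolded solution_mode_def[abs_def]]])
             (use w0 w1 t C0 C1 nrm w mode_measurable in auto)
        also have "\<dots> = 3 * (C0 * ?x + C1 * ?y)" by (simp only: mult.assoc)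
        also have "\<dots> \<le> 3 * ((C0 + C1) * ?x + (C0 + C1) * ?y)"
          using xy C0(1) C1(1) by (intro mult_left_mono add_mono mult_right_mono) auto
        finally show ?thesis by (simp add: algebra_simps)
      qed
      with v show "\<exists>v. has_time_deriv j (\<lambda>t. abs_D a (sobolev_solution \<sigma> \<delta> w0 w1 t)) v \<and>
        (\<forall>t\<ge>0. Lp_norm 2 (v t) \<le> 3 * (C0 + C1) * ((1 + t) powr e0 * nrm 0 w0 + (1 + t) powr e1 * nrm 1 w1))"
        by blast
    qed
  qed
  have alg: "real 0 - e - k * x = - k * x - e" "real 1 - e - k * x = 1 - k * x - e"
    "real 0 - x / k = - x / k" "real 1 - e = 1 - e" for e k x :: real
    by simp_all
  have ex: "real 0 - ?e - ?N = - (real CARD('n) / (2 * (\<sigma> - \<delta>))) * (1 / m - 1 / 2) - ?e"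
    "real 1 - ?e - ?N = 1 - (real CARD('n) / (2 * (\<sigma> - \<delta>))) * (1 / m - 1 / 2) - ?e"
    "real 0 - ?e = - (a + 2 * real j * \<delta>) / (2 * (\<sigma> - \<delta>))" "real 1 - ?e = 1 - ?e"
    by (rule alg)+
  have Lm: "\<exists>C>0. \<forall>(w::real ^ 'n \<Rightarrow> complex) t. w \<in> Lp m \<longrightarrow> w \<in> Hs (data_order \<sigma> a j l) \<longrightarrow> 0 \<le> t \<longrightarrow>
      nsq (mode \<sigma> \<delta> a j l w t) \<le> ennreal ((C * (1 + t) powr (real l - ?e - ?N) * Lp_Hs_norm m (data_order \<sigma> a j l) w)\<^sup>2)"
    if "l \<le> 1" for l
    using mode_Lm_bound[OF sd a j that m, where 'a="real ^ 'n"] unfolding dim .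
  have L2: "\<exists>C>0. \<forall>(w::real ^ 'n \<Rightarrow> complex) t. w \<in> UNIV \<longrightarrow> w \<in> Hs (data_order \<sigma> a j l) \<longrightarrow> 0 \<le> t \<longrightarrow>
      nsq (mode \<sigma> \<delta> a j l w t) \<le> ennreal ((C * (1 + t) powr (real l - ?e) * Hs_norm (data_order \<sigma> a j l) w)\<^sup>2)"
    if "l \<le> 1" for l
    using mode_L2_bound[OF sd a j that, where 'a="real ^ 'n"] by simp
  note 1 = combine[where A="Lp m" and nrm="\<lambda>l. Lp_Hs_norm m (data_order \<sigma> a j l)"
      and ?e0.0="real 0 - ?e - ?N" and ?e1.0="real 1 - ?e - ?N", OF Lm[of 0] Lm[of 1]]
  note 2 = combine[where A=UNIV and nrm="\<lambda>l. Hs_norm (data_order \<sigma> a j l)"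
      and ?e0.0="real 0 - ?e" and ?e1.0="real 1 - ?e", OF L2[of 0] L2[of 1]]
  show ?thesis
    unfolding orders
  proof (rule conjI[OF 1[unfolded ex(1,2)] 2[unfolded ex(3,4) Int_UNIV_left]])
  qed (auto simp: Lp_Hs_norm_def Lp_norm_nonneg Hs_norm_nonneg)
qed

end
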